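(* Let $D$ be a generalized Lipschitz domain in a Riemannian manifold $M^n$ satisfying $\partial\overline D=\partial D$. Then the closures of $\mathcal{F}_0(D)\cap W^{1,2}(D)$, $\mathcal{F}_1(D)$ and $\mathcal{F}_c(D)$ in $W^{1,2}(D)$ are the same space $E(D)$. Namely, $$E(D)=W^{1,2}_0(D),$$ and, moreover, $$H(D)=\text{the closure of }\mathcal{G}_c(D)\text{ in }W^{1,2}(D).$$
   Context: Closures and topological boundaries of sets are taken in $M^n$; $dM$ is the Riemannian volume element. Generalized Lipschitz domains. A simple domain in $\mathbb{R}^n$ is an open set diffeomorphic to an $n$-ball. A simple triple $(U,\Gamma,V)$ consists of a simple domain $U\subset\mathbb{R}^n$, an open subset $V$ of a hyperplane $H^{n-1}\subset\mathbb{R}^n$ with $V$ diffeomorphic to an $(n-1)$-ball, and a set $\Gamma\subset\partial U$ of the form $\Gamma=\{(x,u(x))\;;\;x\in V\}$ for a function $u$ on $V$; it is a Lipschitz simple domain if $u$ is Lipschitz. Let $D'$ be a compact $n$-dimensional $C^\infty$-manifold with $C^\infty$-boundary $\partial D'$. A boundary gluing map is a $C^\infty$-map $\rho:D'\to M^n$ whose restriction to $\operatorname{Int}D'$ is a $C^\infty$-diffeomorphism (onto its image) and which maps at most finitely many points of $\partial D'$ to any given point of $M^n$. A family $(U_i',\Gamma_i',V_i')$, $i=1,\dots,\nu$, of simple triples (lying in $\mathbb{R}^n$ through coordinate maps of $D'$) covers $\partial D'$ if the sets $U_i'\cup\Gamma_i'$ are open in $D'$ and cover $\partial D'$, each $\Gamma_i'\subset\partial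 U_i'$ is open in $\partial D'$, and $\Gamma_1'\cup\dots\cup\Gamma_\nu'=\partial D'$. A domain $D\subset M^n$ is a generalized Lipschitz domain if there are a boundary gluing map $\rho:D'\to M^n$ with $D=\rho(\operatorname{Int}D')$ and a family of simple triples $(U_i',\Gamma_i',V_i')$ covering $\partial D'$ such that, with $U_i=\rho(U_i')$, $\Gamma_i=\rho(\Gamma_i')$ and $V_i$ corresponding to $V_i'$, each $(U_i,\Gamma_i,V_i)$ is a Lipschitz simple domain through a coordinate map of $M^n$. Function spaces. For $m=0,1$: $\mathcal{F}_m(D)=\{f\in C^\infty(D)\cap C^m(\overline D)\;;\;f|_{\partial D}=0\}$; $\mathcal{F}_c(D)=\{f\in C^\infty(D)\;;\;\overline{\operatorname{supp}f}\subset D\}$; $\mathcal{G}_0(D)=\{f\in\mathcal{F}_0(D)\;;\;\int_Df\,dM=0\}$; $\mathcal{G}_c(D)=\{g\in C^\infty(D)\;;\;\overline{\operatorname{supp}g}\subset D,\ \int_Dg\,dM=0\}$. $E(D)$ is the closure of $\mathcal{F}_0(D)\cap W^{1,2}(D)$ in $W^{1,2}(D)$, $H(D)$ is the closure of $\mathcal{G}_0(D)\cap W^{1,2}(D)$ in $W^{1,2}(D)$, and $W^{1,2}_0(D)$ is the closure of $\mathcal{F}_c(D)$ in $W^{1,2}(D)$. *)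

theory Defs
  imports "HOL-Analysis.Analysis"
begin

section \<open>Smooth maps between subsets of Euclidean spaces\<close>

text \<open>Meant for open \<open>S\<close>: \<open>f\<close> has continuous derivatives up to order \<open>k\<close>.\<close>

primrec Ck_on :: "nat \<Rightarrow> 'a::euclidean_space set \<Rightarrow> ('a \<Rightarrow> 'b::real_normed_vector) \<Rightarrow> bool" where
  "Ck_on 0 S f = continuous_on S f"
| "Ck_on (Suc k) S f = ((\<forall>x\<in>S. f differentiable (at x)) \<and>
     (\<forall>v. Ck_on k S (\<lambda>x. frechet_derivative f (at x) v)))"

text \<open>Smoothness on an arbitrary set means local extendability to a smooth map on an open set.
  For open \<open>S\<close> this is the usual notion; the general case is needed for relatively open subsets
  of half-spaces and of hyperplanes.\<close>

definition smooth_on :: "'a::euclidean_space set \<Rightarrow> ('a \<Rightarrow> 'b::real_normed_vector) \<Rightarrow> bool" where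
  "smooth_on S f \<longleftrightarrow> (\<forall>x\<in>S. \<exists>W g. open W \<and> x \<in> W \<and> (\<forall>k. Ck_on k W g) \<and> (\<forall>y\<in>S \<inter> W. f y = g y))"

definition diffeomorphic :: "'a::euclidean_space set \<Rightarrow> 'b::euclidean_space set \<Rightarrow> bool" where
  "diffeomorphic S T \<longleftrightarrow> (\<exists>f g. smooth_on S f \<and> smooth_on T g \<and> f ` S = T \<and> g ` T = S \<and>
     (\<forall>x\<in>S. g (f x) = x) \<and> (\<forall>y\<in>T. f (g y) = y))"

section \<open>Smooth manifolds, possibly with boundary\<close>

text \<open>A manifold is a Hausdorff, second countable type together with a (not necessarily maximal)
  smooth atlas. The dimension \<open>n\<close> is \<open>CARD('n)\<close>.\<close>

type_synonym ('m, 'n) chart = "'m set \<times> ('m \<Rightarrow> real ^ 'n)"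

abbreviation chart_dom :: "('m, 'n) chart \<Rightarrow> 'm set" where
  "chart_dom \<equiv> fst"

abbreviation chart_map :: "('m, 'n) chart \<Rightarrow> 'm \<Rightarrow> real ^ 'n" where
  "chart_map \<equiv> snd"

definition chart_inv :: "('m, 'n) chart \<Rightarrow> real ^ 'n \<Rightarrow> 'm" where
  "chart_inv c = inv_into (chart_dom c) (chart_map c)"

definition is_chart :: "('m::topological_space, 'n::finite) chart \<Rightarrow> bool" where
  "is_chart c \<longleftrightarrow> open (chart_dom c) \<and>
     homeomorphism (chart_dom c) (chart_map c ` chart_dom c) (chart_map c) (chart_inv c) \<and>
     (open (chart_map c ` chart_dom c) \<or>
      (\<exists>a b. a \<noteq> 0 \<and> openin (top_of_set {x. b \<le> a \<bullet> x}) (chart_map c ` chart_dom c)))"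

definition smoothly_compatible :: "('m, 'n::finite) chart \<Rightarrow> ('m, 'n) chart \<Rightarrow> bool" where
  "smoothly_compatible c d \<longleftrightarrow>
     smooth_on (chart_map c ` (chart_dom c \<inter> chart_dom d)) (chart_map d \<circ> chart_inv c) \<and>
     smooth_on (chart_map d ` (chart_dom c \<inter> chart_dom d)) (chart_map c \<circ> chart_inv d)"

definition smooth_atlas ::
    "('m::{t2_space, second_countable_topology}, 'n::finite) chart set \<Rightarrow> bool" where
  "smooth_atlas A \<longleftrightarrow> (\<forall>c\<in>A. is_chart c) \<and> (\<Union>c\<in>A. chart_dom c) = UNIV \<and>
     (\<forall>c\<in>A. \<forall>d\<in>A. smoothly_compatible c d)"

text \<open>The maximal atlas generated by \<open>A\<close>.\<close>

definition coordinate_maps ::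
    "('m::topological_space, 'n::finite) chart set \<Rightarrow> ('m, 'n) chart set" where
  "coordinate_maps A = {c. is_chart c \<and> (\<forall>d\<in>A. smoothly_compatible c d)}"

text \<open>For a chart onto a relatively open subset of a half-space, the points of the image that are
  not interior in \<open>\<real>\<^sup>n\<close> are exactly those on the bounding hyperplane.\<close>

definition manifold_boundary :: "('m, 'n::finite) chart set \<Rightarrow> 'm set" where
  "manifold_boundary A =
     {p. \<exists>c\<in>A. p \<in> chart_dom c \<and> chart_map c p \<notin> interior (chart_map c ` chart_dom c)}"

definition manifold_interior :: "('m, 'n::finite) chart set \<Rightarrow> 'm set" where
  "manifold_interior A = - manifold_boundary A"

definition smooth_fun_on :: "('m, 'n::finite) chart set \<Rightarrow> 'm set \<Rightarrow> ('m \<Rightarrow> real) \<Rightarrow> bool" where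
  "smooth_fun_on A S f \<longleftrightarrow>
     (\<forall>c\<in>A. smooth_on (chart_map c ` (chart_dom c \<inter> S)) (f \<circ> chart_inv c))"

definition smooth_map_on :: "('m::topological_space, 'n::finite) chart set \<Rightarrow>
    ('k::topological_space, 'l::finite) chart set \<Rightarrow> 'm set \<Rightarrow> ('m \<Rightarrow> 'k) \<Rightarrow> bool" where
  "smooth_map_on A B S f \<longleftrightarrow> continuous_on S f \<and>
     (\<forall>c\<in>A. \<forall>d\<in>B. smooth_on (chart_map c ` (chart_dom c \<inter> S \<inter> f -` chart_dom d))
        (chart_map d \<circ> f \<circ> chart_inv c))"

section \<open>Generalized Lipschitz domains\<close>

definition simple_domain :: "(real ^ 'n::finite) set \<Rightarrow> bool" where
  "simple_domain U \<longleftrightarrow> open U \<and> diffeomorphic U (ball (0 :: real ^ 'n) 1)"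

text \<open>The hyperplane is \<open>{x. a \<bullet> x = b}\<close> with unit normal \<open>a\<close>, and \<open>(x, u(x))\<close> denotes the point
  \<open>x + u(x) a\<close>. The \<open>(n-1)\<close>-ball is the unit ball of the linear hyperplane orthogonal to \<open>a\<close>.\<close>

definition simple_triple_graph :: "real ^ 'n::finite \<Rightarrow> (real ^ 'n \<Rightarrow> real) \<Rightarrow>
    (real ^ 'n) set \<Rightarrow> (real ^ 'n) set \<Rightarrow> (real ^ 'n) set \<Rightarrow> bool" where
  "simple_triple_graph a u U \<Gamma> V \<longleftrightarrow> simple_domain U \<and> norm a = 1 \<and>
     (\<exists>b. openin (top_of_set {x. a \<bullet> x = b}) V) \<and>
     diffeomorphic V (ball 0 1 \<inter> {x. a \<bullet> x = 0}) \<and>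
     \<Gamma> \<subseteq> frontier U \<and> \<Gamma> = (\<lambda>x. x + u x *\<^sub>R a) ` V"

definition simple_triple ::
    "(real ^ 'n::finite) set \<Rightarrow> (real ^ 'n) set \<Rightarrow> (real ^ 'n) set \<Rightarrow> bool" where
  "simple_triple U \<Gamma> V \<longleftrightarrow> (\<exists>a u. simple_triple_graph a u U \<Gamma> V)"

definition Lipschitz_simple_domain ::
    "(real ^ 'n::finite) set \<Rightarrow> (real ^ 'n) set \<Rightarrow> (real ^ 'n) set \<Rightarrow> bool" where
  "Lipschitz_simple_domain U \<Gamma> V \<longleftrightarrow>
     (\<exists>a u. simple_triple_graph a u U \<Gamma> V \<and> (\<exists>C. C-lipschitz_on V u))"

text \<open>\<open>P\<close> is one of the two preceding predicates. The base \<open>V\<close> stays in \<open>\<real>\<^sup>n\<close>, whereas \<open>U\<close> and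
  \<open>\<Gamma>\<close> are subsets of the manifold.\<close>

definition through_coordinate_map :: "('m::topological_space, 'n::finite) chart set \<Rightarrow>
    ((real ^ 'n) set \<Rightarrow> (real ^ 'n) set \<Rightarrow> (real ^ 'n) set \<Rightarrow> bool) \<Rightarrow>
    'm set \<Rightarrow> 'm set \<Rightarrow> (real ^ 'n) set \<Rightarrow> bool" where
  "through_coordinate_map A P U \<Gamma> V \<longleftrightarrow>
     (\<exists>c\<in>coordinate_maps A. U \<union> \<Gamma> \<subseteq> chart_dom c \<and> P (chart_map c ` U) (chart_map c ` \<Gamma>) V)"

definition boundary_gluing_map ::
    "('d::{t2_space, second_countable_topology}, 'n::finite) chart set \<Rightarrow>
     ('m::{t2_space, second_countable_topology}, 'n) chart set \<Rightarrow> ('d \<Rightarrow> 'm) \<Rightarrow> bool" where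
  "boundary_gluing_map A' A \<rho> \<longleftrightarrow>
     smooth_map_on A' A UNIV \<rho> \<and>
     inj_on \<rho> (manifold_interior A') \<and>
     open (\<rho> ` manifold_interior A') \<and>
     smooth_map_on A A' (\<rho> ` manifold_interior A') (inv_into (manifold_interior A') \<rho>) \<and>
     (\<forall>p. finite {x \<in> manifold_boundary A'. \<rho> x = p})"

definition covers_boundary :: "('d::topological_space, 'n::finite) chart set \<Rightarrow> nat \<Rightarrow>
    (nat \<Rightarrow> 'd set) \<Rightarrow> (nat \<Rightarrow> 'd set) \<Rightarrow> (nat \<Rightarrow> (real ^ 'n) set) \<Rightarrow> bool" where
  "covers_boundary A' \<nu> U' \<Gamma>' V' \<longleftrightarrow>
     (\<forall>i\<in>{1..\<nu>}. through_coordinate_map A' simple_triple (U' i) (\<Gamma>' i) (V' i) \<and>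
        open (U' i \<union> \<Gamma>' i) \<and> \<Gamma>' i \<subseteq> frontier (U' i) \<and>
        openin (top_of_set (manifold_boundary A')) (\<Gamma>' i)) \<and>
     manifold_boundary A' \<subseteq> (\<Union>i\<in>{1..\<nu>}. U' i \<union> \<Gamma>' i) \<and>
     (\<Union>i\<in>{1..\<nu>}. \<Gamma>' i) = manifold_boundary A'"

text \<open>The compact manifold \<open>D'\<close> is the whole type \<open>'d\<close> with atlas \<open>A'\<close>. Since one cannot quantify
  existentially over types, \<open>'d\<close> is a parameter; as a type variable in the hypothesis of a
  theorem it amounts to the existence of some \<open>D'\<close>. The set \<open>V\<^sub>i\<close> needs no separate link to
  \<open>V'\<^sub>i\<close>: being the base of the graph \<open>\<Gamma>\<^sub>i = \<rho>(\<Gamma>'\<^sub>i)\<close>, it is the image of \<open>V'\<^sub>i\<close> under the map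
  induced by \<open>\<rho>\<close>.\<close>

definition generalized_Lipschitz_domain ::
    "'d::{t2_space, second_countable_topology} itself \<Rightarrow>
     ('m::{t2_space, second_countable_topology}, 'n::finite) chart set \<Rightarrow> 'm set \<Rightarrow> bool" where
  "generalized_Lipschitz_domain _ A D \<longleftrightarrow>
     open D \<and> connected D \<and> D \<noteq> {} \<and>
     (\<exists>(A' :: ('d, 'n) chart set) \<rho> \<nu> U' \<Gamma>' V'.
        compact (UNIV :: 'd set) \<and> smooth_atlas A' \<and>
        boundary_gluing_map A' A \<rho> \<and> D = \<rho> ` manifold_interior A' \<and>
        covers_boundary A' \<nu> U' \<Gamma>' V' \<and>
        (\<forall>i\<in>{1..\<nu>}. \<exists>V. through_coordinate_map A Lipschitz_simple_domain
           (\<rho> ` U' i) (\<rho> ` \<Gamma>' i) V))"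

section \<open>Riemannian manifolds\<close>

definition transition_jacobian ::
    "('m, 'n::finite) chart \<Rightarrow> ('m, 'n) chart \<Rightarrow> 'm \<Rightarrow> real ^ 'n ^ 'n" where
  "transition_jacobian c d p =
     matrix (frechet_derivative (chart_map d \<circ> chart_inv c) (at (chart_map c p)))"

text \<open>\<open>G c p\<close> is the matrix \<open>(g\<^sub>i\<^sub>j(p))\<close> of the metric with respect to the chart \<open>c\<close>.\<close>

definition riemannian_metric ::
    "('m, 'n::finite) chart set \<Rightarrow> (('m, 'n) chart \<Rightarrow> 'm \<Rightarrow> real ^ 'n ^ 'n) \<Rightarrow> bool" where
  "riemannian_metric A G \<longleftrightarrow>
     (\<forall>c\<in>A. smooth_on (chart_map c ` chart_dom c) (G c \<circ> chart_inv c)) \<and>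
     (\<forall>c\<in>A. \<forall>p\<in>chart_dom c. transpose (G c p) = G c p \<and>
        (\<forall>v. v \<noteq> 0 \<longrightarrow> 0 < v \<bullet> (G c p *v v))) \<and>
     (\<forall>c\<in>A. \<forall>d\<in>A. \<forall>p\<in>chart_dom c \<inter> chart_dom d.
        G c p = transpose (transition_jacobian c d p) ** G d p ** transition_jacobian c d p)"

definition riemannian_manifold ::
    "('m::{t2_space, second_countable_topology}, 'n::finite) chart set \<Rightarrow>
     (('m, 'n) chart \<Rightarrow> 'm \<Rightarrow> real ^ 'n ^ 'n) \<Rightarrow> bool" where
  "riemannian_manifold A G \<longleftrightarrow>
     smooth_atlas A \<and> manifold_boundary A = {} \<and> riemannian_metric A G"

text \<open>The unique Borel measure given by \<open>sqrt (det (g\<^sub>i\<^sub>j)) dx\<close> in every chart; no orientation is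
  involved.\<close>

definition riemannian_volume :: "('m::{t2_space, second_countable_topology}, 'n::finite) chart set \<Rightarrow>
    (('m, 'n) chart \<Rightarrow> 'm \<Rightarrow> real ^ 'n ^ 'n) \<Rightarrow> 'm measure" where
  "riemannian_volume A G = (THE \<mu>. sets \<mu> = sets borel \<and>
     (\<forall>c\<in>A. \<forall>B\<in>sets borel. B \<subseteq> chart_dom c \<longrightarrow>
        emeasure \<mu> B =
          (\<integral>\<^sup>+x\<in>chart_map c ` B. ennreal (sqrt (det (G c (chart_inv c x)))) \<partial>lborel)))"

section \<open>The Sobolev space on an open subset of a Riemannian manifold\<close>

text \<open>A covector field, with \<open>\<omega> c p\<close> the component vector at \<open>p\<close> with respect to the chart
  \<open>c\<close>.\<close>

definition covector_field_on ::
    "('m, 'n::finite) chart set \<Rightarrow> 'm set \<Rightarrow> (('m, 'n) chart \<Rightarrow> 'm \<Rightarrow> real ^ 'n) \<Rightarrow> bool" where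
  "covector_field_on A D \<omega> \<longleftrightarrow> (\<forall>c\<in>A. \<forall>d\<in>A. \<forall>p\<in>chart_dom c \<inter> chart_dom d \<inter> D.
     \<omega> c p = transpose (transition_jacobian c d p) *v \<omega> d p)"

text \<open>\<open>g\<^sup>i\<^sup>j \<omega>\<^sub>i \<omega>\<^sub>j\<close>, which for a covector field does not depend on the chart chosen at \<open>p\<close>.\<close>

definition covector_sqnorm :: "('m, 'n::finite) chart set \<Rightarrow> (('m, 'n) chart \<Rightarrow> 'm \<Rightarrow> real ^ 'n ^ 'n) \<Rightarrow>
    (('m, 'n) chart \<Rightarrow> 'm \<Rightarrow> real ^ 'n) \<Rightarrow> 'm \<Rightarrow> real" where
  "covector_sqnorm A G \<omega> p =
     (let c = (SOME c. c \<in> A \<and> p \<in> chart_dom c) in \<omega> c p \<bullet> (matrix_inv (G c p) *v \<omega> c p))"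

definition test_function :: "(real ^ 'n::finite) set \<Rightarrow> (real ^ 'n \<Rightarrow> real) \<Rightarrow> bool" where
  "test_function V \<eta> \<longleftrightarrow> smooth_on UNIV \<eta> \<and>
     compact (closure {x. \<eta> x \<noteq> 0}) \<and> closure {x. \<eta> x \<noteq> 0} \<subseteq> V"

definition locally_integrable_on ::
    "(real ^ 'n::finite) set \<Rightarrow> (real ^ 'n \<Rightarrow> 'b::{banach, second_countable_topology}) \<Rightarrow> bool" where
  "locally_integrable_on V f \<longleftrightarrow> (\<forall>K. compact K \<and> K \<subseteq> V \<longrightarrow> set_integrable lborel K f)"

definition weak_differential :: "('m, 'n::finite) chart set \<Rightarrow> 'm set \<Rightarrow> ('m \<Rightarrow> real) \<Rightarrow>
    (('m, 'n) chart \<Rightarrow> 'm \<Rightarrow> real ^ 'n) \<Rightarrow> bool" where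
  "weak_differential A D u \<omega> \<longleftrightarrow> covector_field_on A D \<omega> \<and>
     (\<forall>c\<in>A. let V = chart_map c ` (chart_dom c \<inter> D) in
        locally_integrable_on V (u \<circ> chart_inv c) \<and>
        locally_integrable_on V (\<omega> c \<circ> chart_inv c) \<and>
        (\<forall>\<eta> i. test_function V \<eta> \<longrightarrow>
           (LINT x:V|lborel. u (chart_inv c x) * frechet_derivative \<eta> (at x) (axis i 1)) =
           - (LINT x:V|lborel. \<omega> c (chart_inv c x) $ i * \<eta> x)))"

text \<open>Functions on \<open>D\<close> are total functions whose values outside \<open>D\<close> (or outside \<open>closure D\<close>, where
  these occur) are irrelevant. Almost everywhere equal functions are not identified: \<open>W12\<close> is the
  set of all representatives, \<open>W12_norm\<close> is a seminorm on it, and closures are saturated under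
  equality almost everywhere on \<open>D\<close>.\<close>

definition W12 :: "('m::{t2_space, second_countable_topology}, 'n::finite) chart set \<Rightarrow>
    (('m, 'n) chart \<Rightarrow> 'm \<Rightarrow> real ^ 'n ^ 'n) \<Rightarrow> 'm set \<Rightarrow> ('m \<Rightarrow> real) set" where
  "W12 A G D = {u. set_borel_measurable borel D u \<and>
     set_integrable (riemannian_volume A G) D (\<lambda>p. (u p)\<^sup>2) \<and>
     (\<exists>\<omega>. weak_differential A D u \<omega> \<and>
        set_integrable (riemannian_volume A G) D (covector_sqnorm A G \<omega>))}"

text \<open>Weak differentials are unique up to null sets, so the choice below does not matter.\<close>

definition W12_norm :: "('m::{t2_space, second_countable_topology}, 'n::finite) chart set \<Rightarrow>
    (('m, 'n) chart \<Rightarrow> 'm \<Rightarrow> real ^ 'n ^ 'n) \<Rightarrow> 'm set \<Rightarrow> ('m \<Rightarrow> real) \<Rightarrow> real" where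
  "W12_norm A G D u = sqrt (LINT p:D|riemannian_volume A G.
     (u p)\<^sup>2 + covector_sqnorm A G (SOME \<omega>. weak_differential A D u \<omega>) p)"

definition W12_closure :: "('m::{t2_space, second_countable_topology}, 'n::finite) chart set \<Rightarrow>
    (('m, 'n) chart \<Rightarrow> 'm \<Rightarrow> real ^ 'n ^ 'n) \<Rightarrow> 'm set \<Rightarrow> ('m \<Rightarrow> real) set \<Rightarrow> ('m \<Rightarrow> real) set" where
  "W12_closure A G D S = {u \<in> W12 A G D.
     \<forall>\<epsilon>>0. \<exists>s\<in>S \<inter> W12 A G D. W12_norm A G D (\<lambda>p. u p - s p) < \<epsilon>}"

section \<open>Function spaces\<close>

text \<open>\<open>C\<^sup>1(closure D)\<close>: continuous on \<open>closure D\<close>, and the first derivatives on \<open>D\<close> exist and extend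
  continuously to \<open>closure D\<close>.\<close>

definition C1_closure :: "('m::topological_space, 'n::finite) chart set \<Rightarrow> 'm set \<Rightarrow> ('m \<Rightarrow> real) \<Rightarrow> bool" where
  "C1_closure A D f \<longleftrightarrow> continuous_on (closure D) f \<and>
     (\<forall>c\<in>A. (\<forall>x\<in>chart_map c ` (chart_dom c \<inter> D). (f \<circ> chart_inv c) differentiable (at x)) \<and>
        (\<forall>i. \<exists>h. continuous_on (chart_map c ` (chart_dom c \<inter> closure D)) h \<and>
           (\<forall>x\<in>chart_map c ` (chart_dom c \<inter> D).
              h x = frechet_derivative (f \<circ> chart_inv c) (at x) (axis i 1))))"

definition F0 :: "('m::topological_space, 'n::finite) chart set \<Rightarrow> 'm set \<Rightarrow> ('m \<Rightarrow> real) set" where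
  "F0 A D = {f. smooth_fun_on A D f \<and> continuous_on (closure D) f \<and> (\<forall>p\<in>frontier D. f p = 0)}"

definition F1 :: "('m::topological_space, 'n::finite) chart set \<Rightarrow> 'm set \<Rightarrow> ('m \<Rightarrow> real) set" where
  "F1 A D = {f. smooth_fun_on A D f \<and> C1_closure A D f \<and> (\<forall>p\<in>frontier D. f p = 0)}"

definition Fc :: "('m::topological_space, 'n::finite) chart set \<Rightarrow> 'm set \<Rightarrow> ('m \<Rightarrow> real) set" where
  "Fc A D = {f. smooth_fun_on A D f \<and> closure {p\<in>D. f p \<noteq> 0} \<subseteq> D}"

definition zero_integral :: "('m::{t2_space, second_countable_topology}, 'n::finite) chart set \<Rightarrow>
    (('m, 'n) chart \<Rightarrow> 'm \<Rightarrow> real ^ 'n ^ 'n) \<Rightarrow> 'm set \<Rightarrow> ('m \<Rightarrow> real) \<Rightarrow> bool" where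
  "zero_integral A G D f \<longleftrightarrow> set_integrable (riemannian_volume A G) D f \<and>
     (LINT p:D|riemannian_volume A G. f p) = 0"

definition G0 :: "('m::{t2_space, second_countable_topology}, 'n::finite) chart set \<Rightarrow>
    (('m, 'n) chart \<Rightarrow> 'm \<Rightarrow> real ^ 'n ^ 'n) \<Rightarrow> 'm set \<Rightarrow> ('m \<Rightarrow> real) set" where
  "G0 A G D = {f \<in> F0 A D. zero_integral A G D f}"

definition Gc :: "('m::{t2_space, second_countable_topology}, 'n::finite) chart set \<Rightarrow>
    (('m, 'n) chart \<Rightarrow> 'm \<Rightarrow> real ^ 'n ^ 'n) \<Rightarrow> 'm set \<Rightarrow> ('m \<Rightarrow> real) set" where
  "Gc A G D = {g. smooth_fun_on A D g \<and> closure {p\<in>D. g p \<noteq> 0} \<subseteq> D \<and> zero_integral A G D g}"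

definition E_space :: "('m::{t2_space, second_countable_topology}, 'n::finite) chart set \<Rightarrow>
    (('m, 'n) chart \<Rightarrow> 'm \<Rightarrow> real ^ 'n ^ 'n) \<Rightarrow> 'm set \<Rightarrow> ('m \<Rightarrow> real) set" where
  "E_space A G D = W12_closure A G D (F0 A D \<inter> W12 A G D)"

definition H_space :: "('m::{t2_space, second_countable_topology}, 'n::finite) chart set \<Rightarrow>
    (('m, 'n) chart \<Rightarrow> 'm \<Rightarrow> real ^ 'n ^ 'n) \<Rightarrow> 'm set \<Rightarrow> ('m \<Rightarrow> real) set" where
  "H_space A G D = W12_closure A G D (G0 A G D \<inter> W12 A G D)"

definition W12_0 :: "('m::{t2_space, second_countable_topology}, 'n::finite) chart set \<Rightarrow>
    (('m, 'n) chart \<Rightarrow> 'm \<Rightarrow> real ^ 'n ^ 'n) \<Rightarrow> 'm set \<Rightarrow> ('m \<Rightarrow> real) set" where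
  "W12_0 A G D = W12_closure A G D (Fc A D)"

end

theory Submission
  imports Defs
begin

text \<open>Let \<open>u\<close> be smooth on the open set \<open>D\<close>, continuous on its closure, and zero on the frontier. Flattening
the values of \<open>u\<close> near zero gives a function supported inside \<open>D\<close>: if \<open>\<theta>\<^sub>k\<close> is a smooth function on
the line that vanishes on \<open>[-1/k, 1/k]\<close>, then \<open>\<theta>\<^sub>k(u)\<close> is smooth and can differ from zero only where
\<open>\<bar>u\<bar> \<ge> 1/k\<close>, which is a closed subset of the closure of \<open>D\<close> that misses the frontier
(\<open>trunc_support\<close>). The functions \<open>\<theta>\<^sub>k\<close> (\<open>trunc k\<close> below) converge to the identity with uniformly
bounded derivatives tending to \<open>1\<close> away from zero, so \<open>\<theta>\<^sub>k(u) \<rightarrow> u\<close> in \<open>W\<^sup>1\<^sup>,\<^sup>2\<close> follows by dominated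
convergence (\<open>trunc_W12_norm_tendsto\<close>), once it is known that \<open>du\<close> vanishes almost everywhere on
\<open>{u = 0}\<close>. That in turn is a consequence of the uniqueness of weak differentials: passing to the
limit in the weak equation for \<open>\<theta>\<^sub>k(u)\<close> shows that \<open>du\<close> restricted to \<open>{u \<noteq> 0}\<close> is another weak
differential of \<open>u\<close> (\<open>wd_differential_off_zeros\<close>).

Hence the closure of \<open>F0\<close> lies in that of \<open>Fc\<close>. Conversely a function in \<open>Fc\<close> extended by zero
belongs to \<open>F1\<close>, and \<open>F1\<close> lies in \<open>F0\<close>, so that the three closures coincide. For functions with
zero integral the truncations have integrals tending to zero, and a suitable multiple of one fixed
truncation restores the condition without leaving the compactly supported class
(\<open>H_subset_closure_Gc\<close>).

Three ingredients make this rigorous. The Riemannian volume is introduced by a definite description,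
so a Borel measure with the prescribed density in every chart has to be constructed; the densities
fit together by the change of variables formula (\<open>is_volume_exists\<close>). The uniqueness of weak
differentials is the fundamental lemma of the calculus of variations
(\<open>fundamental_lemma_variations\<close>), tested on smooth functions that approximate indicators of boxes. That
smooth functions have their classical differential as weak differential is integration by parts on
open sets (\<open>integration_by_parts\<close>), where differentiation under translation replaces an appeal to
Fubini's theorem.\<close>

section \<open>Smooth functions on open sets\<close>

lemma frechet_derivative_unique_at:
  "(f has_derivative f') (at x) \<Longrightarrow> frechet_derivative f (at x) = f'"
  by (metis frechet_derivative_at)

lemma Ck_on_subset: "Ck_on k S f \<Longrightarrow> T \<subseteq> S \<Longrightarrow> Ck_on k T f"
proof (induction k arbitrary: f)
  case 0
  then show ?case by (simp add: continuous_on_subset)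
next
  case (Suc k)
  then show ?case by (simp add: subset_eq)
qed

lemma Ck_on_cong:
  assumes "open S" "\<And>x. x \<in> S \<Longrightarrow> f x = g x" "Ck_on k S f"
  shows "Ck_on k S g"
  using assms(2,3)
proof (induction k arbitrary: f g)
  case 0
  then show ?case using continuous_on_cong by force
next
  case (Suc k)
  have der: "(g has_derivative frechet_derivative f (at x)) (at x)" if "x \<in> S" for x
    using Suc.prems that assms(1)
    by (intro has_derivative_transform_within_open[of f _ x UNIV S g])
       (auto simp: frechet_derivative_works)
  then have eq: "frechet_derivative g (at x) = frechet_derivative f (at x)" if "x \<in> S" for x
    using frechet_derivative_unique_at that by blast
  have "Ck_on k S (\<lambda>x. frechet_derivative g (at x) v)" for v
    using Suc.prems(2) by (rule_tac Suc.IH[of "\<lambda>x. frechet_derivative f (at x) v"]) (auto simp: eq)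
  then show ?case using der by simp (blast intro: differentiableI)
qed

lemma Ck_on_Suc_imp: "Ck_on (Suc k) S f \<Longrightarrow> Ck_on k S f"
proof (induction k arbitrary: f)
  case 0
  then show ?case
    by (auto intro!: differentiable_imp_continuous_on simp: differentiable_on_def differentiable_at_withinI)
next
  case (Suc k)
  from Suc.prems have "\<forall>x\<in>S. f differentiable (at x)"
    and "\<And>v. Ck_on (Suc k) S (\<lambda>x. frechet_derivative f (at x) v)"
    unfolding Ck_on.simps(2)[of "Suc k"] by auto
  then show ?case using Suc.IH by simp
qed

lemma Ck_on_local:
  assumes "\<And>x. x \<in> S \<Longrightarrow> \<exists>W. open W \<and> x \<in> W \<and> Ck_on k (S \<inter> W) f"
  shows "Ck_on k S f"
  using assms
proof (induction k arbitrary: f)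
  case 0
  show ?case unfolding Ck_on.simps
  proof (rule continuous_on_eq_continuous_within[THEN iffD2], intro ballI)
    fix x assume "x \<in> S"
    with 0 obtain W where "open W" "x \<in> W" "continuous_on (S \<inter> W) f" by auto
    moreover have "at x within S = at x within (S \<inter> W)"
      by (rule at_within_nhd[of x W]) (use \<open>open W\<close> \<open>x \<in> W\<close> in auto)
    ultimately show "continuous (at x within S) f" using \<open>x \<in> S\<close>
      by (simp add: continuous_on_eq_continuous_within)
  qed
next
  case (Suc k)
  then show ?case by simp (meson IntI)
qed

text \<open>On open sets the local extensions in the definition of smoothness can be taken to be the function
itself, and all smoothness arguments below reduce to inductions on \<open>k\<close>.\<close>

lemma smooth_on_iff_Ck_on:
  assumes "open S"
  shows "smooth_on S f \<longleftrightarrow> (\<forall>k. Ck_on k S f)"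
proof
  assume L: "smooth_on S f"
  show "\<forall>k. Ck_on k S f"
  proof (intro allI Ck_on_local)
    fix k x assume "x \<in> S"
    with L obtain W g where W: "open W" "x \<in> W" "\<forall>k. Ck_on k W g" "\<forall>y\<in>S \<inter> W. f y = g y"
      unfolding smooth_on_def by metis
    have "Ck_on k (S \<inter> W) f"
      by (rule Ck_on_cong[of _ g]) (use W assms Ck_on_subset[of _ W g "S \<inter> W"] in auto)
    with W show "\<exists>W. open W \<and> x \<in> W \<and> Ck_on k (S \<inter> W) f" by blast
  qed
next
  assume "\<forall>k. Ck_on k S f"
  then show "smooth_on S f" unfolding smooth_on_def using assms by blast
qed

lemma Ck_on_const: "Ck_on k S (\<lambda>x. c)"
proof (induction k arbitrary: c)
  case (Suc k)
  then show ?case by simp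
qed simp

lemma Ck_on_add:
  "Ck_on k S f \<Longrightarrow> Ck_on k S g \<Longrightarrow> open S \<Longrightarrow> Ck_on k S (\<lambda>x. f x + g x)"
proof (induction k arbitrary: f g)
  case 0
  then show ?case by (simp add: continuous_on_add)
next
  case (Suc k)
  have d: "((\<lambda>x. f x + g x) has_derivative
      (\<lambda>v. frechet_derivative f (at x) v + frechet_derivative g (at x) v)) (at x)" if "x \<in> S" for x
    using Suc.prems that by (intro has_derivative_add) (auto simp: frechet_derivative_works)
  have "Ck_on k S (\<lambda>x. frechet_derivative (\<lambda>x. f x + g x) (at x) v)" for v
    by (rule Ck_on_cong[OF Suc.prems(3) _ Suc.IH[of "\<lambda>x. frechet_derivative f (at x) v" "\<lambda>x. frechet_derivative g (at x) v"]])
       (use Suc.prems frechet_derivative_unique_at[OF d] in auto)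
  then show ?case using d by simp (blast intro: differentiableI)
qed

lemma Ck_on_mult:
  fixes f g :: "'a::euclidean_space \<Rightarrow> real"
  shows "Ck_on k S f \<Longrightarrow> Ck_on k S g \<Longrightarrow> open S \<Longrightarrow> Ck_on k S (\<lambda>x. f x * g x)"
proof (induction k arbitrary: f g)
  case 0
  then show ?case by (simp add: continuous_on_mult)
next
  case (Suc k)
  have d: "((\<lambda>x. f x * g x) has_derivative
      (\<lambda>v. f x * frechet_derivative g (at x) v + frechet_derivative f (at x) v * g x)) (at x)"
    if "x \<in> S" for x
    using Suc.prems that by (intro has_derivative_mult) (auto simp: frechet_derivative_works)
  have "Ck_on k S (\<lambda>x. f x * frechet_derivative g (at x) v + frechet_derivative f (at x) v * g x)" for v
    using Suc.prems Ck_on_Suc_imp by (intro Ck_on_add Suc.IH) auto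
  then have "Ck_on k S (\<lambda>x. frechet_derivative (\<lambda>x. f x * g x) (at x) v)" for v
    by (rule Ck_on_cong[OF Suc.prems(3), rotated]) (use frechet_derivative_unique_at[OF d] in auto)
  then show ?case using d by simp (blast intro: differentiableI)
qed

lemma Ck_on_prod:
  fixes f :: "'i \<Rightarrow> 'a::euclidean_space \<Rightarrow> real"
  assumes "open S" "\<And>i. i \<in> I \<Longrightarrow> Ck_on k S (f i)"
  shows "Ck_on k S (\<lambda>x. \<Prod>i\<in>I. f i x)"
  using assms(2) by (induction I rule: infinite_finite_induct) (auto simp: Ck_on_const intro!: Ck_on_mult assms(1))

lemma Ck_on_bounded_linear: "bounded_linear f \<Longrightarrow> Ck_on k S f"
proof (cases k)
  case (Suc j)
  assume f: "bounded_linear f"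
  then have "frechet_derivative f (at x) = f" for x
    using bounded_linear_imp_has_derivative frechet_derivative_unique_at by blast
  with f Suc show ?thesis by (auto simp: Ck_on_const bounded_linear_imp_differentiable)
qed (simp add: linear_continuous_on)

lemma Ck_on_compose_real:
  fixes \<phi> :: "real \<Rightarrow> real" and g :: "'a::euclidean_space \<Rightarrow> real"
  shows "Ck_on k UNIV \<phi> \<Longrightarrow> Ck_on k S g \<Longrightarrow> open S \<Longrightarrow> Ck_on k S (\<lambda>x. \<phi> (g x))"
proof (induction k arbitrary: \<phi>)
  case 0
  then show ?case by (auto intro: continuous_on_compose2)
next
  case (Suc k)
  have d: "((\<lambda>x. \<phi> (g x)) has_derivative
      (\<lambda>v. frechet_derivative \<phi> (at (g x)) 1 * frechet_derivative g (at x) v)) (at x)" if "x \<in> S" for x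
  proof -
    have \<phi>: "\<phi> differentiable (at (g x))"
      using Suc.prems(1) by simp
    have "linear (frechet_derivative \<phi> (at (g x)))"
      by (rule linear_frechet_derivative[OF \<phi>])
    then have "frechet_derivative \<phi> (at (g x)) (v *\<^sub>R 1) = v *\<^sub>R frechet_derivative \<phi> (at (g x)) 1" for v
      by (rule linear_cmul)
    then have eq: "frechet_derivative \<phi> (at (g x)) = (\<lambda>v. frechet_derivative \<phi> (at (g x)) 1 * v)"
      by (metis mult.commute mult.right_neutral real_scaleR_def)
    have "(\<phi> has_derivative (\<lambda>v. frechet_derivative \<phi> (at (g x)) 1 * v)) (at (g x))"
      by (rule has_derivative_eq_rhs[OF _ eq]) (rule \<phi>[unfolded frechet_derivative_works])
    moreover have "(g has_derivative frechet_derivative g (at x)) (at x)"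
      using Suc.prems that by (auto simp: frechet_derivative_works)
    ultimately show ?thesis by (rule has_derivative_compose[rotated])
  qed
  have "Ck_on k S (\<lambda>x. frechet_derivative \<phi> (at (g x)) 1 * frechet_derivative g (at x) v)" for v
    using Suc.prems(1,2) Ck_on_Suc_imp[OF Suc.prems(2)]
    by (intro Ck_on_mult Suc.IH[of "\<lambda>t. frechet_derivative \<phi> (at t) 1"] Suc.prems(3)) simp_all
  then have "Ck_on k S (\<lambda>x. frechet_derivative (\<lambda>x. \<phi> (g x)) (at x) v)" for v
    by (rule Ck_on_cong[OF Suc.prems(3), rotated]) (use frechet_derivative_unique_at[OF d] in auto)
  then show ?case using d by simp (blast intro: differentiableI)
qed

section \<open>Flat functions and the truncations\<close>

text \<open>The functions \<open>P(1/t) exp(-1/t)\<close>, continued by zero to \<open>t \<le> 0\<close>, are treated for all polynomials \<open>P\<close>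
at once because this family is closed under differentiation; smoothness is then an induction with
\<open>P\<close> varying.\<close>

definition flat_exp :: "real poly \<Rightarrow> real \<Rightarrow> real" where
  "flat_exp P t = (if t \<le> 0 then 0 else poly P (1 / t) * exp (- 1 / t))"

lemma tendsto_poly_exp: "((\<lambda>t::real. poly P (1 / t) * exp (- 1 / t)) \<longlongrightarrow> 0) (at_right 0)"
proof -
  have "((\<lambda>x::real. poly P x * exp (- x)) \<longlongrightarrow> 0) at_top"
  proof -
    have "((\<lambda>x::real. \<Sum>i\<le>degree P. coeff P i * (x ^ i / exp x)) \<longlongrightarrow> (\<Sum>i\<le>degree P. coeff P i * 0)) at_top"
      by (intro tendsto_sum tendsto_mult tendsto_const tendsto_power_div_exp_0)
    then show ?thesis by (simp add: poly_altdef exp_minus sum_divide_distrib field_simps)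
  qed
  then have "((\<lambda>x::real. poly P (inverse x) * exp (- inverse x)) \<longlongrightarrow> 0) (at_right 0)"
    by (rule filterlim_compose) (rule filterlim_inverse_at_top_right)
  then show ?thesis by (simp add: inverse_eq_divide)
qed

text \<open>The polynomial on the right comes from \<open>d/dt (1/t) = -(1/t)\<^sup>2\<close>. At \<open>t = 0\<close> the difference quotient is
again of the same form, with \<open>X P\<close> in place of \<open>P\<close>, and exponential decay makes it tend to zero.\<close>

lemma flat_exp_has_derivative:
  "(flat_exp P has_field_derivative flat_exp ([:0,0,1:] * (P - pderiv P)) t) (at t)"
proof -
  consider "t < 0" | "t > 0" | "t = 0" by linarith
  then show ?thesis
  proof cases
    case 1
    have "((\<lambda>t. 0) has_field_derivative 0) (at t)" by simp
    then have "(flat_exp P has_field_derivative 0) (at t)"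
      by (rule has_field_derivative_transform_within_open[of _ _ _ "{..<0}"])
         (use 1 in \<open>auto simp: flat_exp_def\<close>)
    with 1 show ?thesis by (simp add: flat_exp_def)
  next
    case 2
    have "((\<lambda>t. poly P (1 / t) * exp (- 1 / t)) has_field_derivative
       flat_exp ([:0,0,1:] * (P - pderiv P)) t) (at t)"
      using 2 by (auto intro!: derivative_eq_intros poly_DERIV[THEN DERIV_chain2] simp: flat_exp_def field_simps power2_eq_square)
    then show ?thesis
      by (rule has_field_derivative_transform_within_open[of _ _ _ "{0<..}"])
         (use 2 in \<open>auto simp: flat_exp_def\<close>)
  next
    case 3
    have "((\<lambda>h. flat_exp P h / h) \<longlongrightarrow> 0) (at 0)"
    proof (rule filterlim_split_at)
      show "((\<lambda>h. flat_exp P h / h) \<longlongrightarrow> 0) (at_left 0)"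
        by (rule tendsto_eventually) (auto simp: eventually_at_left_field flat_exp_def intro: exI[of _ "-1"])
      have "((\<lambda>t::real. poly ([:0,1:] * P) (1 / t) * exp (- 1 / t)) \<longlongrightarrow> 0) (at_right 0)"
        by (rule tendsto_poly_exp)
      then show "((\<lambda>h. flat_exp P h / h) \<longlongrightarrow> 0) (at_right 0)"
        by (rule Lim_transform_eventually)
           (auto simp: eventually_at_right_field flat_exp_def intro!: exI[of _ 1])
    qed
    with 3 show ?thesis by (simp add: DERIV_def flat_exp_def)
  qed
qed

lemma Ck_on_flat_exp: "Ck_on k UNIV (flat_exp P)"
proof (induction k arbitrary: P)
  case 0
  show ?case by (simp add: continuous_at_imp_continuous_on DERIV_isCont[OF flat_exp_has_derivative])
next
  case (Suc k)
  have d: "(flat_exp P has_derivative (\<lambda>v. flat_exp ([:0,0,1:] * (P - pderiv P)) t * v)) (at t)" for t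
    using flat_exp_has_derivative by (simp add: has_field_derivative_def)
  have "Ck_on k UNIV (\<lambda>x. frechet_derivative (flat_exp P) (at x) v)" for v
    unfolding frechet_derivative_unique_at[OF d]
    by (intro Ck_on_mult Suc.IH Ck_on_const) auto
  then show ?case using d by simp (blast intro: differentiableI)
qed

abbreviation ramp :: "real \<Rightarrow> real" where "ramp \<equiv> flat_exp 1"
abbreviation ramp' :: "real \<Rightarrow> real" where "ramp' \<equiv> flat_exp ([:0,0,1:] * (1 - pderiv 1))"

lemma ramp_nonneg: "0 \<le> ramp t" and ramp_le_1: "ramp t \<le> 1"
  and ramp_eq_0: "t \<le> 0 \<Longrightarrow> ramp t = 0"
  by (auto simp: flat_exp_def)

lemma ramp_tendsto_1:
  assumes "filterlim f at_top F"
  shows "((\<lambda>x. ramp (f x)) \<longlongrightarrow> 1) F"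
proof -
  have "((\<lambda>x. exp (- inverse (f x))) \<longlongrightarrow> exp (- 0)) F"
    by (intro tendsto_intros filterlim_compose[OF tendsto_inverse_0_at_top assms] tendsto_inverse_0_at_top assms)
  moreover have "eventually (\<lambda>x. f x > 0) F"
    using assms by (auto simp: filterlim_at_top_dense)
  then have "eventually (\<lambda>x. exp (- inverse (f x)) = ramp (f x)) F"
    by eventually_elim (auto simp: flat_exp_def inverse_eq_divide)
  ultimately show ?thesis by (simp add: Lim_transform_eventually)
qed

text \<open>The factor \<open>ramp ((k t)\<^sup>2 - 1)\<close> is zero for \<open>\<bar>t\<bar> \<le> 1/k\<close> and, unlike a cutoff that reaches the value \<open>1\<close>,
it needs no quotient of flat functions. It tends to \<open>1\<close> slowly, but only pointwise limits and
bounds uniform in \<open>k\<close> matter.\<close>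

definition trunc :: "nat \<Rightarrow> real \<Rightarrow> real" where
  "trunc k t = t * ramp ((real k * t)\<^sup>2 - 1)"

definition trunc' :: "nat \<Rightarrow> real \<Rightarrow> real" where
  "trunc' k t = ramp ((real k * t)\<^sup>2 - 1) + 2 * (real k * t)\<^sup>2 * ramp' ((real k * t)\<^sup>2 - 1)"

lemma trunc_has_derivative: "(trunc k has_field_derivative trunc' k t) (at t)"
  unfolding trunc_def
  by (auto intro!: derivative_eq_intros DERIV_chain2[OF flat_exp_has_derivative] simp: trunc'_def power2_eq_square)

lemma Ck_on_trunc: "Ck_on m UNIV (trunc k)"
proof -
  have lin: "Ck_on m UNIV (\<lambda>t::real. real k * t)" "Ck_on m UNIV (\<lambda>t::real. t)"
    by (auto intro!: Ck_on_bounded_linear bounded_linear_mult_right)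
  have "Ck_on m UNIV (\<lambda>t. (real k * t) * (real k * t) + (-1))"
    by (intro Ck_on_add Ck_on_mult Ck_on_const lin) auto
  from Ck_on_mult[OF lin(2) Ck_on_compose_real[OF Ck_on_flat_exp[of m 1] this]]
  have "Ck_on m UNIV (\<lambda>t. t * ramp ((real k * t) * (real k * t) + (-1)))" by simp
  then show ?thesis by (simp add: trunc_def[abs_def] power2_eq_square)
qed

lemma trunc_eq_0: "real k * \<bar>t\<bar> \<le> 1 \<Longrightarrow> trunc k t = 0"
proof -
  assume "real k * \<bar>t\<bar> \<le> 1"
  then have "(real k * t)\<^sup>2 \<le> 1" by (simp add: abs_square_le_1 abs_mult)
  then show ?thesis by (simp add: trunc_def flat_exp_def)
qed

lemma trunc_bound: "\<bar>trunc k t\<bar> \<le> \<bar>t\<bar>"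
  using ramp_nonneg ramp_le_1 by (simp add: trunc_def abs_mult mult_left_le)

lemma trunc_diff_bound: "\<bar>t - trunc k t\<bar> \<le> \<bar>t\<bar>"
proof -
  have "t - trunc k t = t * (1 - ramp ((real k * t)\<^sup>2 - 1))" by (simp add: trunc_def algebra_simps)
  moreover have "\<bar>1 - ramp ((real k * t)\<^sup>2 - 1)\<bar> \<le> 1" using ramp_nonneg ramp_le_1 by simp
  ultimately show ?thesis by (simp add: abs_mult mult_left_le)
qed

lemma exp_neg_quadratic_bound:
  fixes r :: real assumes "r \<ge> 0"
  shows "2 * (r + r\<^sup>2) * exp (- r) \<le> 6"
proof -
  have "1 + r + r\<^sup>2 / 2 \<le> exp r" by (rule exp_lower_Taylor_quadratic[OF assms])
  then have "2 * (r + r\<^sup>2) \<le> 6 * exp r" using assms by (smt (verit) field_sum_of_halves zero_le_power2)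
  then show ?thesis by (simp add: exp_minus field_simps)
qed

text \<open>In terms of \<open>r = 1/((k t)\<^sup>2 - 1)\<close> the derivative becomes a function of \<open>r\<close> alone, which yields both the
bound uniform in \<open>k\<close> and, as \<open>r\<close> tends to zero, the limit.\<close>

lemma trunc'_eq:
  assumes "(real k * t)\<^sup>2 > 1"
  defines "r \<equiv> 1 / ((real k * t)\<^sup>2 - 1)"
  shows "trunc' k t = ramp ((real k * t)\<^sup>2 - 1) + 2 * (r + r\<^sup>2) * exp (- r)"
proof -
  define s where "s = (real k * t)\<^sup>2 - 1"
  have s: "(real k * t)\<^sup>2 = s + 1" "s > 0" "r = 1 / s" using assms by (auto simp: s_def)
  have "ramp' s = r\<^sup>2 * exp (- r)"
    using s(2) by (simp add: flat_exp_def s(3) power2_eq_square pderiv_1)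
  moreover have "(s + 1) * r\<^sup>2 = r + r\<^sup>2" using s(2) by (simp add: s(3) field_simps power2_eq_square)
  ultimately show ?thesis unfolding trunc'_def s(1) by (simp add: algebra_simps)
qed

lemma trunc'_bound: "\<bar>trunc' k t\<bar> \<le> 7"
proof (cases "(real k * t)\<^sup>2 > 1")
  case True
  then show ?thesis
    using exp_neg_quadratic_bound[of "1 / ((real k * t)\<^sup>2 - 1)"] ramp_le_1[of "(real k * t)\<^sup>2 - 1"]
      ramp_nonneg[of "(real k * t)\<^sup>2 - 1"]
    by (simp add: trunc'_eq abs_of_nonneg)
next
  case False
  then show ?thesis by (simp add: trunc'_def flat_exp_def)
qed

lemma trunc'_diff_bound: "\<bar>1 - trunc' k t\<bar> \<le> 8"
  using trunc'_bound[of k t] by linarith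

lemma trunc'_0 [simp]: "trunc' k 0 = 0"
  by (simp add: trunc'_def flat_exp_def)

lemma square_filterlim:
  assumes "t \<noteq> (0::real)" shows "filterlim (\<lambda>k. (real k * t)\<^sup>2 - 1) at_top sequentially"
proof -
  have "filterlim (\<lambda>k. real k * \<bar>t\<bar>) at_top sequentially"
    using assms by (intro filterlim_at_top_mult_tendsto_pos[of _ "\<bar>t\<bar>"] filterlim_real_sequentially tendsto_const) auto
  then have "filterlim (\<lambda>k. -1 + (real k * \<bar>t\<bar>)\<^sup>2) at_top sequentially"
    by (intro filterlim_tendsto_add_at_top[OF tendsto_const] filterlim_pow_at_top) auto
  then show ?thesis by (simp add: power_mult_distrib)
qed

lemma trunc_tendsto: "(\<lambda>k. trunc k t) \<longlonglongrightarrow> t"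
proof (cases "t = 0")
  case False
  have "(\<lambda>k. t * ramp ((real k * t)\<^sup>2 - 1)) \<longlonglongrightarrow> t * 1"
    by (intro tendsto_mult tendsto_const ramp_tendsto_1 square_filterlim False)
  then show ?thesis by (simp add: trunc_def)
qed (simp add: trunc_def)

lemma trunc'_tendsto:
  assumes "t \<noteq> 0" shows "(\<lambda>k. trunc' k t) \<longlonglongrightarrow> 1"
proof -
  let ?s = "\<lambda>k. (real k * t)\<^sup>2 - 1"
  have r: "(\<lambda>k. 1 / ?s k) \<longlonglongrightarrow> 0"
    using filterlim_compose[OF tendsto_inverse_0_at_top[OF filterlim_ident] square_filterlim[OF assms]]
    by (simp add: inverse_eq_divide)
  have "(\<lambda>k. ramp (?s k) + 2 * (1 / ?s k + (1 / ?s k)\<^sup>2) * exp (- (1 / ?s k)))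
      \<longlonglongrightarrow> 1 + 2 * (0 + 0\<^sup>2) * exp (- 0)"
    by (intro tendsto_intros ramp_tendsto_1 square_filterlim assms r)
  moreover have "eventually (\<lambda>k. ?s k > 0) sequentially"
    using square_filterlim[OF assms, unfolded filterlim_at_top_dense, rule_format, of 0] .
  then have "eventually (\<lambda>k. ramp (?s k) + 2 * (1 / ?s k + (1 / ?s k)\<^sup>2) * exp (- (1 / ?s k)) = trunc' k t) sequentially"
    by eventually_elim (simp add: trunc'_eq)
  ultimately show ?thesis by (simp add: Lim_transform_eventually)
qed

section \<open>Box-shaped test functions and the fundamental lemma\<close>

text \<open>These increase to the indicator of the open box as \<open>k \<rightarrow> \<infinity>\<close>. They vanish outside the box, so the
closed box contains their support for every \<open>k\<close>.\<close>

definition box_bump :: "nat \<Rightarrow> real ^ 'n::finite \<Rightarrow> real ^ 'n \<Rightarrow> real ^ 'n::finite \<Rightarrow> real" where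
  "box_bump k a b x = (\<Prod>i\<in>UNIV. ramp (real k * (x $ i - a $ i)) * ramp (real k * (b $ i - x $ i)))"

lemma Ck_on_box_bump:
  fixes a b :: "real ^ 'n::finite"
  shows "Ck_on m UNIV (box_bump k a b)"
proof -
  have 1: "Ck_on m UNIV (\<lambda>x::real^'n. x $ i)" for i
    by (rule Ck_on_bounded_linear) (rule bounded_linear_vec_nth)
  have "Ck_on m UNIV (\<lambda>x::real^'n. c * x $ i + d)" for c i d
    by (rule Ck_on_add[OF Ck_on_mult[OF Ck_on_const 1] Ck_on_const]) auto
  then have 2: "Ck_on m UNIV (\<lambda>x::real^'n. ramp (c * x $ i + d))" for c i d
    by (rule Ck_on_compose_real[OF Ck_on_flat_exp]) auto
  have "Ck_on m UNIV (\<lambda>x::real^'n. ramp (real k * (x $ i - a $ i)) * ramp (real k * (b $ i - x $ i)))" for i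
    using Ck_on_mult[OF 2[of "real k" i "- (real k * a $ i)"] 2[of "- real k" i "real k * b $ i"]]
    by (simp add: algebra_simps)
  then show ?thesis
    unfolding box_bump_def[abs_def] by (intro Ck_on_prod) auto
qed

lemma box_bump_nonneg: "0 \<le> box_bump k a b x"
  unfolding box_bump_def by (intro prod_nonneg) (simp add: ramp_nonneg)

lemma box_bump_le_1: "box_bump k a b x \<le> 1"
  unfolding box_bump_def by (intro prod_le_1) (simp add: ramp_nonneg ramp_le_1 mult_le_one)

lemma box_bump_eq_0:
  assumes "x \<notin> box a b" shows "box_bump k a b x = 0"
proof -
  obtain i where "x $ i \<le> a $ i \<or> b $ i \<le> x $ i"
    using assms by (auto simp: mem_box_cart not_less)
  then have "ramp (real k * (x $ i - a $ i)) * ramp (real k * (b $ i - x $ i)) = 0"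
    by (auto intro!: ramp_eq_0 simp: mult_nonneg_nonpos)
  then show ?thesis unfolding box_bump_def using prod_zero by (metis (mono_tags, lifting) UNIV_I finite)
qed

lemma box_bump_tendsto:
  fixes x :: "real ^ 'n::finite"
  shows "(\<lambda>k. box_bump k a b x) \<longlonglongrightarrow> indicator (box a b) x"
proof (cases "x \<in> box a b")
  case True
  have lim: "(\<lambda>k. ramp (real k * t)) \<longlonglongrightarrow> 1" if "t > 0" for t
    using that by (intro ramp_tendsto_1 filterlim_at_top_mult_tendsto_pos[of _ t] filterlim_real_sequentially tendsto_const) auto
  have "(\<lambda>k. box_bump k a b x) \<longlonglongrightarrow> (\<Prod>i\<in>(UNIV :: 'n set). 1 * 1)"
    unfolding box_bump_def using True by (intro tendsto_prod tendsto_mult lim) (auto simp: mem_box_cart)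
  with True show ?thesis by simp
qed (simp add: box_bump_eq_0)

lemma test_function_box_bump:
  assumes "cbox a b \<subseteq> V" shows "test_function V (box_bump k a b)"
proof -
  have "closure {x. box_bump k a b x \<noteq> 0} \<subseteq> cbox a b"
    using box_bump_eq_0 box_subset_cbox by (intro closure_minimal) blast+
  with assms show ?thesis
    unfolding test_function_def
    by (auto simp: smooth_on_iff_Ck_on Ck_on_box_bump compact_closure
        intro: bounded_subset[OF bounded_cbox subset_trans[OF closure_subset]])
qed

text \<open>The positive and the negative part of \<open>g\<close> are densities of two finite measures that agree on boxes.
Boxes are stable under intersection and generate the Borel sets, so the measures are equal, and so
are their densities up to null sets.\<close>

lemma AE_eq_0_if_box_integrals_eq_0:
  fixes g :: "'a::euclidean_space \<Rightarrow> real"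
  assumes g: "integrable lborel g"
    and box: "\<And>c d. (LINT x:box c d|lborel. g x) = 0"
  shows "AE x in lborel. g x = 0"
proof -
  have [measurable]: "g \<in> borel_measurable borel" using borel_measurable_integrable[OF g] by simp
  have e: "emeasure (density lborel (\<lambda>x. ennreal (g x))) (box c d) = emeasure (density lborel (\<lambda>x. ennreal (- g x))) (box c d)"
    for c d
  proof -
    have i: "integrable lborel (\<lambda>x. max 0 (s * g x) * indicator (box c d) x)" if "s = 1 \<or> s = -1" for s :: real
      by (rule Bochner_Integration.integrable_bound[OF g]) (use that in \<open>auto simp: indicator_def\<close>)
    have "emeasure (density lborel (\<lambda>x. ennreal (s * g x))) (box c d)
        = ennreal (LINT x|lborel. max 0 (s * g x) * indicator (box c d) x)" if "s = 1 \<or> s = -1" for s :: real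
    proof -
      have "emeasure (density lborel (\<lambda>x. ennreal (s * g x))) (box c d)
          = (\<integral>\<^sup>+x. ennreal (max 0 (s * g x) * indicator (box c d) x) \<partial>lborel)"
        by (subst emeasure_density) (auto intro!: nn_integral_cong simp: indicator_def max_def ennreal_neg)
      also have "\<dots> = ennreal (LINT x|lborel. max 0 (s * g x) * indicator (box c d) x)"
        by (rule nn_integral_eq_integral[OF i[OF that]]) auto
      finally show ?thesis .
    qed
    note em = this[of 1] this[of "-1"]
    have "(LINT x|lborel. max 0 (1 * g x) * indicator (box c d) x) - (LINT x|lborel. max 0 (-1 * g x) * indicator (box c d) x)
        = (LINT x:box c d|lborel. g x)"
    proof -
      have "(LINT x|lborel. max 0 (1 * g x) * indicator (box c d) x - max 0 (-1 * g x) * indicator (box c d) x)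
          = (LINT x:box c d|lborel. g x)"
        unfolding set_lebesgue_integral_def
        by (intro Bochner_Integration.integral_cong) (auto simp: indicator_def max_def)
      then show ?thesis
        using Bochner_Integration.integral_diff[OF i[of 1] i[of "-1"]] by simp
    qed
    with em box show ?thesis by simp
  qed
  have "density lborel (\<lambda>x. ennreal (g x)) = density lborel (\<lambda>x. ennreal (- g x))"
  proof (rule measure_eqI_generator_eq)
    let ?E = "range (\<lambda>(a, b). box a b::'a set)"
    show "Int_stable ?E" by (auto simp: Int_stable_def box_Int_box)
    show "?E \<subseteq> Pow UNIV" "sets (density lborel (\<lambda>x. ennreal (g x))) = sigma_sets UNIV ?E"
      "sets (density lborel (\<lambda>x. ennreal (- g x))) = sigma_sets UNIV ?E"
      by (simp_all add: borel_eq_box)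
    let ?A = "\<lambda>n::nat. box (- (real n *\<^sub>R One)) (real n *\<^sub>R One) :: 'a set"
    show "range ?A \<subseteq> ?E" "(\<Union>i. ?A i) = UNIV"
      unfolding UN_box_eq_UNIV by auto
    show "emeasure (density lborel (\<lambda>x. ennreal (g x))) (?A i) \<noteq> \<infinity>" for i
    proof -
      have "emeasure (density lborel (\<lambda>x. ennreal (g x))) (?A i) \<le> (\<integral>\<^sup>+x. ennreal (norm (g x)) \<partial>lborel)"
        by (subst emeasure_density) (auto intro!: nn_integral_mono simp: indicator_def ennreal_leI)
      also have "\<dots> < \<infinity>" using g by (simp add: integrable_iff_bounded)
      finally show ?thesis by simp
    qed
    show "emeasure (density lborel (\<lambda>x. ennreal (g x))) X = emeasure (density lborel (\<lambda>x. ennreal (- g x))) X"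
      if "X \<in> ?E" for X using that e by auto
  qed
  then have "AE x in lborel. ennreal (g x) = ennreal (- g x)"
    by (intro sigma_finite_measure.density_unique[OF lborel.sigma_finite_measure_axioms]) auto
  then show ?thesis
    by eventually_elim (metis ennreal_eq_0_iff ennreal_inj linorder_le_cases neg_0_le_iff_le neg_le_0_iff_le antisym)
qed

lemma locally_integrable_imp_integrable_mult:
  fixes f :: "real ^ 'n::finite \<Rightarrow> real"
  assumes f: "locally_integrable_on V f" and K: "compact K" "K \<subseteq> V"
    and g: "g \<in> borel_measurable borel" "\<And>x. \<bar>g x\<bar> \<le> B" "\<And>x. x \<notin> K \<Longrightarrow> g x = 0"
  shows "set_integrable lborel V (\<lambda>x. f x * g x)"
    and "integrable lborel (\<lambda>x. indicator K x * f x * g x)"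
    and "(LINT x:V|lborel. f x * g x) = (LINT x|lborel. indicator K x * f x * g x)"
proof -
  have fK: "integrable lborel (\<lambda>x. indicator K x * f x)"
    using f K unfolding locally_integrable_on_def set_integrable_def by simp
  have m: "(\<lambda>x. indicator K x * f x) \<in> borel_measurable borel"
    using borel_measurable_integrable[OF fK] by simp
  show i: "integrable lborel (\<lambda>x. indicator K x * f x * g x)"
    using integrable_mult_right[OF fK, of B]
  proof (rule Bochner_Integration.integrable_bound)
    show "(\<lambda>x. indicator K x * f x * g x) \<in> borel_measurable lborel" using m g(1) by simp
    show "AE x in lborel. norm (indicator K x * f x * g x) \<le> norm (B * (indicator K x * f x))"
    proof (rule AE_I2)
      fix x
      have "\<bar>g x\<bar> \<le> \<bar>B\<bar>" using g(2)[of x] by linarith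
      then show "norm (indicator K x * f x * g x) \<le> norm (B * (indicator K x * f x))"
        by (simp add: abs_mult mult_right_mono mult.commute)
    qed
  qed
  have eq: "indicator V x *\<^sub>R (f x * g x) = indicator K x * f x * g x" for x
    using K g(3)[of x] by (cases "x \<in> K") (auto simp: indicator_def)
  from i show "set_integrable lborel V (\<lambda>x. f x * g x)" unfolding set_integrable_def eq .
  show "(LINT x:V|lborel. f x * g x) = (LINT x|lborel. indicator K x * f x * g x)"
    unfolding set_lebesgue_integral_def eq ..
qed

text \<open>Dominated convergence along the box bumps turns the hypothesis into vanishing integrals over all
boxes whose closure lies in \<open>V\<close>; intersecting with a fixed such box covers arbitrary boxes.\<close>

lemma fundamental_lemma_variations:
  fixes f :: "real ^ 'n::finite \<Rightarrow> real"
  assumes "open V" and f: "locally_integrable_on V f"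
    and test: "\<And>\<eta>. test_function V \<eta> \<Longrightarrow> (LINT x:V|lborel. f x * \<eta> x) = 0"
  shows "AE x in lborel. x \<in> V \<longrightarrow> f x = 0"
proof -
  have int0: "(LINT x|lborel. indicator (box a b) x * f x) = 0" if ab: "cbox a b \<subseteq> V" for a b
  proof -
    have fK: "integrable lborel (\<lambda>x. indicator (cbox a b) x * f x)"
      using f ab unfolding locally_integrable_on_def set_integrable_def by simp
    then have m[measurable]: "(\<lambda>x. indicator (cbox a b) x * f x) \<in> borel_measurable borel"
      using borel_measurable_integrable by fastforce
    have bm[measurable]: "box_bump k a b \<in> borel_measurable borel" for k
      using Ck_on_box_bump[of 0 k a b] by (simp add: borel_measurable_continuous_onI)
    have "(\<lambda>k. LINT x|lborel. indicator (cbox a b) x * f x * box_bump k a b x)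
        \<longlonglongrightarrow> (LINT x|lborel. indicator (cbox a b) x * f x * indicator (box a b) x)"
    proof (rule integral_dominated_convergence[where w="\<lambda>x. norm (indicator (cbox a b) x * f x)"])
      show "integrable lborel (\<lambda>x. norm (indicator (cbox a b) x * f x))" using fK by (rule integrable_norm)
      show "AE x in lborel. norm (indicator (cbox a b) x * f x * box_bump k a b x) \<le> norm (indicator (cbox a b) x * f x)" for k
        by (intro AE_I2) (simp only: real_norm_def abs_mult[of _ "box_bump k a b _"]
            abs_of_nonneg[OF box_bump_nonneg] mult_left_le[OF box_bump_le_1 abs_ge_zero])
      show "AE x in lborel. (\<lambda>k. indicator (cbox a b) x * f x * box_bump k a b x)
          \<longlonglongrightarrow> indicator (cbox a b) x * f x * indicator (box a b) x"
        by (intro AE_I2 tendsto_intros box_bump_tendsto)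
    qed measurable
    moreover have "(LINT x|lborel. indicator (cbox a b) x * f x * box_bump k a b x) = 0" for k
    proof -
      have "(LINT x|lborel. indicator (cbox a b) x * f x * box_bump k a b x) = (LINT x:V|lborel. f x * box_bump k a b x)"
      proof (rule locally_integrable_imp_integrable_mult(3)[OF f _ ab bm, symmetric])
        show "\<bar>box_bump k a b x\<bar> \<le> 1" for x using box_bump_nonneg[of k a b x] box_bump_le_1[of k a b x] by simp
        show "box_bump k a b x = 0" if "x \<notin> cbox a b" for x
          using that box_subset_cbox[of a b] by (intro box_bump_eq_0) blast
      qed simp
      then show ?thesis using test[OF test_function_box_bump[OF ab]] by simp
    qed
    ultimately have "(LINT x|lborel. indicator (cbox a b) x * f x * indicator (box a b) x) = 0"
      by (simp add: LIMSEQ_const_iff)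
    moreover have "indicator (cbox a b) x * f x * indicator (box a b) x = indicator (box a b) x * f x" for x
      using box_subset_cbox[of a b] by (auto simp: indicator_def)
    ultimately show ?thesis by simp
  qed
  have ae: "AE x in lborel. x \<in> box a b \<longrightarrow> f x = 0" if ab: "cbox a b \<subseteq> V" for a b
  proof -
    have fK: "set_integrable lborel (cbox a b) f"
      using f ab unfolding locally_integrable_on_def by simp
    then have "set_integrable lborel (box a b) f"
      by (rule set_integrable_subset) (auto simp: box_subset_cbox)
    then have i: "integrable lborel (\<lambda>x. indicator (box a b) x * f x)"
      by (simp add: set_integrable_def)
    have "AE x in lborel. indicator (box a b) x * f x = 0"
    proof (rule AE_eq_0_if_box_integrals_eq_0[OF i])
      fix c d :: "real ^ 'n"
      obtain p q where pq: "box c d \<inter> box a b = box p q" using box_Int_box by blast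
      show "(LINT x:box c d|lborel. indicator (box a b) x * f x) = 0"
      proof (cases "box p q = {}")
        case True
        then have "(\<lambda>x. indicator (box c d) x *\<^sub>R (indicator (box a b) x * f x)) = (\<lambda>x. 0)"
          using pq by (auto simp: indicator_def fun_eq_iff)
        then show ?thesis unfolding set_lebesgue_integral_def by (simp only: integral_zero)
      next
        case False
        then have "cbox p q = closure (box p q)" by simp
        also have "\<dots> \<subseteq> closure (box a b)" using pq by (intro closure_mono) blast
        also have "\<dots> \<subseteq> cbox a b" using box_subset_cbox by (intro closure_minimal) auto
        finally have "cbox p q \<subseteq> V" using ab by blast
        moreover have "(\<lambda>x. indicator (box c d) x *\<^sub>R (indicator (box a b) x * f x)) = (\<lambda>x. indicator (box p q) x * f x)"
          using pq by (auto simp: indicator_def fun_eq_iff)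
        ultimately show ?thesis unfolding set_lebesgue_integral_def using int0 by (simp only:)
      qed
    qed
    then show ?thesis by eventually_elim (auto simp: indicator_def)
  qed
  obtain \<D> where D: "countable \<D>" "\<Union>\<D> = V" "\<And>X. X \<in> \<D> \<Longrightarrow> \<exists>a b. X = cbox a b \<and> cbox a b \<subseteq> V"
    using open_countable_Union_open_cbox[OF assms(1)] by (metis Union_upper)
  have "\<forall>X\<in>\<D>. AE x in lborel. x \<in> X \<longrightarrow> f x = 0"
  proof
    fix X assume "X \<in> \<D>"
    then obtain a b where X: "X = cbox a b" "cbox a b \<subseteq> V" using D(3) by blast
    have "cbox a b - box a b \<in> null_sets lborel"
      using negligible_frontier_interval[of a b] by (simp add: negligible_iff_null_sets null_sets_completion_iff)
    then have "AE x in lborel. x \<notin> cbox a b - box a b" by (rule AE_not_in)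
    with ae[OF X(2)] show "AE x in lborel. x \<in> X \<longrightarrow> f x = 0"
      by eventually_elim (auto simp: X(1))
  qed
  then have "AE x in lborel. \<forall>X\<in>\<D>. x \<in> X \<longrightarrow> f x = 0"
    by (simp only: AE_ball_countable[OF D(1)])
  then show ?thesis by eventually_elim (use D(2) in blast)
qed

section \<open>Integration by parts\<close>

lemma frechet_derivative_eq_0_outside_compact:
  assumes "compact K" "\<And>x. x \<notin> K \<Longrightarrow> g x = 0" "x \<notin> K"
  shows "g differentiable (at x)" "frechet_derivative g (at x) v = 0"
proof -
  have "(g has_derivative (\<lambda>_. 0)) (at x)"
    by (rule has_derivative_transform_within_open[of "\<lambda>_. 0" _ x UNIV "- K"])
       (use assms compact_imp_closed in auto)
  then show "g differentiable (at x)" "frechet_derivative g (at x) v = 0"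
    by (auto simp: frechet_derivative_unique_at differentiableI)
qed

lemma bounded_if_compactly_supported:
  fixes f :: "'a::metric_space \<Rightarrow> real"
  assumes "continuous_on UNIV f" "compact K" "\<And>x. x \<notin> K \<Longrightarrow> f x = 0"
  obtains B where "\<And>x. \<bar>f x\<bar> \<le> B"
proof -
  have "bounded (f ` K)"
    using assms by (intro compact_imp_bounded compact_continuous_image) (auto intro: continuous_on_subset)
  then obtain B where "\<And>x. x \<in> K \<Longrightarrow> \<bar>f x\<bar> \<le> B" by (auto simp: bounded_iff)
  then have "\<bar>f x\<bar> \<le> max B 0" for x
    using assms(3)[of x] by (cases "x \<in> K") (auto intro: le_max_iff_disj[THEN iffD2])
  then show ?thesis using that by blast
qed

text \<open>The integral of each difference quotient is zero by translation invariance. The mean value theorem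
bounds the quotients uniformly, and they are supported in a common ball, so the limit may be taken
under the integral.\<close>

lemma integral_directional_derivative_eq_0:
  fixes g :: "real ^ 'n::finite \<Rightarrow> real"
  assumes diff: "\<And>x. g differentiable (at x)"
    and cont: "continuous_on UNIV (\<lambda>x. frechet_derivative g (at x) v)"
    and K: "compact K" "\<And>x. x \<notin> K \<Longrightarrow> g x = 0"
  shows "(LINT x|lborel. frechet_derivative g (at x) v) = 0"
proof -
  let ?d = "\<lambda>x. frechet_derivative g (at x) v"
  have der: "(g has_derivative frechet_derivative g (at x)) (at x)" for x
    using diff by (simp add: frechet_derivative_works)
  have d0: "?d x = 0" if "x \<notin> K" for x
    by (rule frechet_derivative_eq_0_outside_compact(2)[OF K that])
  obtain B where B: "\<And>x. \<bar>?d x\<bar> \<le> B"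
    using bounded_if_compactly_supported[OF cont K(1) d0] by metis
  obtain R where R: "\<And>x. x \<in> K \<Longrightarrow> norm x \<le> R" using compact_imp_bounded[OF K(1)] by (auto simp: bounded_iff)
  have gc: "continuous_on UNIV g"
    using diff by (auto intro!: differentiable_imp_continuous_on simp: differentiable_on_def)
  have lip: "\<bar>g (x + t *\<^sub>R v) - g x\<bar> \<le> t * B" if "t > 0" for x t
  proof -
    have "((\<lambda>s. g (x + s *\<^sub>R v)) has_derivative (\<lambda>h. frechet_derivative g (at (x + s *\<^sub>R v)) (h *\<^sub>R v))) (at s)" for s
      by (rule has_derivative_compose[OF _ der]) (auto intro!: derivative_eq_intros)
    then have "((\<lambda>s. g (x + s *\<^sub>R v)) has_field_derivative ?d (x + s *\<^sub>R v)) (at s)" for s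
      using linear_cmul[OF linear_frechet_derivative[OF diff]]
      by (simp add: has_field_derivative_def mult.commute[of _ "?d _"] mult_commute_abs)
    from MVT2[OF that, of "\<lambda>s. g (x + s *\<^sub>R v)" "\<lambda>s. ?d (x + s *\<^sub>R v)"] this
    obtain z where "g (x + t *\<^sub>R v) - g x = t * ?d (x + z *\<^sub>R v)" by auto
    with B[of "x + z *\<^sub>R v"] that show ?thesis by (simp add: abs_mult)
  qed
  define q where "q = (\<lambda>k x. real (Suc k) * (g (x + (1 / real (Suc k)) *\<^sub>R v) - g x))"
  have gi: "integrable lborel g"
  proof -
    have "set_integrable lborel K g"
      unfolding set_integrable_def
      by (rule borel_integrable_compact[OF K(1)]) (use gc in \<open>auto intro: continuous_on_subset\<close>)
    moreover have "(\<lambda>x. indicator K x *\<^sub>R g x) = g" using K(2) by (auto simp: indicator_def fun_eq_iff)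
    ultimately show ?thesis by (simp only: set_integrable_def)
  qed
  have [measurable]: "g \<in> borel_measurable borel" "?d \<in> borel_measurable borel"
    using gc cont by (auto intro: borel_measurable_continuous_onI)
  have "(LINT x|lborel. q k x) = 0" for k
  proof -
    let ?w = "(1 / real (Suc k)) *\<^sub>R v"
    have "integrable (distr lborel borel ((+) ?w)) g" "(LINT x|distr lborel borel ((+) ?w). g x) = (LINT x|lborel. g x)"
      using gi by (simp_all add: lborel_distr_plus)
    then have "integrable lborel (\<lambda>x. g (x + ?w))" "(LINT x|lborel. g (x + ?w)) = (LINT x|lborel. g x)"
      by (simp_all add: integrable_distr_eq integral_distr add.commute)
    then show ?thesis unfolding q_def using gi by simp
  qed
  moreover have "(\<lambda>k. LINT x|lborel. q k x) \<longlonglongrightarrow> (LINT x|lborel. ?d x)"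
  proof (rule integral_dominated_convergence[where w="\<lambda>x. B * indicator (cball 0 (R + norm v)) x"])
    show "integrable lborel (\<lambda>x. B * indicat_real (cball 0 (R + norm v)) x)"
      by (intro integrable_mult_right integrable_real_indicator) (use emeasure_bounded_finite[OF bounded_cball] in auto)
    show "AE x in lborel. (\<lambda>k. q k x) \<longlonglongrightarrow> ?d x"
    proof (rule AE_I2)
      fix x
      have "((\<lambda>s. g (x + s *\<^sub>R v)) has_derivative (\<lambda>h. frechet_derivative g (at (x + 0 *\<^sub>R v)) (h *\<^sub>R v))) (at 0)"
        by (rule has_derivative_compose[OF _ der]) (auto intro!: derivative_eq_intros)
      then have "((\<lambda>s. g (x + s *\<^sub>R v)) has_field_derivative ?d x) (at 0)"
        using linear_cmul[OF linear_frechet_derivative[OF diff]]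
        by (simp add: has_field_derivative_def mult.commute[of _ "?d _"] mult_commute_abs)
      then have "(\<lambda>h. (g (x + h *\<^sub>R v) - g x) / h) \<midarrow>0\<rightarrow> ?d x" by (simp add: DERIV_def)
      moreover have "filterlim (\<lambda>k. 1 / real (Suc k)) (at 0) sequentially"
        using LIMSEQ_inverse_real_of_nat by (auto simp: filterlim_at inverse_eq_divide)
      ultimately have "(\<lambda>k. (g (x + (1 / real (Suc k)) *\<^sub>R v) - g x) / (1 / real (Suc k))) \<longlonglongrightarrow> ?d x"
        by (rule filterlim_compose)
      then show "(\<lambda>k. q k x) \<longlonglongrightarrow> ?d x" by (simp add: q_def mult.commute)
    qed
    show "AE x in lborel. norm (q k x) \<le> B * indicator (cball 0 (R + norm v)) x" for k
    proof (rule AE_I2)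
      fix x
      let ?t = "1 / real (Suc k)"
      have nv: "norm (?t *\<^sub>R v) \<le> norm v" using mult_left_le_one_le[of "norm v" ?t] by simp
      show "norm (q k x) \<le> B * indicator (cball 0 (R + norm v)) x"
      proof (cases "x \<in> cball 0 (R + norm v)")
        case True
        have "norm (q k x) = real (Suc k) * \<bar>g (x + ?t *\<^sub>R v) - g x\<bar>" by (simp add: q_def abs_mult)
        also have "\<dots> \<le> real (Suc k) * (?t * B)" by (intro mult_left_mono lip) auto
        finally show ?thesis using True by simp
      next
        case False
        then have "norm x > R + norm v" by simp
        moreover have "norm (x + ?t *\<^sub>R v) \<ge> norm x - norm (?t *\<^sub>R v)" by (rule norm_diff_ineq)
        ultimately have "norm x > R" "norm (x + ?t *\<^sub>R v) > R" using nv norm_ge_zero[of v] by linarith+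
        then have "g x = 0" "g (x + ?t *\<^sub>R v) = 0" using K(2) R by (meson not_less)+
        with False show ?thesis by (simp add: q_def)
      qed
    qed
    show "(\<lambda>x. q k x) \<in> borel_measurable lborel" for k unfolding q_def by measurable
  qed measurable
  ultimately show ?thesis by (simp add: LIMSEQ_const_iff)
qed

lemma test_function_smooth:
  assumes "test_function V \<eta>"
  shows "\<eta> differentiable (at x)" "continuous_on UNIV (\<lambda>x. frechet_derivative \<eta> (at x) v)"
    "continuous_on UNIV \<eta>"
proof -
  have C: "Ck_on k UNIV \<eta>" for k
    using assms by (simp add: test_function_def smooth_on_iff_Ck_on)
  show "\<eta> differentiable (at x)" "continuous_on UNIV (\<lambda>x. frechet_derivative \<eta> (at x) v)" "continuous_on UNIV \<eta>"
    using C[of 1] C[of 0] by simp_all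
qed

lemma test_function_support:
  assumes "test_function V \<eta>"
  obtains K where "compact K" "K \<subseteq> V" "\<And>x. x \<notin> K \<Longrightarrow> \<eta> x = 0"
    "\<And>x v. x \<notin> K \<Longrightarrow> frechet_derivative \<eta> (at x) v = 0"
proof -
  let ?K = "closure {x. \<eta> x \<noteq> 0}"
  have 0: "\<eta> x = 0" if "x \<notin> ?K" for x
    using that closure_subset[of "{x. \<eta> x \<noteq> 0}"] by (metis (mono_tags) mem_Collect_eq subsetD)
  have K: "compact ?K" "?K \<subseteq> V" using assms by (auto simp: test_function_def)
  show ?thesis
    by (rule that[OF K 0 frechet_derivative_eq_0_outside_compact(2)[OF K(1) 0]])
qed

lemma continuous_imp_locally_integrable:
  fixes f :: "real ^ 'n::finite \<Rightarrow> 'b::{banach,second_countable_topology}"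
  assumes "continuous_on V f" shows "locally_integrable_on V f"
  unfolding locally_integrable_on_def
  unfolding set_integrable_def using assms
  by (auto intro!: borel_integrable_compact intro: continuous_on_subset)

text \<open>The product \<open>f \<eta>\<close>, extended by zero, is continuously differentiable on the whole space because it
vanishes identically near the complement of \<open>V\<close>.\<close>

lemma integration_by_parts:
  fixes f :: "real ^ 'n::finite \<Rightarrow> real"
  assumes V: "open V" and f: "Ck_on 1 V f" and \<eta>: "test_function V \<eta>"
  shows "(LINT x:V|lborel. f x * frechet_derivative \<eta> (at x) v) = - (LINT x:V|lborel. frechet_derivative f (at x) v * \<eta> x)"
proof -
  note t = test_function_smooth[OF \<eta>]
  obtain K where K: "compact K" "K \<subseteq> V" and \<eta>0: "\<And>x. x \<notin> K \<Longrightarrow> \<eta> x = 0"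
    and d\<eta>0: "\<And>x v. x \<notin> K \<Longrightarrow> frechet_derivative \<eta> (at x) v = 0"
    using test_function_support[OF \<eta>] by metis
  have "closed K" using K(1) by (rule compact_imp_closed)
  define g where "g x = (if x \<in> V then f x * \<eta> x else 0)" for x
  define d where "d x = (if x \<in> V then f x * frechet_derivative \<eta> (at x) v + frechet_derivative f (at x) v * \<eta> x else 0)" for x
  have fd: "f differentiable (at x)" if "x \<in> V" for x using f that by simp
  have fc: "continuous_on V f" "continuous_on V (\<lambda>x. frechet_derivative f (at x) v)"
    using f Ck_on_Suc_imp[of 0 V f] by simp_all
  have 1: "g differentiable (at x) \<and> frechet_derivative g (at x) v = d x" for x
  proof (cases "x \<in> V")
    case True
    have "((\<lambda>x. f x * \<eta> x) has_derivative
      (\<lambda>v. f x * frechet_derivative \<eta> (at x) v + frechet_derivative f (at x) v * \<eta> x)) (at x)"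
      using fd[OF True] t(1) by (intro has_derivative_mult) (auto simp: frechet_derivative_works)
    then have "(g has_derivative
      (\<lambda>v. f x * frechet_derivative \<eta> (at x) v + frechet_derivative f (at x) v * \<eta> x)) (at x)"
      by (rule has_derivative_transform_within_open[OF _ V True]) (simp add: g_def)
    then show ?thesis using True by (auto simp: d_def frechet_derivative_unique_at differentiable_def)
  next
    case False
    then have "x \<notin> K" using K(2) by blast
    with False show ?thesis
      using frechet_derivative_eq_0_outside_compact[OF K(1), of g x] \<eta>0 by (auto simp: d_def g_def)
  qed
  have "continuous_on (V \<union> - K) d"
  proof (rule continuous_on_open_Un[OF V])
    show "continuous_on V d"
      by (rule continuous_on_eq[of _ "\<lambda>x. f x * frechet_derivative \<eta> (at x) v + frechet_derivative f (at x) v * \<eta> x"])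
         (use fc t(2,3) in \<open>auto intro!: continuous_intros intro: continuous_on_subset simp: d_def\<close>)
    show "continuous_on (- K) d"
      by (rule continuous_on_eq[of _ "\<lambda>x. 0"]) (auto simp: d_def \<eta>0 d\<eta>0)
  qed (use \<open>closed K\<close> in auto)
  moreover have "V \<union> - K = UNIV" using K(2) by blast
  ultimately have dc: "continuous_on UNIV (\<lambda>x. frechet_derivative g (at x) v)" using 1 by simp
  have "(LINT x|lborel. frechet_derivative g (at x) v) = 0"
    using 1 \<eta>0 by (intro integral_directional_derivative_eq_0[OF _ dc K(1)]) (auto simp: g_def)
  then have z: "(LINT x|lborel. d x) = 0" using 1 by simp
  obtain B1 B2 where B: "\<And>x. \<bar>frechet_derivative \<eta> (at x) v\<bar> \<le> B1" "\<And>x. \<bar>\<eta> x\<bar> \<le> B2"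
    using bounded_if_compactly_supported[OF t(2) K(1) d\<eta>0] bounded_if_compactly_supported[OF t(3) K(1) \<eta>0] by metis
  have i1: "set_integrable lborel V (\<lambda>x. f x * frechet_derivative \<eta> (at x) v)"
    by (rule locally_integrable_imp_integrable_mult(1)[OF continuous_imp_locally_integrable[OF fc(1)] K _ B(1) d\<eta>0])
       (use t(2) in \<open>auto intro: borel_measurable_continuous_onI\<close>)
  have i2: "set_integrable lborel V (\<lambda>x. frechet_derivative f (at x) v * \<eta> x)"
    by (rule locally_integrable_imp_integrable_mult(1)[OF continuous_imp_locally_integrable[OF fc(2)] K _ B(2) \<eta>0])
       (use t(3) in \<open>auto intro: borel_measurable_continuous_onI\<close>)
  have "(LINT x|lborel. d x) = (LINT x:V|lborel. f x * frechet_derivative \<eta> (at x) v + frechet_derivative f (at x) v * \<eta> x)"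
    unfolding set_lebesgue_integral_def by (intro Bochner_Integration.integral_cong) (auto simp: d_def)
  also have "\<dots> = (LINT x:V|lborel. f x * frechet_derivative \<eta> (at x) v) + (LINT x:V|lborel. frechet_derivative f (at x) v * \<eta> x)"
    by (rule set_integral_add[OF i1 i2])
  finally show ?thesis using z by simp
qed

section \<open>Change of variables for nonnegative functions\<close>

text \<open>Translates between absolute integrability and finiteness of the nonnegative integral, so that an
equivalence of the former gives an identity in \<open>[0, \<infinity>]\<close>.\<close>

lemma nn_integral_absolutely_integrable:
  fixes h :: "'a::euclidean_space \<Rightarrow> real"
  assumes "\<And>x. x \<in> T \<Longrightarrow> 0 \<le> h x" and m: "(\<lambda>x. indicator T x * h x) \<in> borel_measurable borel"
  shows "h absolutely_integrable_on T \<longleftrightarrow> (\<integral>\<^sup>+x\<in>T. ennreal (h x) \<partial>lborel) \<noteq> \<infinity>"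
    and "h absolutely_integrable_on T \<Longrightarrow> (\<integral>\<^sup>+x\<in>T. ennreal (h x) \<partial>lborel) = ennreal (integral T h)"
proof -
  have eq: "(\<integral>\<^sup>+x\<in>T. ennreal (h x) \<partial>lborel) = (\<integral>\<^sup>+x. ennreal (indicator T x * h x) \<partial>lborel)"
    by (intro nn_integral_cong) (auto simp: indicator_def)
  have nn: "0 \<le> indicator T x * h x" for x using assms(1) by (auto simp: indicator_def)
  have 1: "h absolutely_integrable_on T \<longleftrightarrow> integrable lborel (\<lambda>x. indicator T x * h x)"
    using m by (simp add: set_integrable_def integrable_completion)
  show "h absolutely_integrable_on T \<longleftrightarrow> (\<integral>\<^sup>+x\<in>T. ennreal (h x) \<partial>lborel) \<noteq> \<infinity>"
    unfolding 1 eq integrable_iff_bounded using m nn by (simp add: less_top)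
  assume h: "h absolutely_integrable_on T"
  have "(\<integral>\<^sup>+x. ennreal (indicator T x * h x) \<partial>lborel) = ennreal (LINT x|lborel. indicator T x * h x)"
    using h 1 nn by (intro nn_integral_eq_integral) auto
  also have "(LINT x|lborel. indicator T x * h x) = (LINT x:T|lebesgue. h x)"
    using m by (simp add: set_lebesgue_integral_def integral_completion)
  also have "\<dots> = integral T h" by (rule set_lebesgue_integral_eq_integral(2)[OF h])
  finally show "(\<integral>\<^sup>+x\<in>T. ennreal (h x) \<partial>lborel) = ennreal (integral T h)" using eq by simp
qed

lemma nn_integral_change_of_variables_wellorder:
  fixes g :: "real^'n::{finite,wellorder} \<Rightarrow> real^'n::_" and f :: "real^'n::_ \<Rightarrow> real"
  assumes S: "S \<in> sets borel"
    and der: "\<And>x. x \<in> S \<Longrightarrow> (g has_derivative g' x) (at x within S)"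
    and inj: "inj_on g S" and f: "\<And>x. 0 \<le> f x"
    and m1: "(\<lambda>x. indicator (g ` S) x * f x) \<in> borel_measurable borel"
    and m2: "(\<lambda>x. indicator S x * (\<bar>det (matrix (g' x))\<bar> * f (g x))) \<in> borel_measurable borel"
  shows "(\<integral>\<^sup>+y\<in>g ` S. ennreal (f y) \<partial>lborel) = (\<integral>\<^sup>+x\<in>S. ennreal (\<bar>det (matrix (g' x))\<bar> * f (g x)) \<partial>lborel)"
proof -
  have S': "S \<in> sets lebesgue" using S by (simp add: sets_completionI_sets)
  let ?h = "\<lambda>x. \<bar>det (matrix (g' x))\<bar> * f (g x)"
  have cov: "?h absolutely_integrable_on S \<and> integral S ?h = b \<longleftrightarrow>
      f absolutely_integrable_on (g ` S) \<and> integral (g ` S) f = b" for b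
  proof -
    have "(\<lambda>x. \<bar>det (matrix (g' x))\<bar> *\<^sub>R (vec (f (g x)) :: real^1)) absolutely_integrable_on S \<and>
           integral S (\<lambda>x. \<bar>det (matrix (g' x))\<bar> *\<^sub>R (vec (f (g x)) :: real^1)) = vec b
     \<longleftrightarrow> (\<lambda>x. vec (f x) :: real^1) absolutely_integrable_on (g ` S) \<and> integral (g ` S) (\<lambda>x. vec (f x) :: real^1) = vec b"
      by (rule has_absolute_integral_change_of_variables[OF S' der inj])
    moreover have "(\<lambda>x. \<bar>det (matrix (g' x))\<bar> *\<^sub>R (vec (f (g x)) :: real^1)) = (\<lambda>x. vec (?h x))"
      by (auto simp: vec_eq_iff)
    ultimately show ?thesis
      by (simp add: absolutely_integrable_on_1_iff integral_on_1_eq)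
  qed
  have h: "0 \<le> ?h x" for x using f by simp
  note N1 = nn_integral_absolutely_integrable[of "g ` S" f, OF f m1]
    and N2 = nn_integral_absolutely_integrable[of S ?h, OF h m2]
  show ?thesis
  proof (cases "f absolutely_integrable_on (g ` S)")
    case True
    with cov have "?h absolutely_integrable_on S" "integral S ?h = integral (g ` S) f" by blast+
    with True N1(2) N2(2) show ?thesis by (simp only:)
  next
    case False
    moreover from this cov have "\<not> ?h absolutely_integrable_on S" by blast
    ultimately show ?thesis using N1(1) N2(1) by (simp only: not_not)
  qed
qed

text \<open>A copy of a finite type with a well-order inherited from an enumeration. Renaming the coordinates
preserves Lebesgue measure and determinants, and so carries the change of variables formula over from
well-ordered index types to arbitrary finite ones, such as the coordinate indices of a manifold.\<close>

typedef 'n relabeled = "UNIV :: 'n set" morphisms old_label new_label by simp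

instantiation relabeled :: (finite) "{finite, wellorder}"
begin

definition less_eq_relabeled :: "'a relabeled \<Rightarrow> 'a relabeled \<Rightarrow> bool" where
  "less_eq_relabeled i j \<longleftrightarrow> to_nat (old_label i) \<le> to_nat (old_label j)"

definition less_relabeled :: "'a relabeled \<Rightarrow> 'a relabeled \<Rightarrow> bool" where
  "less_relabeled i j \<longleftrightarrow> to_nat (old_label i) < to_nat (old_label j)"

instance
proof
  have "(UNIV :: 'a relabeled set) = range new_label"
    by (metis UNIV_eq_I old_label_inverse rangeI)
  then show "finite (UNIV :: 'a relabeled set)" by (metis finite finite_imageI)
  show "P a" if "\<And>x :: 'a relabeled. (\<And>y. y < x \<Longrightarrow> P y) \<Longrightarrow> P x" for P a
  proof (induction a rule: measure_induct_rule[of "\<lambda>i. to_nat (old_label i)"])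
    case (less x)
    then show ?case by (rule_tac that) (simp add: less_relabeled_def)
  qed
qed (auto simp: less_eq_relabeled_def less_relabeled_def old_label_inject)

end

lemma old_new_label [simp]: "old_label (new_label i) = i" "new_label (old_label j) = j"
  by (simp_all add: new_label_inverse old_label_inverse)

lemma bij_old_label: "bij old_label"
  by (rule o_bij[of new_label]) auto

lemma bij_new_label: "bij new_label"
  by (rule o_bij[of old_label]) auto

definition relabel :: "real ^ 'n::finite \<Rightarrow> real ^ 'n relabeled" where
  "relabel x = (\<chi> i. x $ old_label i)"

definition unlabel :: "real ^ 'n relabeled \<Rightarrow> real ^ 'n::finite" where
  "unlabel y = (\<chi> i. y $ new_label i)"

lemma relabel_nth [simp]: "relabel x $ i = x $ old_label i" "unlabel y $ j = y $ new_label j"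
  by (simp_all add: relabel_def unlabel_def)

lemma unlabel_relabel [simp]: "unlabel (relabel x) = x" "relabel (unlabel y) = y"
  by (simp_all add: vec_eq_iff)

lemma bounded_linear_relabel: "bounded_linear relabel" and bounded_linear_unlabel: "bounded_linear unlabel"
  by (auto intro!: linear_linear[THEN iffD2] linearI simp: vec_eq_iff linear_conv_bounded_linear[symmetric])

lemma lborel_relabel: "(lborel :: (real ^ 'n::finite relabeled) measure) = distr lborel borel relabel"
proof (rule lborel_eqI)
  have [measurable]: "relabel \<in> borel_measurable borel"
    by (intro borel_measurable_continuous_onI linear_continuous_on bounded_linear_relabel)
  have Basis: "(\<Prod>b\<in>Basis. F b) = (\<Prod>i\<in>UNIV. F (axis i 1))" for F :: "real ^ 'k::finite \<Rightarrow> real"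
  proof -
    have 1: "Basis = range (\<lambda>i::'k. axis i (1::real))" by (auto simp: Basis_vec_def)
    have 2: "inj (\<lambda>i::'k. axis i (1::real))" by (auto simp: inj_def axis_eq_axis)
    show ?thesis unfolding 1 prod.reindex[OF 2] by (simp only: o_def)
  qed
  fix l u :: "real ^ 'n relabeled"
  assume "\<And>b. b \<in> Basis \<Longrightarrow> l \<bullet> b \<le> u \<bullet> b"
  from this[of "axis _ 1"] have le: "l $ i \<le> u $ i" for i
    by (simp add: inner_axis)
  have "relabel -` box l u = box (unlabel l) (unlabel u)"
  proof (intro set_eqI)
    fix x :: "real ^ 'n"
    show "x \<in> relabel -` box l u \<longleftrightarrow> x \<in> box (unlabel l) (unlabel u)"
      unfolding vimage_eq mem_box_cart by (auto simp: ) (metis old_new_label)+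
  qed
  then have "emeasure (distr lborel borel relabel) (box l u) = emeasure lborel (box (unlabel l) (unlabel u))"
    by (subst emeasure_distr) auto
  also have "\<dots> = (\<Prod>b\<in>Basis. (unlabel u - unlabel l) \<bullet> b)"
    using le by (intro emeasure_lborel_box) (auto simp: Basis_vec_def inner_axis)
  also have "(\<Prod>b\<in>Basis. (unlabel u - unlabel l) \<bullet> b) = (\<Prod>i\<in>UNIV. u $ new_label i - l $ new_label i)"
    by (simp add: Basis inner_axis)
  also have "\<dots> = (\<Prod>i\<in>UNIV. u $ i - l $ i)"
    by (rule prod.reindex_bij_betw[OF bij_new_label])
  also have "\<dots> = (\<Prod>b\<in>Basis. (u - l) \<bullet> b)"
    by (simp add: Basis inner_axis)
  finally show "emeasure (distr lborel borel relabel) (box l u) = (\<Prod>b\<in>Basis. (u - l) \<bullet> b)" .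
qed simp

lemma sign_conjugate_bij:
  assumes f: "bij (f :: 'b \<Rightarrow> 'a)" and p: "p permutes (UNIV :: 'a::finite set)"
  shows "sign (inv f \<circ> p \<circ> f) = sign p"
  using p finite
proof (induction rule: permutes_induct)
  case id
  have "inv f \<circ> id \<circ> f = id" using f by (auto simp: bij_def)
  then show ?case by simp
next
  case (swap a b p)
  have bp: "bij p" "permutation p"
    using swap.hyps permutes_bij permutes_imp_permutation[of UNIV p] by auto
  have fin: "finite (UNIV :: 'b set)" using f by (metis bij_betw_finite finite)
  have perm: "permutation (inv f \<circ> q \<circ> f)" if "bij q" for q
    unfolding permutation using that f fin
    by (auto intro!: bij_comp bij_imp_bij_inv finite_subset[OF subset_UNIV])
  have "inv f \<circ> (Transposition.transpose a b \<circ> p) \<circ> f = Transposition.transpose (inv f a) (inv f b) \<circ> (inv f \<circ> p \<circ> f)"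
    using f by (auto simp: fun_eq_iff Transposition.transpose_def bij_is_surj surj_f_inv_f bij_inv_eq_iff)
  then have "sign (inv f \<circ> (Transposition.transpose a b \<circ> p) \<circ> f) = sign (Transposition.transpose (inv f a) (inv f b)) * sign (inv f \<circ> p \<circ> f)"
    using perm[OF bp(1)] by (simp only: sign_compose permutation_swap_id)
  also have "sign (Transposition.transpose (inv f a) (inv f b)) = sign (Transposition.transpose a b)"
    using f by (simp add: sign_swap_id bij_inv_eq_iff bij_is_surj surj_f_inv_f)
  also have "sign (inv f \<circ> p \<circ> f) = sign p" by (rule swap.IH)
  also have "sign (Transposition.transpose a b) * sign p = sign (Transposition.transpose a b \<circ> p)"
    using bp(2) by (simp only: sign_compose permutation_swap_id)
  finally show ?case .
qed

lemma det_relabel: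
  fixes M :: "real ^ 'n::finite ^ 'n"
  shows "det (\<chi> i j. M $ old_label i $ old_label j) = det M"
proof -
  have inv: "inv old_label = (new_label :: 'n \<Rightarrow> _)"
    by (rule inv_equality) auto
  let ?c = "\<lambda>p :: 'n \<Rightarrow> 'n. new_label \<circ> p \<circ> old_label"
  have bij: "bij_betw ?c {p. p permutes UNIV} {p. p permutes UNIV}"
  proof (rule bij_betw_byWitness[where f' = "\<lambda>q. old_label \<circ> q \<circ> new_label"])
    show "?c ` {p. p permutes UNIV} \<subseteq> {p. p permutes UNIV}"
      using bij_old_label bij_new_label by (auto intro!: bij_imp_permutes bij_comp dest!: permutes_bij)
    show "(\<lambda>q. old_label \<circ> q \<circ> new_label) ` {p. p permutes UNIV} \<subseteq> {p. p permutes UNIV}"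
      using bij_old_label bij_new_label by (auto intro!: bij_imp_permutes bij_comp dest!: permutes_bij)
  qed (auto simp: fun_eq_iff)
  have "det (\<chi> i j. M $ old_label i $ old_label j)
      = (\<Sum>p\<in>{p. p permutes UNIV}. of_int (sign (?c p)) * (\<Prod>i\<in>UNIV. M $ old_label i $ old_label (?c p i)))"
    unfolding det_def by (subst sum.reindex_bij_betw[OF bij, symmetric]) simp
  also have "\<dots> = (\<Sum>p\<in>{p. p permutes UNIV}. of_int (sign p) * (\<Prod>i\<in>UNIV. M $ i $ p i))"
  proof (rule sum.cong[OF refl])
    fix p :: "'n \<Rightarrow> 'n" assume "p \<in> {p. p permutes UNIV}"
    then have "sign (?c p) = sign p"
      using sign_conjugate_bij[OF bij_old_label, of p] inv by simp
    moreover have "(\<Prod>i\<in>UNIV. M $ old_label i $ old_label (?c p i)) = (\<Prod>i\<in>UNIV. M $ i $ p i)"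
      using prod.reindex_bij_betw[OF bij_old_label, of "\<lambda>i. M $ i $ p i"] by simp
    ultimately show "of_int (sign (?c p)) * (\<Prod>i\<in>UNIV. M $ old_label i $ old_label (?c p i)) = of_int (sign p) * (\<Prod>i\<in>UNIV. M $ i $ p i)"
      by simp
  qed
  finally show ?thesis by (simp add: det_def)
qed

lemma nn_integral_unlabel:
  assumes "F \<in> borel_measurable borel"
  shows "(\<integral>\<^sup>+y. F (unlabel y) \<partial>lborel) = (\<integral>\<^sup>+x. F x \<partial>lborel)"
proof -
  have [measurable]: "relabel \<in> borel_measurable borel" "unlabel \<in> borel_measurable borel"
    by (intro borel_measurable_continuous_onI linear_continuous_on bounded_linear_relabel bounded_linear_unlabel)+
  show ?thesis using assms by (subst lborel_relabel) (simp add: nn_integral_distr)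
qed

text \<open>Conjugating \<open>g\<close> with the renaming of coordinates reduces this to the well-ordered case.\<close>

lemma nn_integral_change_of_variables:
  fixes g :: "real^'n::finite \<Rightarrow> real^'n::finite" and f :: "real^'n::finite \<Rightarrow> real"
  assumes S: "S \<in> sets borel"
    and der: "\<And>x. x \<in> S \<Longrightarrow> (g has_derivative g' x) (at x within S)"
    and inj: "inj_on g S" and f: "\<And>x. 0 \<le> f x"
    and m1: "(\<lambda>x. indicator (g ` S) x * f x) \<in> borel_measurable borel"
    and m2: "(\<lambda>x. indicator S x * (\<bar>det (matrix (g' x))\<bar> * f (g x))) \<in> borel_measurable borel"
  shows "(\<integral>\<^sup>+y\<in>g ` S. ennreal (f y) \<partial>lborel) = (\<integral>\<^sup>+x\<in>S. ennreal (\<bar>det (matrix (g' x))\<bar> * f (g x)) \<partial>lborel)"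
proof -
  note bl = bounded_linear_relabel bounded_linear_unlabel
  have [measurable]: "relabel \<in> borel_measurable borel" "unlabel \<in> borel_measurable borel"
    by (intro borel_measurable_continuous_onI linear_continuous_on bl)+
  let ?g = "\<lambda>y. relabel (g (unlabel y))" and ?g' = "\<lambda>y v. relabel (g' (unlabel y) (unlabel v))"
  let ?S = "unlabel -` S"
  have gS: "?g ` ?S = unlabel -` (g ` S)"
  proof -
    have "y \<in> ?g ` ?S" if y: "unlabel y \<in> g ` S" for y
    proof -
      obtain x where "x \<in> S" "unlabel y = g x" using y by auto
      moreover from this have "y = relabel (g x)" by (metis unlabel_relabel(2))
      ultimately show ?thesis by (intro image_eqI[of _ _ "relabel x"]) simp_all
    qed
    then show ?thesis by auto
  qed
  have det: "det (matrix (?g' y)) = det (matrix (g' (unlabel y)))" for y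
  proof -
    have "unlabel (axis j 1) = axis (old_label j) 1" for j :: "'n relabeled"
      by (auto simp: vec_eq_iff axis_def)
    then have "matrix (?g' y) = (\<chi> i j. matrix (g' (unlabel y)) $ old_label i $ old_label j)"
      by (simp add: matrix_def)
    then show ?thesis by (simp add: det_relabel)
  qed
  have ind: "indicator (?g ` ?S) y = indicator (g ` S) (unlabel y)" "indicator ?S y = indicator S (unlabel y)" for y
    unfolding gS by (auto simp: indicator_def)
  have ei: "ennreal r * indicator X x = ennreal (indicator X x * r)" for r and X :: "'b set" and x
    by (auto simp: indicator_def)
  have meas: "(\<lambda>y. F (unlabel y)) \<in> borel_measurable borel" if "F \<in> borel_measurable borel" for F :: "_ \<Rightarrow> real"
    using that by measurable
  have "(\<integral>\<^sup>+y\<in>?g ` ?S. ennreal (f (unlabel y)) \<partial>lborel)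
      = (\<integral>\<^sup>+y\<in>?S. ennreal (\<bar>det (matrix (?g' y))\<bar> * f (unlabel (?g y))) \<partial>lborel)"
  proof (rule nn_integral_change_of_variables_wellorder)
    show "?S \<in> sets borel"
      using measurable_sets[of unlabel borel borel S] S by simp
    show "(?g has_derivative ?g' y) (at y within ?S)" if "y \<in> ?S" for y
    proof -
      have "((\<lambda>y. g (unlabel y)) has_derivative (\<lambda>v. g' (unlabel y) (unlabel v))) (at y within ?S)"
        using that by (intro has_derivative_in_compose2[OF der])
          (auto intro!: bounded_linear_imp_has_derivative bl)
      then show ?thesis by (rule bounded_linear.has_derivative[OF bl(1)])
    qed
    show "inj_on ?g ?S"
      using inj by (auto simp: inj_on_def) (metis unlabel_relabel)
    show "(\<lambda>y. indicator (?g ` ?S) y * f (unlabel y)) \<in> borel_measurable borel"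
      unfolding ind by (rule meas[OF m1])
    show "(\<lambda>y. indicator ?S y * (\<bar>det (matrix (?g' y))\<bar> * f (unlabel (?g y)))) \<in> borel_measurable borel"
      unfolding ind det using meas[OF m2] by simp
  qed (rule f)
  then have "(\<integral>\<^sup>+y. ennreal (indicator (g ` S) (unlabel y) * f (unlabel y)) \<partial>lborel)
      = (\<integral>\<^sup>+y. ennreal (indicator S (unlabel y) * (\<bar>det (matrix (g' (unlabel y)))\<bar> * f (g (unlabel y)))) \<partial>lborel)"
    by (simp only: ei ind det unlabel_relabel)
  then have "(\<integral>\<^sup>+y. ennreal (indicator (g ` S) y * f y) \<partial>lborel)
      = (\<integral>\<^sup>+y. ennreal (indicator S y * (\<bar>det (matrix (g' y))\<bar> * f (g y))) \<partial>lborel)"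
    using nn_integral_unlabel[OF measurable_compose[OF m1 measurable_ennreal]]
      nn_integral_unlabel[OF measurable_compose[OF m2 measurable_ennreal]]
    by (simp only:)
  then show ?thesis by (simp only: ei)
qed

section \<open>Charts and the Riemannian volume\<close>

lemma borel_measurable_indicator_continuous:
  fixes f :: "real ^ 'k::finite \<Rightarrow> real"
  assumes "open U" "continuous_on U f" "B \<in> sets borel" "B \<subseteq> U"
  shows "(\<lambda>x. indicator B x * f x) \<in> borel_measurable borel"
proof -
  have "(\<lambda>x. indicator U x *\<^sub>R f x) \<in> borel_measurable borel"
    using assms(1,2) by (intro borel_measurable_continuous_on_indicator) auto
  then have "(\<lambda>x. indicator B x * (indicator U x *\<^sub>R f x)) \<in> borel_measurable borel"
    using assms(3) by measurable
  moreover have "(\<lambda>x. indicator B x * (indicator U x *\<^sub>R f x)) = (\<lambda>x. indicator B x * f x)"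
    using assms(4) by (auto simp: indicator_def fun_eq_iff)
  ultimately show ?thesis by (simp only:)
qed

locale riemannian =
  fixes A :: "('m::{t2_space, second_countable_topology}, 'n::finite) chart set"
    and G :: "('m, 'n) chart \<Rightarrow> 'm \<Rightarrow> real ^ 'n ^ 'n"
  assumes riem: "riemannian_manifold A G"
begin

lemma open_chart_dom: "c \<in> A \<Longrightarrow> open (chart_dom c)"
  and chart_homeo: "c \<in> A \<Longrightarrow> homeomorphism (chart_dom c) (chart_map c ` chart_dom c) (chart_map c) (chart_inv c)"
  and chart_cover: "(\<Union>c\<in>A. chart_dom c) = UNIV"
  and chart_compatible: "c \<in> A \<Longrightarrow> d \<in> A \<Longrightarrow> smoothly_compatible c d"
  using riem by (auto simp: riemannian_manifold_def smooth_atlas_def is_chart_def)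

lemma chart_inv_map [simp]: "c \<in> A \<Longrightarrow> p \<in> chart_dom c \<Longrightarrow> chart_inv c (chart_map c p) = p"
  using chart_homeo by (auto simp: homeomorphism_def)

lemma inj_on_chart_map: "c \<in> A \<Longrightarrow> inj_on (chart_map c) (chart_dom c)"
  by (metis chart_inv_map inj_onI)

lemma continuous_on_chart_map: "c \<in> A \<Longrightarrow> continuous_on (chart_dom c) (chart_map c)"
  and continuous_on_chart_inv: "c \<in> A \<Longrightarrow> continuous_on (chart_map c ` chart_dom c) (chart_inv c)"
  using chart_homeo by (auto simp: homeomorphism_def)

text \<open>Without boundary points, the charts onto relatively open subsets of half-spaces have open image too.\<close>

lemma open_chart_image:
  assumes c: "c \<in> A" shows "open (chart_map c ` chart_dom c)"
proof -
  have "chart_map c p \<in> interior (chart_map c ` chart_dom c)" if "p \<in> chart_dom c" for p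
    using riem c that by (auto simp: riemannian_manifold_def manifold_boundary_def)
  then have "chart_map c ` chart_dom c \<subseteq> interior (chart_map c ` chart_dom c)" by blast
  then show ?thesis by (metis interior_subset open_interior subset_antisym)
qed

lemma chart_image_eq_vimage:
  assumes "c \<in> A" shows "chart_map c ` (chart_dom c \<inter> X) = chart_map c ` chart_dom c \<inter> chart_inv c -` X"
  using assms by (auto simp: image_iff)

lemma open_chart_image_Int:
  assumes c: "c \<in> A" and "open X" shows "open (chart_map c ` (chart_dom c \<inter> X))"
  unfolding chart_image_eq_vimage[OF c]
  using continuous_on_chart_inv[OF c] open_chart_image[OF c] assms(2) by (simp add: continuous_on_open_vimage Int_commute)

lemma chart_image_borel:
  assumes c: "c \<in> A" and B: "B \<in> sets borel" and "B \<subseteq> chart_dom c"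
  shows "chart_map c ` B \<in> sets borel"
proof -
  let ?U = "chart_map c ` chart_dom c"
  have "chart_inv c \<in> measurable (restrict_space borel ?U) borel"
    by (rule borel_measurable_continuous_on_restrict[OF continuous_on_chart_inv[OF c]])
  from measurable_sets[OF this B]
  have "chart_inv c -` B \<inter> ?U \<in> sets (restrict_space borel ?U)" by (simp add: space_restrict_space)
  then have "chart_inv c -` B \<inter> ?U \<in> sets borel"
    using open_chart_image[OF c] by (subst (asm) sets_restrict_space_iff) auto
  moreover have "chart_map c ` B = chart_inv c -` B \<inter> ?U"
    using chart_image_eq_vimage[OF c, of B] assms(3) by (auto simp: Int_absorb1)
  ultimately show ?thesis by simp
qed

lemma chart_vimage_borel:
  assumes c: "c \<in> A" and B: "B \<in> sets borel"
  shows "chart_dom c \<inter> chart_map c -` B \<in> sets borel"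
proof -
  have "chart_map c \<in> measurable (restrict_space borel (chart_dom c)) borel"
    by (rule borel_measurable_continuous_on_restrict[OF continuous_on_chart_map[OF c]])
  from measurable_sets[OF this B]
  have "chart_map c -` B \<inter> chart_dom c \<in> sets (restrict_space borel (chart_dom c))" by (simp add: space_restrict_space)
  then show ?thesis
    using open_chart_dom[OF c] by (subst (asm) sets_restrict_space_iff) (auto simp: Int_commute)
qed

text \<open>A sequence of charts rather than a countable set, so that the cover can be made disjoint.\<close>

lemma countable_charts:
  obtains C :: "nat \<Rightarrow> ('m, 'n) chart" where "range C \<subseteq> A" "(\<Union>k. chart_dom (C k)) = UNIV"
proof -
  obtain \<F> where F: "\<F> \<subseteq> chart_dom ` A" "countable \<F>" "\<Union>\<F> = \<Union>(chart_dom ` A)"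
    using Lindelof[of "chart_dom ` A"] open_chart_dom by blast
  have U: "\<Union>\<F> = UNIV" using F(3) chart_cover by simp
  then have "\<F> \<noteq> {}" by auto
  then obtain S :: "nat \<Rightarrow> 'm set" where S: "range S = \<F>" using F(2) by (metis range_from_nat_into)
  then have "\<exists>c\<in>A. S k = chart_dom c" for k using F(1) by blast
  then obtain C where "\<And>k. C k \<in> A \<and> S k = chart_dom (C k)" by metis
  then show ?thesis using that[of C] U S by auto
qed

lemma disjointed_chart_dom_borel:
  assumes "range C \<subseteq> A"
  shows "disjointed (\<lambda>k. chart_dom (C k)) k \<in> sets borel"
proof -
  have "chart_dom (C k) \<in> sets borel" for k
    using open_chart_dom[of "C k"] assms by (intro borel_open) blast
  then have "range (disjointed (\<lambda>k. chart_dom (C k))) \<subseteq> sets borel"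
    by (intro sets.range_disjointed_sets) blast
  then show ?thesis by blast
qed

abbreviation transition_domain where
  "transition_domain c d \<equiv> chart_map c ` (chart_dom c \<inter> chart_dom d)"

lemma transition_has_derivative:
  assumes "c \<in> A" "d \<in> A" "p \<in> chart_dom c \<inter> chart_dom d"
  shows "((chart_map d \<circ> chart_inv c) has_derivative (\<lambda>v. transition_jacobian c d p *v v)) (at (chart_map c p))"
proof -
  have "open (transition_domain c d)" using assms open_chart_image_Int open_chart_dom by blast
  then have "Ck_on 1 (transition_domain c d) (chart_map d \<circ> chart_inv c)"
    using chart_compatible[OF assms(1,2)] by (auto simp: smoothly_compatible_def smooth_on_iff_Ck_on)
  then have "(chart_map d \<circ> chart_inv c) differentiable (at (chart_map c p))" using assms(3) by simp
  then have D: "((chart_map d \<circ> chart_inv c) has_derivative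
      frechet_derivative (chart_map d \<circ> chart_inv c) (at (chart_map c p))) (at (chart_map c p))"
    by (simp only: frechet_derivative_works)
  have "transition_jacobian c d p *v v
      = frechet_derivative (chart_map d \<circ> chart_inv c) (at (chart_map c p)) v" for v
    unfolding transition_jacobian_def using has_derivative_linear[OF D]
    by (intro matrix_works) (simp only: linear_matrix_vector_mul_eq)
  then show ?thesis using D by (simp only:)
qed

lemma metric_change: "c \<in> A \<Longrightarrow> d \<in> A \<Longrightarrow> p \<in> chart_dom c \<inter> chart_dom d \<Longrightarrow>
    G c p = Finite_Cartesian_Product.transpose (transition_jacobian c d p) ** G d p ** transition_jacobian c d p"
  and metric_pos: "c \<in> A \<Longrightarrow> p \<in> chart_dom c \<Longrightarrow> v \<noteq> 0 \<Longrightarrow> 0 < v \<bullet> (G c p *v v)"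
  using riem unfolding riemannian_manifold_def riemannian_metric_def by blast+

lemma continuous_on_metric:
  assumes "c \<in> A"
  shows "continuous_on (chart_map c ` chart_dom c) (\<lambda>x. G c (chart_inv c x) $ i $ j)"
proof -
  have "smooth_on (chart_map c ` chart_dom c) (G c \<circ> chart_inv c)"
    using riem assms by (auto simp: riemannian_manifold_def riemannian_metric_def)
  then have "Ck_on 0 (chart_map c ` chart_dom c) (G c \<circ> chart_inv c)"
    using smooth_on_iff_Ck_on[OF open_chart_image[OF assms]] by blast
  then show ?thesis by (auto simp: o_def intro!: continuous_intros)
qed

definition weight :: "('m, 'n) chart \<Rightarrow> real ^ 'n \<Rightarrow> real" where
  "weight c x = sqrt (det (G c (chart_inv c x)))"

lemma continuous_on_weight: "c \<in> A \<Longrightarrow> continuous_on (chart_map c ` chart_dom c) (weight c)"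
  unfolding weight_def[abs_def] det_def
  by (intro continuous_intros continuous_on_metric)

definition chart_volume :: "('m, 'n) chart \<Rightarrow> 'm set \<Rightarrow> ennreal" where
  "chart_volume c B = (\<integral>\<^sup>+x\<in>chart_map c ` B. ennreal (weight c x) \<partial>lborel)"

text \<open>The transformation law \<open>G\<^sub>c = J\<^sup>T G\<^sub>d J\<close> gives \<open>sqrt (det G\<^sub>c) = \<bar>det J\<bar> sqrt (det G\<^sub>d)\<close>, which is exactly
the density change prescribed by the change of variables formula.\<close>

lemma chart_volume_overlap:
  assumes c: "c \<in> A" and d: "d \<in> A" and B: "B \<in> sets borel" "B \<subseteq> chart_dom c \<inter> chart_dom d"
  shows "chart_volume c B = chart_volume d B"
proof -
  let ?S = "chart_map c ` B" and ?T = "chart_map d ` B"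
  let ?g = "chart_map d \<circ> chart_inv c"
  let ?J = "\<lambda>x. transition_jacobian c d (chart_inv c x)"
  \<comment> \<open>Taking the positive part leaves the extended nonnegative integrand unchanged and makes
    nonnegativity hold also outside the image of the chart.\<close>
  let ?f = "\<lambda>y. max 0 (weight d y)"
  have gS: "?g ` ?S = ?T"
    using c B(2) by (auto simp: image_image intro!: image_cong)
  have w: "\<bar>det (?J x)\<bar> * ?f (?g x) = max 0 (weight c x)" if x: "x \<in> ?S" for x
  proof -
    obtain p where p: "p \<in> B" "x = chart_map c p" using x by blast
    then have pp: "p \<in> chart_dom c \<inter> chart_dom d" and [simp]: "chart_inv c x = p" "chart_inv d (chart_map d p) = p"
      using B c d by auto
    have "det (G c p) = (det (?J x))\<^sup>2 * det (G d p)"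
      using metric_change[OF c d pp] by (simp add: det_mul det_transpose power2_eq_square)
    then have "weight c x = \<bar>det (?J x)\<bar> * weight d (?g x)"
      by (simp add: weight_def real_sqrt_mult)
    then show ?thesis by (simp add: max_mult_distrib_left)
  qed
  have "(\<integral>\<^sup>+y\<in>?g ` ?S. ennreal (?f y) \<partial>lborel)
     = (\<integral>\<^sup>+x\<in>?S. ennreal (\<bar>det (matrix (\<lambda>v. ?J x *v v))\<bar> * ?f (?g x)) \<partial>lborel)"
  proof (rule nn_integral_change_of_variables)
    show "?S \<in> sets borel" by (rule chart_image_borel) (use c B in auto)
    have T: "?T \<in> sets borel" by (rule chart_image_borel) (use d B in auto)
    show "(?g has_derivative (\<lambda>v. ?J x *v v)) (at x within ?S)" if "x \<in> ?S" for x
    proof -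
      obtain p where p: "p \<in> B" "x = chart_map c p" using \<open>x \<in> ?S\<close> by blast
      then have "p \<in> chart_dom c \<inter> chart_dom d" using B by blast
      from transition_has_derivative[OF c d this] show ?thesis
        using p \<open>p \<in> _ \<inter> _\<close> c by (auto intro: has_derivative_at_withinI)
    qed
    show "inj_on ?g ?S"
    proof (rule inj_onI)
      fix x y assume "x \<in> ?S" "y \<in> ?S" "?g x = ?g y"
      then obtain p q where pq: "p \<in> B" "q \<in> B" "x = chart_map c p" "y = chart_map c q" by blast
      then have "p \<in> chart_dom c" "q \<in> chart_dom c" "p \<in> chart_dom d" "q \<in> chart_dom d" using B(2) by auto
      moreover from this have "chart_map d p = chart_map d q" using \<open>?g x = ?g y\<close> c pq by simp
      ultimately have "p = q" using inj_on_chart_map[OF d] by (simp add: inj_on_def)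
      then show "x = y" using pq by simp
    qed
    show "(\<lambda>y. indicator (?g ` ?S) y * ?f y) \<in> borel_measurable borel"
      unfolding gS by (rule borel_measurable_indicator_continuous[OF open_chart_image[OF d] _ T])
        (use B in \<open>auto intro!: continuous_intros continuous_on_weight d\<close>)
    have "(\<lambda>x. indicator ?S x * max 0 (weight c x)) \<in> borel_measurable borel"
      by (rule borel_measurable_indicator_continuous[OF open_chart_image[OF c] _ \<open>?S \<in> sets borel\<close>])
        (use B in \<open>auto intro!: continuous_intros continuous_on_weight c\<close>)
    moreover have "(\<lambda>x. indicator ?S x * max 0 (weight c x))
       = (\<lambda>x. indicator ?S x * (\<bar>det (matrix (\<lambda>v. ?J x *v v))\<bar> * ?f (?g x)))"
      using w by (auto simp: fun_eq_iff indicator_def matrix_of_matrix_vector_mul simp del: o_apply)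
    ultimately show "(\<lambda>x. indicator ?S x * (\<bar>det (matrix (\<lambda>v. ?J x *v v))\<bar> * ?f (?g x))) \<in> borel_measurable borel"
      by (simp only:)
  qed simp
  also have "\<dots> = (\<integral>\<^sup>+x\<in>?S. ennreal (max 0 (weight c x)) \<partial>lborel)"
    using w by (intro nn_integral_cong) (auto simp: indicator_def matrix_of_matrix_vector_mul simp del: o_apply)
  finally show ?thesis
    unfolding chart_volume_def gS by (simp add: ennreal_max_0)
qed

lemma chart_volume_UN:
  assumes c: "c \<in> A" and F: "range F \<subseteq> sets borel" "disjoint_family F" "\<And>i. F i \<subseteq> chart_dom c"
  shows "(\<Sum>i::nat. chart_volume c (F i)) = chart_volume c (\<Union>i. F i)"
proof -
  let ?U = "chart_map c ` chart_dom c"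
  let ?D = "density lborel (\<lambda>x. ennreal (indicator ?U x * weight c x))"
  have m: "(\<lambda>x. indicator ?U x * weight c x) \<in> borel_measurable borel"
    by (rule borel_measurable_indicator_continuous[OF open_chart_image[OF c]])
       (use open_chart_image[OF c] continuous_on_weight[OF c] in auto)
  have vol: "chart_volume c B = emeasure ?D (chart_map c ` B)" if "B \<in> sets borel" "B \<subseteq> chart_dom c" for B
    unfolding chart_volume_def using m chart_image_borel[OF c that] that(2)
    by (subst emeasure_density) (auto intro!: nn_integral_cong simp: indicator_def, blast)
  have "(\<Sum>i. chart_volume c (F i)) = (\<Sum>i. emeasure ?D (chart_map c ` F i))"
    using vol F by (intro suminf_cong) auto
  also have "\<dots> = emeasure ?D (\<Union>i. chart_map c ` F i)"
  proof (rule suminf_emeasure)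
    show "range (\<lambda>i. chart_map c ` F i) \<subseteq> sets ?D"
      using chart_image_borel[OF c] F by auto
    show "disjoint_family (\<lambda>i. chart_map c ` F i)"
      using F(2,3) inj_on_chart_map[OF c] by (auto simp: disjoint_family_on_def inj_on_def) blast
  qed
  also have "\<dots> = chart_volume c (\<Union>i. F i)"
    using vol[of "\<Union>i. F i"] F by (simp add: image_UN UN_subset_iff image_subset_iff sets.countable_UN)
  finally show ?thesis .
qed

definition is_volume :: "'m measure \<Rightarrow> bool" where
  "is_volume \<mu> \<longleftrightarrow> sets \<mu> = sets borel \<and>
     (\<forall>c\<in>A. \<forall>B\<in>sets borel. B \<subseteq> chart_dom c \<longrightarrow> emeasure \<mu> B = chart_volume c B)"

text \<open>Every Borel set is a countable disjoint union of sets lying in single charts, where the two measures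
are prescribed.\<close>

lemma is_volume_unique:
  assumes "is_volume \<mu>" "is_volume \<nu>" shows "\<mu> = \<nu>"
proof (rule measure_eqI)
  show "sets \<mu> = sets \<nu>" using assms by (simp add: is_volume_def)
  fix B assume "B \<in> sets \<mu>"
  then have B: "B \<in> sets borel" using assms by (simp add: is_volume_def)
  obtain C :: "nat \<Rightarrow> ('m, 'n) chart" where C: "range C \<subseteq> A" "(\<Union>k. chart_dom (C k)) = UNIV" by (rule countable_charts)
  define F where "F k = B \<inter> disjointed (\<lambda>k. chart_dom (C k)) k" for k
  have Fb: "F k \<in> sets borel" for k
    unfolding F_def by (intro sets.Int B disjointed_chart_dom_borel C(1))
  have Fd: "disjoint_family F"
    using disjoint_family_disjointed[of "\<lambda>k. chart_dom (C k)"] by (fastforce simp: F_def disjoint_family_on_def)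
  have FB: "(\<Union>k. F k) = B"
    using UN_disjointed_eq[of "\<lambda>k. chart_dom (C k)"] C(2) by (auto simp: F_def)
  have "emeasure \<rho> B = (\<Sum>k. chart_volume (C k) (F k))" if "is_volume \<rho>" for \<rho>
  proof -
    have "emeasure \<rho> B = (\<Sum>k. emeasure \<rho> (F k))"
      using that Fb Fd by (subst suminf_emeasure) (auto simp: FB is_volume_def)
    also have "\<dots> = (\<Sum>k. chart_volume (C k) (F k))"
    proof (rule suminf_cong)
      fix k
      have "F k \<subseteq> chart_dom (C k)" using disjointed_subset[of "\<lambda>k. chart_dom (C k)" k] by (auto simp: F_def)
      moreover have "C k \<in> A" using C(1) by blast
      ultimately show "emeasure \<rho> (F k) = chart_volume (C k) (F k)"
        using that Fb[of k] unfolding is_volume_def by blast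
    qed
    finally show ?thesis .
  qed
  with assms show "emeasure \<mu> B = emeasure \<nu> B" by simp
qed

text \<open>A disjointed sequence of chart domains allocates each point to one chart; the resulting sum of chart
volumes has the right value on subsets of an arbitrary chart by agreement on overlaps.\<close>

lemma is_volume_exists: "\<exists>\<mu>. is_volume \<mu>"
proof -
  obtain C :: "nat \<Rightarrow> ('m, 'n) chart" where C: "range C \<subseteq> A" "(\<Union>k. chart_dom (C k)) = UNIV" by (rule countable_charts)
  define E where "E = disjointed (\<lambda>k. chart_dom (C k))"
  have Eb: "E k \<in> sets borel" for k
    unfolding E_def by (rule disjointed_chart_dom_borel[OF C(1)])
  have Ed: "disjoint_family E" unfolding E_def by (rule disjoint_family_disjointed)
  have EU: "(\<Union>k. E k) = UNIV" unfolding E_def UN_disjointed_eq C(2) ..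
  have Es: "E k \<subseteq> chart_dom (C k)" for k unfolding E_def by (rule disjointed_subset)
  have CA: "C k \<in> A" for k using C(1) by blast
  define M where "M B = (\<Sum>k. chart_volume (C k) (B \<inter> E k))" for B
  define \<mu> where "\<mu> = measure_of UNIV (sets borel) M"
  have em: "emeasure \<mu> B = M B" if B: "B \<in> sets borel" for B
  proof (rule emeasure_measure_of[OF \<mu>_def])
    show "positive (sets \<mu>) M" by (simp add: positive_def M_def chart_volume_def)
    show "countably_additive (sets \<mu>) M"
    proof (rule countably_additiveI)
      fix F :: "nat \<Rightarrow> 'm set" assume F: "range F \<subseteq> sets \<mu>" "disjoint_family F"
      then have Fb: "F i \<in> sets borel" for i using sets.sigma_sets_eq[of borel] by (auto simp: \<mu>_def)
      have "(\<Sum>i. M (F i)) = (\<Sum>i. \<integral>\<^sup>+k. chart_volume (C k) (F i \<inter> E k) \<partial>count_space UNIV)"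
        by (simp add: M_def nn_integral_count_space_nat)
      also have "\<dots> = (\<integral>\<^sup>+k. (\<Sum>i. chart_volume (C k) (F i \<inter> E k)) \<partial>count_space UNIV)"
        by (rule nn_integral_suminf[symmetric]) simp
      also have "\<dots> = (\<Sum>k. \<Sum>i. chart_volume (C k) (F i \<inter> E k))"
        by (rule nn_integral_count_space_nat)
      also have "\<dots> = (\<Sum>k. chart_volume (C k) (\<Union>i. F i \<inter> E k))"
        using Fb Eb F(2) Es
        by (intro suminf_cong chart_volume_UN CA) (auto simp: disjoint_family_on_def, blast+)
      finally show "(\<Sum>i. M (F i)) = M (\<Union>i. F i)" by (simp add: M_def)
    qed
    show "B \<in> sets \<mu>" using B sets.sigma_sets_eq[of borel] by (auto simp: \<mu>_def)
  qed auto
  have "emeasure \<mu> B = chart_volume c B" if c: "c \<in> A" and B: "B \<in> sets borel" "B \<subseteq> chart_dom c" for c B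
  proof -
    have "emeasure \<mu> B = (\<Sum>k. chart_volume c (B \<inter> E k))"
      unfolding em[OF B(1)] M_def using B Eb Es
      by (intro suminf_cong chart_volume_overlap CA c) auto
    also have "\<dots> = chart_volume c (\<Union>k. B \<inter> E k)"
      using B Eb Ed by (intro chart_volume_UN c) (auto simp: disjoint_family_on_def, blast+)
    also have "(\<Union>k. B \<inter> E k) = B" using EU by auto
    finally show ?thesis .
  qed
  moreover have "sets \<mu> = sets borel" using sets.sigma_sets_eq[of borel] by (auto simp: \<mu>_def)
  ultimately have "is_volume \<mu>" by (simp add: is_volume_def)
  then show ?thesis ..
qed

abbreviation vol where "vol \<equiv> riemannian_volume A G"

lemma is_volume_vol: "is_volume vol"
proof -
  have "vol = (THE \<mu>. is_volume \<mu>)"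
    unfolding riemannian_volume_def is_volume_def chart_volume_def weight_def ..
  then show ?thesis
    using theI'[of is_volume] is_volume_exists is_volume_unique by metis
qed

lemma sets_vol [measurable_cong, simp]: "sets vol = sets borel"
  using is_volume_vol by (simp add: is_volume_def)

lemma space_vol [simp]: "space vol = UNIV"
  using sets_eq_imp_space_eq[OF sets_vol] by simp

text \<open>This is how statements about Lebesgue measure in charts, such as the uniqueness of weak differentials,
reach the integrals over the manifold.\<close>

lemma AE_vol_chart:
  assumes c: "c \<in> A" and ae: "AE x in lborel. x \<in> chart_map c ` (chart_dom c \<inter> X) \<longrightarrow> P (chart_inv c x)"
  shows "AE p in vol. p \<in> chart_dom c \<inter> X \<longrightarrow> P p"
proof -
  obtain N where N: "N \<in> null_sets lborel"
    "{x. \<not> (x \<in> chart_map c ` (chart_dom c \<inter> X) \<longrightarrow> P (chart_inv c x))} \<subseteq> N"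
    using ae by (auto elim!: AE_E2 simp: eventually_ae_filter)
  let ?B = "chart_dom c \<inter> chart_map c -` N"
  have B: "?B \<in> sets borel" using N(1) by (intro chart_vimage_borel[OF c]) auto
  have "emeasure vol ?B = chart_volume c ?B"
    using is_volume_vol c B by (auto simp: is_volume_def)
  also have "\<dots> = 0"
  proof -
    have "AE x in lborel. x \<notin> N" using N(1) by (rule AE_not_in)
    then have "AE x in lborel. ennreal (weight c x) * indicator (chart_map c ` ?B) x = 0"
      by eventually_elim (auto simp: indicator_def)
    then have "(\<integral>\<^sup>+x\<in>chart_map c ` ?B. ennreal (weight c x) \<partial>lborel) = (\<integral>\<^sup>+x. 0 \<partial>(lborel :: (real^'n) measure))"
      by (rule nn_integral_cong_AE)
    then show ?thesis by (simp add: chart_volume_def)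
  qed
  finally have "?B \<in> null_sets vol" using B by auto
  then show ?thesis
  proof (rule AE_I')
    show "{p \<in> space vol. \<not> (p \<in> chart_dom c \<inter> X \<longrightarrow> P p)} \<subseteq> ?B"
      using N(2) c by fastforce
  qed
qed

end

section \<open>Locally integrable functions\<close>

lemma locally_integrable_cong:
  assumes "\<And>x. x \<in> V \<Longrightarrow> f x = g x"
  shows "locally_integrable_on V f \<longleftrightarrow> locally_integrable_on V g"
proof -
  have "set_integrable lborel K f \<longleftrightarrow> set_integrable lborel K g" if "K \<subseteq> V" for K
    by (rule set_integrable_cong) (use assms that in auto)
  then show ?thesis by (auto simp: locally_integrable_on_def)
qed

lemma locally_integrable_bounded_linear:
  assumes "bounded_linear T" "locally_integrable_on V f"
  shows "locally_integrable_on V (\<lambda>x. T (f x))"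
  unfolding locally_integrable_on_def
proof (intro allI impI)
  fix K assume "compact K \<and> K \<subseteq> V"
  with assms(2) have "integrable lborel (\<lambda>x. indicator K x *\<^sub>R f x)"
    by (simp add: locally_integrable_on_def set_integrable_def)
  from integrable_bounded_linear[OF assms(1) this]
  show "set_integrable lborel K (\<lambda>x. T (f x))"
    unfolding set_integrable_def linear_scale[OF bounded_linear.linear[OF assms(1)]] .
qed

lemma locally_integrable_add:
  "locally_integrable_on V f \<Longrightarrow> locally_integrable_on V g \<Longrightarrow> locally_integrable_on V (\<lambda>x. f x + g x)"
  by (auto simp: locally_integrable_on_def intro: set_integral_add)

lemma locally_integrable_lincomb:
  assumes "locally_integrable_on V f" "locally_integrable_on V g"
  shows "locally_integrable_on V (\<lambda>x. a *\<^sub>R f x + b *\<^sub>R g x)"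
  by (intro locally_integrable_add locally_integrable_bounded_linear[OF bounded_linear_scaleR_right] assms)

lemma locally_integrable_measurable:
  fixes f :: "real ^ 'n::finite \<Rightarrow> 'b::{banach, second_countable_topology}"
  assumes V: "open V" and f: "locally_integrable_on V f"
  shows "(\<lambda>x. indicator V x *\<^sub>R f x) \<in> borel_measurable borel"
proof -
  obtain C where C: "\<And>n::nat. compact (C n)" "\<And>n. C n \<subseteq> V" "\<And>n. C n \<subseteq> interior (C (Suc n))" "\<Union>(range C) = V"
    using open_Union_compact_subsets[OF V] by metis
  have inc: "C m \<subseteq> C n" if "m \<le> n" for m n
    using that C(3) interior_subset by (induction rule: dec_induct) blast+
  show ?thesis
  proof (rule borel_measurable_LIMSEQ_metric)
    fix n
    have "integrable lborel (\<lambda>x. indicator (C n) x *\<^sub>R f x)"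
      using f C(1,2) by (simp add: locally_integrable_on_def set_integrable_def)
    from borel_measurable_integrable[OF this]
    show "(\<lambda>x. indicator (C n) x *\<^sub>R f x) \<in> borel_measurable borel" by simp
  next
    fix x
    show "(\<lambda>n. indicator (C n) x *\<^sub>R f x) \<longlonglongrightarrow> indicator V x *\<^sub>R f x"
    proof (cases "x \<in> V")
      case True
      then obtain m where "x \<in> C m" using C(4) by blast
      then have "x \<in> C n" if "n \<ge> m" for n using inc[OF that] by blast
      then have "eventually (\<lambda>n. indicator (C n) x *\<^sub>R f x = indicator V x *\<^sub>R f x) sequentially"
        unfolding eventually_sequentially using True by (intro exI[of _ m]) simp
      then show ?thesis by (rule tendsto_eventually)
    next
      case False
      then have "x \<notin> C n" for n using C(2) by blast
      then show ?thesis using False by simp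
    qed
  qed
qed

lemma test_function_integrable:
  fixes f :: "real ^ 'n::finite \<Rightarrow> real"
  assumes f: "locally_integrable_on V f" and \<eta>: "test_function V \<eta>"
  shows "set_integrable lborel V (\<lambda>x. f x * \<eta> x)"
    and "set_integrable lborel V (\<lambda>x. f x * frechet_derivative \<eta> (at x) v)"
proof -
  obtain K where K: "compact K" "K \<subseteq> V" and 0: "\<And>x. x \<notin> K \<Longrightarrow> \<eta> x = 0"
    and d0: "\<And>x v. x \<notin> K \<Longrightarrow> frechet_derivative \<eta> (at x) v = 0"
    using test_function_support[OF \<eta>] by metis
  note c = test_function_smooth(2,3)[OF \<eta>]
  obtain B where B: "\<And>x. \<bar>\<eta> x\<bar> \<le> B" using bounded_if_compactly_supported[OF c(2) K(1) 0] by metis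
  show "set_integrable lborel V (\<lambda>x. f x * \<eta> x)"
    by (rule locally_integrable_imp_integrable_mult(1)[OF f K _ B 0]) (intro borel_measurable_continuous_onI c)
  obtain B' where B': "\<And>x. \<bar>frechet_derivative \<eta> (at x) v\<bar> \<le> B'"
    using bounded_if_compactly_supported[OF c(1) K(1) d0] by metis
  show "set_integrable lborel V (\<lambda>x. f x * frechet_derivative \<eta> (at x) v)"
    by (rule locally_integrable_imp_integrable_mult(1)[OF f K _ B' d0]) (intro borel_measurable_continuous_onI c)
qed

section \<open>The norm of covectors\<close>

lemma square_sum_le: "(a * x + b * y)\<^sup>2 \<le> 2 * a\<^sup>2 * x\<^sup>2 + 2 * b\<^sup>2 * (y::real)\<^sup>2"
proof -
  have "2 * a\<^sup>2 * x\<^sup>2 + 2 * b\<^sup>2 * y\<^sup>2 - (a * x + b * y)\<^sup>2 = (a * x - b * y)\<^sup>2"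
    by (simp add: power2_eq_square algebra_simps)
  then show ?thesis by (metis diff_ge_0_iff_ge zero_le_power2)
qed

lemma linear_functional_eq_inner:
  fixes L :: "real ^ 'n::finite \<Rightarrow> real"
  assumes "linear L"
  shows "L w = w \<bullet> (\<chi> j. L (axis j 1))"
proof -
  have "L w = L (\<Sum>j\<in>UNIV. w $ j *\<^sub>R axis j 1)"
    using basis_expansion[of w] by (simp add: scalar_mult_eq_scaleR)
  also have "\<dots> = (\<Sum>j\<in>UNIV. w $ j * L (axis j 1))"
    by (simp add: linear_sum[OF assms] linear_cmul[OF assms])
  finally show ?thesis by (simp add: inner_vec_def)
qed

lemma borel_measurable_det:
  fixes M :: "'a \<Rightarrow> real ^ 'n::finite ^ 'n"
  assumes "\<And>i j. (\<lambda>x. M x $ i $ j) \<in> borel_measurable N"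
  shows "(\<lambda>x. det (M x)) \<in> borel_measurable N"
  unfolding det_def using assms
  by (intro borel_measurable_sum borel_measurable_times borel_measurable_prod) auto

context riemannian
begin

abbreviation sq where "sq \<equiv> covector_sqnorm A G"

text \<open>The square \<open>g\<^sup>i\<^sup>j w\<^sub>i w\<^sub>j\<close> of the norm of a covector with components \<open>w\<close>, computed in the chart \<open>c\<close>.\<close>

definition conorm_sq :: "('m, 'n) chart \<Rightarrow> 'm \<Rightarrow> real ^ 'n \<Rightarrow> real" where
  "conorm_sq c p w = w \<bullet> (matrix_inv (G c p) *v w)"

lemma metric_invertible:
  assumes "c \<in> A" "p \<in> chart_dom c"
  shows "G c p ** matrix_inv (G c p) = mat 1" "matrix_inv (G c p) ** G c p = mat 1" "det (G c p) \<noteq> 0"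
proof -
  have "\<forall>v. G c p *v v = 0 \<longrightarrow> v = 0"
    using metric_pos[OF assms] by (metis inner_zero_right less_irrefl)
  then have "\<exists>B. B ** G c p = mat 1" by (simp only: matrix_left_invertible_ker)
  then have i: "invertible (G c p)" by (simp only: invertible_left_inverse)
  then have "\<exists>B. G c p ** B = mat 1 \<and> B ** G c p = mat 1" by (simp only: invertible_def)
  then have "G c p ** matrix_inv (G c p) = mat 1 \<and> matrix_inv (G c p) ** G c p = mat 1"
    unfolding matrix_inv_def by (rule someI_ex)
  then show "G c p ** matrix_inv (G c p) = mat 1" "matrix_inv (G c p) ** G c p = mat 1" by auto
  show "det (G c p) \<noteq> 0" using i invertible_det_nz by blast
qed

text \<open>Raising the index: with \<open>G y = w\<close> the inverse matrix disappears, which is how positivity and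
independence of the chart are obtained.\<close>

lemma conorm_sq_eq:
  assumes "c \<in> A" "p \<in> chart_dom c" "G c p *v y = w"
  shows "conorm_sq c p w = w \<bullet> y"
  unfolding conorm_sq_def assms(3)[symmetric]
  by (simp add: matrix_vector_mul_assoc metric_invertible[OF assms(1,2)])

lemma metric_solve:
  assumes "c \<in> A" "p \<in> chart_dom c"
  obtains y where "G c p *v y = w"
  using that[of "matrix_inv (G c p) *v w"]
  by (simp add: matrix_vector_mul_assoc metric_invertible[OF assms])

lemma conorm_sq_nonneg:
  assumes "c \<in> A" "p \<in> chart_dom c" shows "0 \<le> conorm_sq c p w"
proof -
  obtain y where y: "G c p *v y = w" using metric_solve[OF assms] .
  show ?thesis
    unfolding conorm_sq_eq[OF assms y]
    using metric_pos[OF assms, of y] y by (cases "y = 0") (auto simp: inner_commute)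
qed

lemma conorm_sq_scale: "conorm_sq c p (r *\<^sub>R w) = r\<^sup>2 * conorm_sq c p w"
  by (simp add: conorm_sq_def matrix_vector_mult_scaleR power2_eq_square)

text \<open>The parallelogram identity; it avoids the Cauchy-Schwarz inequality for the metric.\<close>

lemma conorm_sq_lincomb_le:
  assumes "c \<in> A" "p \<in> chart_dom c"
  shows "conorm_sq c p (a *\<^sub>R v + b *\<^sub>R w) \<le> 2 * a\<^sup>2 * conorm_sq c p v + 2 * b\<^sup>2 * conorm_sq c p w"
proof -
  have "conorm_sq c p (x + y) + conorm_sq c p (x - y) = 2 * conorm_sq c p x + 2 * conorm_sq c p y" for x y
    by (simp add: conorm_sq_def matrix_vector_right_distrib matrix_vector_mult_diff_distrib inner_add_left inner_add_right
        inner_diff_left inner_diff_right)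
  from this[of "a *\<^sub>R v" "b *\<^sub>R w"] conorm_sq_nonneg[OF assms, of "a *\<^sub>R v - b *\<^sub>R w"]
  show ?thesis by (simp add: conorm_sq_scale)
qed

text \<open>If \<open>y\<close> is the vector dual to the covector in the chart \<open>c\<close>, then \<open>J y\<close> is the dual vector in the chart
\<open>d\<close>. The matrix \<open>J\<^sup>T\<close> can be cancelled because \<open>J\<^sup>T G\<^sub>d J\<close> is invertible.\<close>

lemma conorm_sq_independent:
  assumes \<omega>: "covector_field_on A D \<omega>" and "c \<in> A" "d \<in> A" and p: "p \<in> chart_dom c" "p \<in> chart_dom d" "p \<in> D"
  shows "conorm_sq c p (\<omega> c p) = conorm_sq d p (\<omega> d p)"
proof -
  let ?J = "transition_jacobian c d p"
  let ?T = "Finite_Cartesian_Product.transpose ?J"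
  have \<omega>c: "\<omega> c p = ?T *v \<omega> d p"
    using \<omega>[unfolded covector_field_on_def] assms(2,3) p by blast
  have Gc: "G c p = ?T ** G d p ** ?J" by (rule metric_change) (use assms in auto)
  obtain y where y: "G c p *v y = \<omega> c p" using metric_solve[OF \<open>c \<in> A\<close> p(1)] .
  have "det ?T \<noteq> 0"
    using metric_invertible(3)[OF \<open>c \<in> A\<close> p(1)] unfolding Gc by (auto simp: det_mul)
  then have "\<exists>B. B ** ?T = mat 1" by (metis invertible_det_nz invertible_left_inverse)
  then have inj: "inj ((*v) ?T)" by (simp only: matrix_left_invertible_injective)
  have "?T *v (G d p *v (?J *v y)) = ?T *v \<omega> d p"
    using y unfolding \<omega>c Gc by (simp add: matrix_vector_mul_assoc matrix_mul_assoc)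
  then have "G d p *v (?J *v y) = \<omega> d p" using inj by (simp add: inj_def)
  then have "conorm_sq d p (\<omega> d p) = \<omega> d p \<bullet> (?J *v y)" by (rule conorm_sq_eq[OF \<open>d \<in> A\<close> p(2)])
  also have "\<dots> = \<omega> c p \<bullet> y" unfolding \<omega>c by (simp add: dot_lmul_matrix)
  also have "\<dots> = conorm_sq c p (\<omega> c p)" by (rule conorm_sq_eq[OF \<open>c \<in> A\<close> p(1) y, symmetric])
  finally show ?thesis ..
qed

text \<open>The chart selected at \<open>p\<close> depends on \<open>p\<close> alone, hence pointwise estimates for several covector fields can
be made in one chart.\<close>

lemma sq_local: "\<exists>c\<in>A. p \<in> chart_dom c \<and> (\<forall>\<omega>. sq \<omega> p = conorm_sq c p (\<omega> c p))"
proof -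
  have "\<exists>c. c \<in> A \<and> p \<in> chart_dom c" using chart_cover by blast
  then have "(SOME c. c \<in> A \<and> p \<in> chart_dom c) \<in> A \<and> p \<in> chart_dom (SOME c. c \<in> A \<and> p \<in> chart_dom c)"
    by (rule someI_ex)
  then show ?thesis by (auto simp: covector_sqnorm_def conorm_sq_def Let_def)
qed

lemma sq_eq:
  assumes "covector_field_on A D \<omega>" "c \<in> A" "p \<in> chart_dom c" "p \<in> D"
  shows "sq \<omega> p = conorm_sq c p (\<omega> c p)"
  using sq_local[of p] conorm_sq_independent[OF assms(1) _ assms(2)] assms by metis

lemma sq_nonneg: "0 \<le> sq \<omega> p"
  using sq_local[of p] conorm_sq_nonneg by metis

lemma sq_scale: "sq (\<lambda>c p. f p *\<^sub>R \<omega> c p) p = (f p)\<^sup>2 * sq \<omega> p"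
  using sq_local[of p] conorm_sq_scale by metis

lemma sq_lincomb_le: "sq (\<lambda>c p. a *\<^sub>R \<omega> c p + b *\<^sub>R \<eta> c p) p \<le> 2 * a\<^sup>2 * sq \<omega> p + 2 * b\<^sup>2 * sq \<eta> p"
proof -
  obtain c where c: "c \<in> A" "p \<in> chart_dom c" "\<forall>\<omega>. sq \<omega> p = conorm_sq c p (\<omega> c p)" using sq_local by blast
  show ?thesis using conorm_sq_lincomb_le[OF c(1,2)] by (simp add: c(3))
qed

end

section \<open>Weak differentials and the Sobolev space\<close>

locale riemannian_open = riemannian A G
  for A :: "('m::{t2_space, second_countable_topology}, 'n::finite) chart set" and G +
  fixes D :: "'m set"
  assumes open_D: "open D"
begin

abbreviation chart_region :: "('m, 'n) chart \<Rightarrow> (real ^ 'n) set" where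
  "chart_region c \<equiv> chart_map c ` (chart_dom c \<inter> D)"

abbreviation wd where "wd \<equiv> weak_differential A D"

lemma open_chart_region: "c \<in> A \<Longrightarrow> open (chart_region c)"
  using open_chart_image_Int open_D by blast

lemma wdI:
  assumes "covector_field_on A D \<omega>"
    and "\<And>c. c \<in> A \<Longrightarrow> locally_integrable_on (chart_region c) (\<lambda>x. u (chart_inv c x))"
    and "\<And>c. c \<in> A \<Longrightarrow> locally_integrable_on (chart_region c) (\<lambda>x. \<omega> c (chart_inv c x))"
    and "\<And>c \<eta> i. c \<in> A \<Longrightarrow> test_function (chart_region c) \<eta> \<Longrightarrow>
      (LINT x:chart_region c|lborel. u (chart_inv c x) * frechet_derivative \<eta> (at x) (axis i 1)) =
           - (LINT x:chart_region c|lborel. \<omega> c (chart_inv c x) $ i * \<eta> x)"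
  shows "wd u \<omega>"
  using assms by (simp add: weak_differential_def Let_def o_def)

lemma wdD:
  assumes "wd u \<omega>"
  shows "covector_field_on A D \<omega>"
    and "\<And>c. c \<in> A \<Longrightarrow> locally_integrable_on (chart_region c) (\<lambda>x. u (chart_inv c x))"
    and "\<And>c. c \<in> A \<Longrightarrow> locally_integrable_on (chart_region c) (\<lambda>x. \<omega> c (chart_inv c x))"
    and "\<And>c \<eta> i. c \<in> A \<Longrightarrow> test_function (chart_region c) \<eta> \<Longrightarrow>
      (LINT x:chart_region c|lborel. u (chart_inv c x) * frechet_derivative \<eta> (at x) (axis i 1)) =
           - (LINT x:chart_region c|lborel. \<omega> c (chart_inv c x) $ i * \<eta> x)"
  using assms by (simp_all add: weak_differential_def Let_def o_def)

lemma wd_nth: "wd u \<omega> \<Longrightarrow> c \<in> A \<Longrightarrow> locally_integrable_on (chart_region c) (\<lambda>x. \<omega> c (chart_inv c x) $ i)"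
  by (rule locally_integrable_bounded_linear[OF bounded_linear_vec_nth wdD(3)])

lemma wd_cong:
  assumes "\<And>p. p \<in> D \<Longrightarrow> u p = v p"
  shows "wd u = wd v"
proof -
  have "wd v \<omega>" if u: "wd u \<omega>" and eq: "\<And>p. p \<in> D \<Longrightarrow> u p = v p" for u v \<omega>
  proof (rule wdI)
    fix c assume c: "c \<in> A"
    have uv: "u (chart_inv c x) = v (chart_inv c x)" if "x \<in> chart_region c" for x
      using that c eq by auto
    show "locally_integrable_on (chart_region c) (\<lambda>x. v (chart_inv c x))"
      using wdD(2)[OF u c]
        locally_integrable_cong[of "chart_region c" "\<lambda>x. u (chart_inv c x)" "\<lambda>x. v (chart_inv c x)", OF uv]
      by blast
    fix \<eta> i assume \<eta>: "test_function (chart_region c) \<eta>"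
    have "(LINT x:chart_region c|lborel. v (chart_inv c x) * frechet_derivative \<eta> (at x) (axis i 1))
        = (LINT x:chart_region c|lborel. u (chart_inv c x) * frechet_derivative \<eta> (at x) (axis i 1))"
      unfolding set_lebesgue_integral_def using uv
      by (intro Bochner_Integration.integral_cong) (auto simp: indicator_def)
    then show "(LINT x:chart_region c|lborel. v (chart_inv c x) * frechet_derivative \<eta> (at x) (axis i 1)) =
           - (LINT x:chart_region c|lborel. \<omega> c (chart_inv c x) $ i * \<eta> x)"
      using wdD(4)[OF u c \<eta>] by simp
  qed (use wdD[OF u] in auto)
  from this[of u _ v] this[of v _ u] assms show ?thesis by (auto simp: fun_eq_iff)
qed

lemma wd_lincomb:
  assumes u: "wd u \<omega>" and v: "wd v \<omega>'"
  shows "wd (\<lambda>p. a * u p + b * v p) (\<lambda>c p. a *\<^sub>R \<omega> c p + b *\<^sub>R \<omega>' c p)"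
proof (rule wdI)
  show "covector_field_on A D (\<lambda>c p. a *\<^sub>R \<omega> c p + b *\<^sub>R \<omega>' c p)"
    unfolding covector_field_on_def
  proof (intro ballI)
    fix c d p assume cdp: "c \<in> A" "d \<in> A" "p \<in> chart_dom c \<inter> chart_dom d \<inter> D"
    let ?T = "Finite_Cartesian_Product.transpose (transition_jacobian c d p)"
    have "\<omega> c p = ?T *v \<omega> d p" "\<omega>' c p = ?T *v \<omega>' d p"
      using wdD(1)[OF u] wdD(1)[OF v] cdp unfolding covector_field_on_def by blast+
    then show "a *\<^sub>R \<omega> c p + b *\<^sub>R \<omega>' c p = ?T *v (a *\<^sub>R \<omega> d p + b *\<^sub>R \<omega>' d p)"
      by (simp only: matrix_vector_right_distrib matrix_vector_mult_scaleR)
  qed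
  fix c assume c: "c \<in> A"
  show "locally_integrable_on (chart_region c) (\<lambda>x. a * u (chart_inv c x) + b * v (chart_inv c x))"
    using locally_integrable_lincomb[OF wdD(2)[OF u c] wdD(2)[OF v c], of a b] by simp
  show "locally_integrable_on (chart_region c) (\<lambda>x. a *\<^sub>R \<omega> c (chart_inv c x) + b *\<^sub>R \<omega>' c (chart_inv c x))"
    by (rule locally_integrable_lincomb[OF wdD(3)[OF u c] wdD(3)[OF v c]])
  fix \<eta> i assume \<eta>: "test_function (chart_region c) \<eta>"
  have lin: "(LINT x:V|lborel. (a * f x + b * g x) * h x) = a * (LINT x:V|lborel. f x * h x) + b * (LINT x:V|lborel. g x * h x)"
    if "set_integrable lborel V (\<lambda>x. f x * h x)" "set_integrable lborel V (\<lambda>x. g x * h x)"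
    for f g h :: "real ^ 'n \<Rightarrow> real" and V
  proof -
    have "(LINT x:V|lborel. (a * f x + b * g x) * h x) = (LINT x:V|lborel. a * (f x * h x) + b * (g x * h x))"
      by (simp add: algebra_simps)
    also have "\<dots> = (LINT x:V|lborel. a * (f x * h x)) + (LINT x:V|lborel. b * (g x * h x))"
      using that by (intro set_integral_add set_integrable_mult_right) auto
    finally show ?thesis by simp
  qed
  show "(LINT x:chart_region c|lborel. (a * u (chart_inv c x) + b * v (chart_inv c x)) * frechet_derivative \<eta> (at x) (axis i 1)) =
      - (LINT x:chart_region c|lborel. (a *\<^sub>R \<omega> c (chart_inv c x) + b *\<^sub>R \<omega>' c (chart_inv c x)) $ i * \<eta> x)"
    using lin[OF test_function_integrable(2)[OF wdD(2)[OF u c] \<eta>] test_function_integrable(2)[OF wdD(2)[OF v c] \<eta>]]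
      lin[OF test_function_integrable(1)[OF wd_nth[OF u c] \<eta>] test_function_integrable(1)[OF wd_nth[OF v c] \<eta>]]
      wdD(4)[OF u c \<eta>] wdD(4)[OF v c \<eta>]
    by simp
qed

lemma wd_unique_chart:
  assumes u: "wd u \<omega>" "wd u \<omega>'" and c: "c \<in> A"
  shows "AE p in vol. p \<in> chart_dom c \<inter> D \<longrightarrow> \<omega> c p = \<omega>' c p"
proof (rule AE_vol_chart[OF c])
  have "AE x in lborel. x \<in> chart_region c \<longrightarrow> \<omega> c (chart_inv c x) $ i - \<omega>' c (chart_inv c x) $ i = 0" for i
  proof (rule fundamental_lemma_variations[OF open_chart_region[OF c]])
    show "locally_integrable_on (chart_region c) (\<lambda>x. \<omega> c (chart_inv c x) $ i - \<omega>' c (chart_inv c x) $ i)"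
      using locally_integrable_lincomb[OF wd_nth[OF u(1) c] wd_nth[OF u(2) c], of 1 _ "-1"] by simp
    fix \<eta> assume \<eta>: "test_function (chart_region c) \<eta>"
    have "(LINT x:chart_region c|lborel. (\<omega> c (chart_inv c x) $ i - \<omega>' c (chart_inv c x) $ i) * \<eta> x)
       = (LINT x:chart_region c|lborel. \<omega> c (chart_inv c x) $ i * \<eta> x - \<omega>' c (chart_inv c x) $ i * \<eta> x)"
      by (simp add: algebra_simps)
    also have "\<dots> = (LINT x:chart_region c|lborel. \<omega> c (chart_inv c x) $ i * \<eta> x)
        - (LINT x:chart_region c|lborel. \<omega>' c (chart_inv c x) $ i * \<eta> x)"
      by (intro set_integral_diff test_function_integrable(1)[OF _ \<eta>] wd_nth[OF u(1) c] wd_nth[OF u(2) c])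
    also have "\<dots> = 0"
      using wdD(4)[OF u(1) c \<eta>, of i] wdD(4)[OF u(2) c \<eta>, of i] by simp
    finally show "(LINT x:chart_region c|lborel. (\<omega> c (chart_inv c x) $ i - \<omega>' c (chart_inv c x) $ i) * \<eta> x) = 0" .
  qed
  then have "AE x in lborel. \<forall>i\<in>UNIV. x \<in> chart_region c \<longrightarrow> \<omega> c (chart_inv c x) $ i - \<omega>' c (chart_inv c x) $ i = 0"
    by (intro AE_finite_allI) auto
  then show "AE x in lborel. x \<in> chart_region c \<longrightarrow> \<omega> c (chart_inv c x) = \<omega>' c (chart_inv c x)"
    by eventually_elim (auto simp: vec_eq_iff)
qed

text \<open>Two covector fields that agree in one chart at \<open>p\<close> have the same norm there, so a countable family of
charts suffices.\<close>

lemma wd_unique_sq: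
  assumes u: "wd u \<omega>" "wd u \<omega>'"
  shows "AE p in vol. p \<in> D \<longrightarrow> sq \<omega> p = sq \<omega>' p"
proof -
  obtain C :: "nat \<Rightarrow> ('m, 'n) chart" where C: "range C \<subseteq> A" "(\<Union>k. chart_dom (C k)) = UNIV" by (rule countable_charts)
  have CA: "C k \<in> A" for k using C(1) by blast
  have "AE p in vol. \<forall>k. p \<in> chart_dom (C k) \<inter> D \<longrightarrow> \<omega> (C k) p = \<omega>' (C k) p"
    using wd_unique_chart[OF u CA] by (simp only: AE_all_countable) simp
  then show ?thesis
  proof eventually_elim
    case (elim p)
    obtain k where "p \<in> chart_dom (C k)" using C(2) by blast
    then show ?case
      using elim sq_eq[OF wdD(1)[OF u(1)] CA] sq_eq[OF wdD(1)[OF u(2)] CA] by auto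
  qed
qed

text \<open>The chart used at \<open>p\<close> in the definition of the norm is an arbitrary choice, so measurability is proved on
each member of a countable cover by charts, where the norm is an explicit expression. Cramer's rule
makes the inverse metric a rational function of the metric.\<close>

lemma sq_measurable:
  assumes u: "wd u \<omega>"
  shows "set_borel_measurable borel D (sq \<omega>)"
proof -
  obtain C :: "nat \<Rightarrow> ('m, 'n) chart" where C: "range C \<subseteq> A" "(\<Union>k. chart_dom (C k)) = UNIV" by (rule countable_charts)
  have CA: "C k \<in> A" for k using C(1) by blast
  let ?f = "\<lambda>p. indicator D p *\<^sub>R sq \<omega> p"
  have "?f \<in> borel_measurable borel"
  proof (rule measurable_piecewise_restrict[where C = "insert (- D) (range (\<lambda>k. chart_dom (C k) \<inter> D))"])
    show "space borel \<subseteq> \<Union>(insert (- D) (range (\<lambda>k. chart_dom (C k) \<inter> D)))"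
      using C(2) by auto
    fix \<Omega> assume \<Omega>: "\<Omega> \<in> insert (- D) (range (\<lambda>k. chart_dom (C k) \<inter> D))"
    have "closed \<Omega> \<or> open \<Omega>" using \<Omega> open_D open_chart_dom[OF CA] by auto
    then show "\<Omega> \<inter> space borel \<in> sets borel" by auto
    show "?f \<in> borel_measurable (restrict_space borel \<Omega>)"
    proof (cases "\<Omega> = - D")
      case True
      have "?f \<in> borel_measurable (restrict_space borel \<Omega>) \<longleftrightarrow> (\<lambda>p. 0 :: real) \<in> borel_measurable (restrict_space borel \<Omega>)"
        by (rule measurable_cong) (auto simp: True space_restrict_space)
      then show ?thesis by simp
    next
      case False
      then obtain k where k: "\<Omega> = chart_dom (C k) \<inter> D" using \<Omega> by blast
      define c where "c = C k"
      have c: "c \<in> A" using CA by (simp add: c_def)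
      let ?R = "restrict_space borel \<Omega>"
      have sp: "space ?R = chart_dom c \<inter> D" by (simp add: space_restrict_space k c_def)
      have "chart_map c \<in> measurable (restrict_space borel \<Omega>) borel"
        by (intro borel_measurable_continuous_on_restrict continuous_on_subset[OF continuous_on_chart_map[OF c]])
           (auto simp: k c_def)
      note m = measurable_compose[OF this]
      have "(\<lambda>p. indicator (chart_region c) (chart_map c p) *\<^sub>R \<omega> c (chart_inv c (chart_map c p))) \<in> borel_measurable ?R"
        by (rule m[OF locally_integrable_measurable[OF open_chart_region[OF c] wdD(3)[OF u c]]])
      then have "\<omega> c \<in> borel_measurable ?R"
        by (rule measurable_cong[THEN iffD1, rotated]) (use c in \<open>auto simp: sp\<close>)
      then have w: "(\<lambda>p. \<omega> c p $ i) \<in> borel_measurable ?R" for i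
        by (rule measurable_compose) (intro borel_measurable_continuous_onI continuous_intros)
      have g: "(\<lambda>p. G c p $ i $ j) \<in> borel_measurable ?R" for i j
      proof -
        have "continuous_on \<Omega> (\<lambda>p. G c (chart_inv c (chart_map c p)) $ i $ j)"
          by (rule continuous_on_compose2[OF continuous_on_metric[OF c] continuous_on_subset[OF continuous_on_chart_map[OF c]]])
             (auto simp: k c_def)
        from borel_measurable_continuous_on_restrict[OF this]
        show ?thesis by (rule measurable_cong[THEN iffD1, rotated]) (use c in \<open>auto simp: sp\<close>)
      qed
      have "(\<lambda>p. \<Sum>l\<in>UNIV. \<omega> c p $ l * (det (\<chi> i j. if j = l then \<omega> c p $ i else G c p $ i $ j) / det (G c p))) \<in> borel_measurable ?R"
      proof (intro borel_measurable_sum borel_measurable_times borel_measurable_divide borel_measurable_det w g)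
        fix l i j
        show "(\<lambda>p. (\<chi> i j. if j = l then \<omega> c p $ i else G c p $ i $ j) $ i $ j) \<in> borel_measurable ?R"
          using w g by (cases "j = l") auto
      qed
      moreover have "(\<Sum>l\<in>UNIV. \<omega> c p $ l * (det (\<chi> i j. if j = l then \<omega> c p $ i else G c p $ i $ j) / det (G c p))) = ?f p"
        if "p \<in> space ?R" for p
      proof -
        have p: "p \<in> chart_dom c" "p \<in> D" using that sp by auto
        have "G c p *v (matrix_inv (G c p) *v \<omega> c p) = \<omega> c p"
          by (simp add: matrix_vector_mul_assoc metric_invertible[OF c p(1)])
        then have "matrix_inv (G c p) *v \<omega> c p
            = (\<chi> l. det (\<chi> i j. if j = l then \<omega> c p $ i else G c p $ i $ j) / det (G c p))"
          using cramer[OF metric_invertible(3)[OF c p(1)]] by blast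
        then show ?thesis
          using p by (simp add: sq_eq[OF wdD(1)[OF u] c p] conorm_sq_def inner_vec_def)
      qed
      ultimately show ?thesis by (rule measurable_cong[THEN iffD1, rotated])
    qed
  qed auto
  then show ?thesis by (simp add: set_borel_measurable_def)
qed

text \<open>The choice of weak differential in the definition of the norm does not matter, by uniqueness.\<close>

lemma W12_norm_eq:
  assumes m: "set_borel_measurable borel D u" and u: "wd u \<omega>"
  shows "(W12_norm A G D u)\<^sup>2 = (LINT p:D|vol. (u p)\<^sup>2 + sq \<omega> p)"
proof -
  let ?\<omega> = "SOME \<omega>. wd u \<omega>"
  have u': "wd u ?\<omega>" by (rule someI[of "wd u", OF u])
  have m2: "(\<lambda>p. indicator D p *\<^sub>R ((u p)\<^sup>2 + sq \<xi> p)) \<in> borel_measurable vol" if "wd u \<xi>" for \<xi>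
  proof -
    have "(\<lambda>p. (indicator D p *\<^sub>R u p)\<^sup>2 + indicator D p *\<^sub>R sq \<xi> p) \<in> borel_measurable borel"
      using m sq_measurable[OF that] unfolding set_borel_measurable_def by measurable
    moreover have "(\<lambda>p. (indicator D p *\<^sub>R u p)\<^sup>2 + indicator D p *\<^sub>R sq \<xi> p) = (\<lambda>p. indicator D p *\<^sub>R ((u p)\<^sup>2 + sq \<xi> p))"
      by (auto simp: indicator_def fun_eq_iff)
    ultimately show ?thesis by simp
  qed
  have "(LINT p:D|vol. (u p)\<^sup>2 + sq ?\<omega> p) = (LINT p:D|vol. (u p)\<^sup>2 + sq \<omega> p)"
    unfolding set_lebesgue_integral_def
  proof (rule integral_cong_AE[OF m2[OF u'] m2[OF u]])
    show "AE p in vol. indicator D p *\<^sub>R ((u p)\<^sup>2 + sq ?\<omega> p) = indicator D p *\<^sub>R ((u p)\<^sup>2 + sq \<omega> p)"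
      using wd_unique_sq[OF u' u] by eventually_elim (auto simp: indicator_def)
  qed
  moreover have "0 \<le> (LINT p:D|vol. (u p)\<^sup>2 + sq ?\<omega> p)"
    unfolding set_lebesgue_integral_def
    by (intro integral_nonneg_AE AE_I2) (auto simp: indicator_def sq_nonneg)
  ultimately show ?thesis by (simp add: W12_norm_def)
qed

lemma W12_norm_nonneg: "0 \<le> W12_norm A G D u"
  unfolding W12_norm_def set_lebesgue_integral_def
  by (intro real_sqrt_ge_zero integral_nonneg_AE AE_I2) (auto simp: indicator_def sq_nonneg)

text \<open>Membership in \<open>W12\<close> provides some weak differential of finite energy; by uniqueness every other one,
in particular a classical differential, has finite energy as well.\<close>

lemma W12_sq_integrable:
  assumes "u \<in> W12 A G D" "wd u \<omega>" shows "set_integrable vol D (sq \<omega>)"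
proof -
  obtain \<omega>' where \<omega>': "wd u \<omega>'" "set_integrable vol D (sq \<omega>')" using assms(1) by (auto simp: W12_def)
  have "integrable vol (\<lambda>p. indicator D p *\<^sub>R sq \<omega>' p) \<longleftrightarrow> integrable vol (\<lambda>p. indicator D p *\<^sub>R sq \<omega> p)"
  proof (rule integrable_cong_AE)
    show "AE p in vol. indicator D p *\<^sub>R sq \<omega>' p = indicator D p *\<^sub>R sq \<omega> p"
      using wd_unique_sq[OF \<omega>'(1) assms(2)] by eventually_elim (auto simp: indicator_def)
  qed (use sq_measurable[OF \<omega>'(1)] sq_measurable[OF assms(2)] in \<open>simp_all add: set_borel_measurable_def\<close>)
  with \<omega>'(2) show ?thesis by (simp add: set_integrable_def)
qed

lemma W12I:
  assumes "set_borel_measurable borel D u" "wd u \<omega>" "set_integrable vol D (\<lambda>p. (u p)\<^sup>2)" "set_integrable vol D (sq \<omega>)"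
  shows "u \<in> W12 A G D"
  using assms by (auto simp: W12_def)

lemma set_integrable_bound_nonneg:
  fixes f g :: "'m \<Rightarrow> real"
  assumes "set_integrable vol D g" "set_borel_measurable borel D f" "\<And>p. p \<in> D \<Longrightarrow> \<bar>f p\<bar> \<le> g p"
  shows "set_integrable vol D f"
  unfolding set_integrable_def
proof (rule Bochner_Integration.integrable_bound[OF assms(1)[unfolded set_integrable_def]])
  show "(\<lambda>p. indicator D p *\<^sub>R f p) \<in> borel_measurable vol"
    using assms(2) by (simp add: set_borel_measurable_def)
  show "AE p in vol. norm (indicator D p *\<^sub>R f p) \<le> norm (indicator D p *\<^sub>R g p)"
    using assms(3) by (intro AE_I2) (auto simp: indicator_def intro: order_trans[OF _ abs_ge_self])
qed

lemma set_borel_measurable_lincomb: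
  fixes u v :: "'m \<Rightarrow> real"
  assumes "set_borel_measurable borel D u" "set_borel_measurable borel D v"
  shows "set_borel_measurable borel D (\<lambda>p. a * u p + b * v p)"
proof -
  have "(\<lambda>p. a * (indicator D p *\<^sub>R u p) + b * (indicator D p *\<^sub>R v p)) \<in> borel_measurable borel"
    using assms unfolding set_borel_measurable_def by measurable
  moreover have "(\<lambda>p. a * (indicator D p *\<^sub>R u p) + b * (indicator D p *\<^sub>R v p)) = (\<lambda>p. indicator D p *\<^sub>R (a * u p + b * v p))"
    by (auto simp: indicator_def fun_eq_iff)
  ultimately show ?thesis by (simp only: set_borel_measurable_def)
qed

lemma set_borel_measurable_square:
  fixes u :: "'m \<Rightarrow> real"
  assumes "set_borel_measurable borel D u"
  shows "set_borel_measurable borel D (\<lambda>p. (u p)\<^sup>2)"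
proof -
  have "(\<lambda>p. (indicator D p *\<^sub>R u p)\<^sup>2) \<in> borel_measurable borel"
    using assms unfolding set_borel_measurable_def by measurable
  moreover have "(\<lambda>p. (indicator D p *\<^sub>R u p)\<^sup>2) = (\<lambda>p. indicator D p *\<^sub>R (u p)\<^sup>2)"
    by (auto simp: indicator_def fun_eq_iff)
  ultimately show ?thesis by (simp only: set_borel_measurable_def)
qed

text \<open>The second part, with \<open>a = b = 1\<close>, serves in place of the triangle inequality.\<close>

lemma W12_lincomb:
  assumes u: "u \<in> W12 A G D" and v: "v \<in> W12 A G D"
  shows "(\<lambda>p. a * u p + b * v p) \<in> W12 A G D"
    and "(W12_norm A G D (\<lambda>p. a * u p + b * v p))\<^sup>2
      \<le> 2 * a\<^sup>2 * (W12_norm A G D u)\<^sup>2 + 2 * b\<^sup>2 * (W12_norm A G D v)\<^sup>2"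
proof -
  obtain \<omega> where \<omega>: "wd u \<omega>" "set_integrable vol D (sq \<omega>)" and um: "set_borel_measurable borel D u"
    and ui: "set_integrable vol D (\<lambda>p. (u p)\<^sup>2)" using u by (auto simp: W12_def)
  obtain \<xi> where \<xi>: "wd v \<xi>" "set_integrable vol D (sq \<xi>)" and vm: "set_borel_measurable borel D v"
    and vi: "set_integrable vol D (\<lambda>p. (v p)\<^sup>2)" using v by (auto simp: W12_def)
  let ?w = "\<lambda>p. a * u p + b * v p" and ?\<zeta> = "\<lambda>c p. a *\<^sub>R \<omega> c p + b *\<^sub>R \<xi> c p"
  have w: "wd ?w ?\<zeta>" by (rule wd_lincomb[OF \<omega>(1) \<xi>(1)])
  have wm: "set_borel_measurable borel D ?w" by (rule set_borel_measurable_lincomb[OF um vm])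
  have wi: "set_integrable vol D (\<lambda>p. (?w p)\<^sup>2)"
    by (rule set_integrable_bound_nonneg[of "\<lambda>p. 2 * a\<^sup>2 * (u p)\<^sup>2 + 2 * b\<^sup>2 * (v p)\<^sup>2"])
       (use ui vi square_sum_le in \<open>auto intro!: set_integral_add set_borel_measurable_square[OF wm]\<close>)
  have \<zeta>i: "set_integrable vol D (sq ?\<zeta>)"
    by (rule set_integrable_bound_nonneg[of "\<lambda>p. 2 * a\<^sup>2 * sq \<omega> p + 2 * b\<^sup>2 * sq \<xi> p"])
       (use \<omega>(2) \<xi>(2) sq_lincomb_le sq_nonneg in \<open>auto intro!: set_integral_add sq_measurable[OF w]\<close>)
  show "?w \<in> W12 A G D" by (rule W12I[OF wm w wi \<zeta>i])
  have "(W12_norm A G D ?w)\<^sup>2 = (LINT p:D|vol. (?w p)\<^sup>2 + sq ?\<zeta> p)" by (rule W12_norm_eq[OF wm w])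
  also have "\<dots> \<le> (LINT p:D|vol. 2 * a\<^sup>2 * ((u p)\<^sup>2 + sq \<omega> p) + 2 * b\<^sup>2 * ((v p)\<^sup>2 + sq \<xi> p))"
  proof (rule set_integral_mono)
    show "set_integrable vol D (\<lambda>p. (?w p)\<^sup>2 + sq ?\<zeta> p)" by (intro set_integral_add wi \<zeta>i)
    show "set_integrable vol D (\<lambda>p. 2 * a\<^sup>2 * ((u p)\<^sup>2 + sq \<omega> p) + 2 * b\<^sup>2 * ((v p)\<^sup>2 + sq \<xi> p))"
      by (intro set_integral_add set_integrable_mult_right ui vi \<omega>(2) \<xi>(2))
    show "(?w p)\<^sup>2 + sq ?\<zeta> p \<le> 2 * a\<^sup>2 * ((u p)\<^sup>2 + sq \<omega> p) + 2 * b\<^sup>2 * ((v p)\<^sup>2 + sq \<xi> p)" for p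
      using add_mono[OF square_sum_le[of a "u p" b "v p"] sq_lincomb_le[of a \<omega> b \<xi> p]]
      by (simp add: algebra_simps)
  qed
  also have "\<dots> = (LINT p:D|vol. 2 * a\<^sup>2 * ((u p)\<^sup>2 + sq \<omega> p)) + (LINT p:D|vol. 2 * b\<^sup>2 * ((v p)\<^sup>2 + sq \<xi> p))"
    by (intro set_integral_add set_integrable_mult_right ui vi \<omega>(2) \<xi>(2))
  also have "\<dots> = 2 * a\<^sup>2 * (W12_norm A G D u)\<^sup>2 + 2 * b\<^sup>2 * (W12_norm A G D v)\<^sup>2"
    by (simp add: W12_norm_eq[OF um \<omega>(1)] W12_norm_eq[OF vm \<xi>(1)])
  finally show "(W12_norm A G D ?w)\<^sup>2 \<le> 2 * a\<^sup>2 * (W12_norm A G D u)\<^sup>2 + 2 * b\<^sup>2 * (W12_norm A G D v)\<^sup>2" .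
qed

lemma W12_diff: "u \<in> W12 A G D \<Longrightarrow> v \<in> W12 A G D \<Longrightarrow> (\<lambda>p. u p - v p) \<in> W12 A G D"
  using W12_lincomb(1)[of u v 1 "-1"] by simp

lemma W12_closure_subset:
  assumes "\<And>s \<epsilon>. s \<in> S \<Longrightarrow> s \<in> W12 A G D \<Longrightarrow> 0 < \<epsilon> \<Longrightarrow> \<exists>t\<in>T \<inter> W12 A G D. W12_norm A G D (\<lambda>p. s p - t p) < \<epsilon>"
  shows "W12_closure A G D S \<subseteq> W12_closure A G D T"
proof
  fix u assume "u \<in> W12_closure A G D S"
  then have u: "u \<in> W12 A G D"
    and us: "\<And>\<epsilon>. \<epsilon> > 0 \<Longrightarrow> \<exists>s\<in>S \<inter> W12 A G D. W12_norm A G D (\<lambda>p. u p - s p) < \<epsilon>"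
    by (auto simp: W12_closure_def)
  have "\<exists>t\<in>T \<inter> W12 A G D. W12_norm A G D (\<lambda>p. u p - t p) < \<epsilon>" if "\<epsilon> > 0" for \<epsilon>
  proof -
    have e: "\<epsilon> / 2 > 0" using that by simp
    obtain s where s: "s \<in> S" "s \<in> W12 A G D" "W12_norm A G D (\<lambda>p. u p - s p) < \<epsilon> / 2" using us[OF e] by blast
    obtain t where t: "t \<in> T \<inter> W12 A G D" "W12_norm A G D (\<lambda>p. s p - t p) < \<epsilon> / 2"
      using assms[OF s(1,2) e] by blast
    have "(W12_norm A G D (\<lambda>p. 1 * (u p - s p) + 1 * (s p - t p)))\<^sup>2
       \<le> 2 * 1\<^sup>2 * (W12_norm A G D (\<lambda>p. u p - s p))\<^sup>2 + 2 * 1\<^sup>2 * (W12_norm A G D (\<lambda>p. s p - t p))\<^sup>2"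
      using t(1) by (intro W12_lincomb(2) W12_diff u s(2)) auto
    also have "\<dots> < 2 * (\<epsilon> / 2)\<^sup>2 + 2 * (\<epsilon> / 2)\<^sup>2"
      using power_strict_mono[OF s(3) W12_norm_nonneg, of 2] power_strict_mono[OF t(2) W12_norm_nonneg, of 2] by simp
    also have "\<dots> = \<epsilon>\<^sup>2" by (simp add: power2_eq_square)
    finally have "(W12_norm A G D (\<lambda>p. u p - t p))\<^sup>2 < \<epsilon>\<^sup>2" by simp
    then have "W12_norm A G D (\<lambda>p. u p - t p) < \<epsilon>" using that by (intro power2_less_imp_less[of _ \<epsilon>]) auto
    with t(1) show ?thesis by blast
  qed
  with u show "u \<in> W12_closure A G D T" by (auto simp: W12_closure_def)
qed

lemma W12_cong:
  assumes "\<And>p. p \<in> D \<Longrightarrow> u p = v p"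
  shows "u \<in> W12 A G D \<longleftrightarrow> v \<in> W12 A G D" and "W12_norm A G D u = W12_norm A G D v"
proof -
  have eq: "(\<lambda>p. indicator D p *\<^sub>R f (u p) p) = (\<lambda>p. indicator D p *\<^sub>R f (v p) p)" for f :: "real \<Rightarrow> 'm \<Rightarrow> real"
    using assms by (auto simp: indicator_def fun_eq_iff)
  note e = eq[of "\<lambda>x p. x"] eq[of "\<lambda>x p. x\<^sup>2"] eq[of "\<lambda>x p. x\<^sup>2 + sq (SOME \<omega>. wd v \<omega>) p"]
  show "u \<in> W12 A G D \<longleftrightarrow> v \<in> W12 A G D"
    unfolding W12_def set_borel_measurable_def set_integrable_def mem_Collect_eq e(1,2)
    by (simp only: wd_cong[of u v, OF assms])
  show "W12_norm A G D u = W12_norm A G D v"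
    unfolding W12_norm_def set_lebesgue_integral_def
    by (simp only: wd_cong[of u v, OF assms] e(3))
qed

end

section \<open>Classical differentials and truncation\<close>

context riemannian_open
begin

lemma smooth_fun_on_iff:
  "smooth_fun_on A D u \<longleftrightarrow> (\<forall>c\<in>A. \<forall>k. Ck_on k (chart_region c) (\<lambda>x. u (chart_inv c x)))"
  using open_chart_region by (simp add: smooth_fun_on_def smooth_on_iff_Ck_on o_def)

lemma smooth_fun_on_cong:
  assumes "smooth_fun_on A D u" "\<And>p. p \<in> D \<Longrightarrow> u p = v p"
  shows "smooth_fun_on A D v"
  unfolding smooth_fun_on_iff
proof (intro ballI allI)
  fix c k assume c: "c \<in> A"
  show "Ck_on k (chart_region c) (\<lambda>x. v (chart_inv c x))"
    by (rule Ck_on_cong[OF open_chart_region[OF c], of "\<lambda>x. u (chart_inv c x)"])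
       (use assms c in \<open>auto simp: smooth_fun_on_iff\<close>)
qed

lemma smooth_fun_on_lincomb:
  assumes "smooth_fun_on A D u" "smooth_fun_on A D v"
  shows "smooth_fun_on A D (\<lambda>p. a * u p + b * v p)"
  unfolding smooth_fun_on_iff
proof (intro ballI allI)
  fix c k assume c: "c \<in> A"
  have "Ck_on k (chart_region c) (\<lambda>x. u (chart_inv c x))" "Ck_on k (chart_region c) (\<lambda>x. v (chart_inv c x))"
    using assms c unfolding smooth_fun_on_iff by blast+
  then show "Ck_on k (chart_region c) (\<lambda>x. a * u (chart_inv c x) + b * v (chart_inv c x))"
    using open_chart_region[OF c] by (intro Ck_on_add Ck_on_mult[OF Ck_on_const]) auto
qed

lemma smooth_imp_continuous_on:
  assumes "smooth_fun_on A D u"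
  shows "continuous_on D u"
proof -
  have "continuous_on (\<Union>c\<in>A. chart_dom c \<inter> D) u"
  proof (rule continuous_on_open_UN)
    fix c assume c: "c \<in> A"
    show "open (chart_dom c \<inter> D)" using open_chart_dom[OF c] open_D by blast
    have "continuous_on (chart_region c) (\<lambda>x. u (chart_inv c x))"
      using assms c unfolding smooth_fun_on_iff by (metis Ck_on.simps(1))
    then have "continuous_on (chart_dom c \<inter> D) (\<lambda>p. u (chart_inv c (chart_map c p)))"
      by (rule continuous_on_compose2[OF _ continuous_on_subset[OF continuous_on_chart_map[OF c]]]) auto
    then show "continuous_on (chart_dom c \<inter> D) u"
      by (rule continuous_on_eq) (use c in auto)
  qed
  moreover have "(\<Union>c\<in>A. chart_dom c \<inter> D) = D" using chart_cover by blast
  ultimately show ?thesis by simp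
qed

definition differential :: "('m \<Rightarrow> real) \<Rightarrow> ('m, 'n) chart \<Rightarrow> 'm \<Rightarrow> real ^ 'n" where
  "differential u c p = (\<chi> i. frechet_derivative (\<lambda>x. u (chart_inv c x)) (at (chart_map c p)) (axis i 1))"

lemma smooth_has_derivative:
  assumes u: "smooth_fun_on A D u" and c: "c \<in> A" and p: "p \<in> chart_dom c" "p \<in> D"
  shows "((\<lambda>x. u (chart_inv c x)) has_derivative (\<lambda>v. v \<bullet> differential u c p)) (at (chart_map c p))"
proof -
  have "Ck_on 1 (chart_region c) (\<lambda>x. u (chart_inv c x))"
    using u c unfolding smooth_fun_on_iff by blast
  then have "(\<lambda>x. u (chart_inv c x)) differentiable (at (chart_map c p))" using p by simp
  then have D: "((\<lambda>x. u (chart_inv c x)) has_derivative frechet_derivative (\<lambda>x. u (chart_inv c x)) (at (chart_map c p))) (at (chart_map c p))"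
    by (simp only: frechet_derivative_works)
  show ?thesis
    unfolding differential_def
    by (rule has_derivative_eq_rhs[OF D]) (intro ext linear_functional_eq_inner has_derivative_linear[OF D])
qed

lemma differential_unique:
  assumes "((\<lambda>x. u (chart_inv c x)) has_derivative (\<lambda>v. v \<bullet> w)) (at (chart_map c p))"
  shows "differential u c p = w"
  unfolding differential_def frechet_derivative_unique_at[OF assms] by (simp add: vec_eq_iff inner_axis')

text \<open>The chain rule for \<open>u\<close> in the chart \<open>d\<close> composed with the transition map from \<open>c\<close> to \<open>d\<close>.\<close>

lemma differential_covector_field:
  assumes u: "smooth_fun_on A D u"
  shows "covector_field_on A D (differential u)"
  unfolding covector_field_on_def
proof (intro ballI)
  fix c d p assume c: "c \<in> A" and d: "d \<in> A" and "p \<in> chart_dom c \<inter> chart_dom d \<inter> D"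
  then have p: "p \<in> chart_dom c" "p \<in> chart_dom d" "p \<in> D" by auto
  let ?J = "transition_jacobian c d p"
  let ?W = "chart_map c ` (chart_dom c \<inter> (chart_dom d \<inter> D))"
  have "((chart_map d \<circ> chart_inv c) has_derivative (\<lambda>v. ?J *v v)) (at (chart_map c p))"
    using c d p by (intro transition_has_derivative) auto
  moreover have "((\<lambda>x. u (chart_inv d x)) has_derivative (\<lambda>v. v \<bullet> differential u d p)) (at ((chart_map d \<circ> chart_inv c) (chart_map c p)))"
    using smooth_has_derivative[OF u d p(2,3)] c p by simp
  ultimately have "((\<lambda>x. u (chart_inv d ((chart_map d \<circ> chart_inv c) x))) has_derivative (\<lambda>v. (?J *v v) \<bullet> differential u d p)) (at (chart_map c p))"
    by (rule has_derivative_compose)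
  then have "((\<lambda>x. u (chart_inv c x)) has_derivative (\<lambda>v. (?J *v v) \<bullet> differential u d p)) (at (chart_map c p))"
  proof (rule has_derivative_transform_within_open)
    show "open ?W" using open_chart_image_Int[OF c] open_chart_dom[OF d] open_D by blast
    show "chart_map c p \<in> ?W" using p by blast
    show "u (chart_inv d ((chart_map d \<circ> chart_inv c) x)) = u (chart_inv c x)" if "x \<in> ?W" for x
      using that c d by auto
  qed
  moreover have "(?J *v v) \<bullet> differential u d p = v \<bullet> (Finite_Cartesian_Product.transpose ?J *v differential u d p)" for v
    by (simp only: transpose_matrix_vector inner_commute[of v] dot_lmul_matrix) (rule inner_commute)
  ultimately show "differential u c p = Finite_Cartesian_Product.transpose ?J *v differential u d p"
    by (intro differential_unique) simp
qed

lemma wd_cong_covector: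
  assumes "wd u \<omega>" and eq: "\<And>c p. c \<in> A \<Longrightarrow> p \<in> chart_dom c \<Longrightarrow> p \<in> D \<Longrightarrow> \<omega> c p = \<omega>' c p"
  shows "wd u \<omega>'"
proof (rule wdI)
  note u = wdD[OF assms(1)]
  show "covector_field_on A D \<omega>'"
    unfolding covector_field_on_def
  proof (intro ballI)
    fix c d p assume "c \<in> A" "d \<in> A" "p \<in> chart_dom c \<inter> chart_dom d \<inter> D"
    then show "\<omega>' c p = Finite_Cartesian_Product.transpose (transition_jacobian c d p) *v \<omega>' d p"
      using u(1)[unfolded covector_field_on_def] eq[of c p] eq[of d p] by (metis IntE)
  qed
  fix c assume c: "c \<in> A"
  show "locally_integrable_on (chart_region c) (\<lambda>x. u (chart_inv c x))" by (rule u(2)[OF c])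
  have e: "\<omega> c (chart_inv c x) = \<omega>' c (chart_inv c x)" if x: "x \<in> chart_region c" for x
  proof -
    obtain p where "p \<in> chart_dom c" "p \<in> D" "x = chart_map c p" using x by blast
    then show ?thesis using c eq by simp
  qed
  show "locally_integrable_on (chart_region c) (\<lambda>x. \<omega>' c (chart_inv c x))"
    using u(3)[OF c] locally_integrable_cong[of "chart_region c" "\<lambda>x. \<omega> c (chart_inv c x)" "\<lambda>x. \<omega>' c (chart_inv c x)", OF e]
    by blast
  fix \<eta> i assume \<eta>: "test_function (chart_region c) \<eta>"
  have "(LINT x:chart_region c|lborel. \<omega>' c (chart_inv c x) $ i * \<eta> x) = (LINT x:chart_region c|lborel. \<omega> c (chart_inv c x) $ i * \<eta> x)"
    unfolding set_lebesgue_integral_def using e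
    by (intro Bochner_Integration.integral_cong) (auto simp: indicator_def)
  then show "(LINT x:chart_region c|lborel. u (chart_inv c x) * frechet_derivative \<eta> (at x) (axis i 1)) =
           - (LINT x:chart_region c|lborel. \<omega>' c (chart_inv c x) $ i * \<eta> x)"
    using u(4)[OF c \<eta>, of i] by simp
qed

lemma continuous_on_differential:
  assumes u: "smooth_fun_on A D u" and c: "c \<in> A"
  shows "continuous_on (chart_region c) (\<lambda>x. differential u c (chart_inv c x))"
proof -
  have "Ck_on 1 (chart_region c) (\<lambda>x. u (chart_inv c x))"
    using u c unfolding smooth_fun_on_iff by blast
  then have "continuous_on (chart_region c) (\<lambda>x. frechet_derivative (\<lambda>x. u (chart_inv c x)) (at x) v)" for v by simp
  then have "continuous_on (chart_region c) (\<lambda>x. \<chi> i. frechet_derivative (\<lambda>x. u (chart_inv c x)) (at x) (axis i 1))"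
    by (intro continuous_on_vec_lambda)
  then show ?thesis by (rule continuous_on_eq) (use c in \<open>auto simp: differential_def\<close>)
qed

lemma wd_differential:
  assumes u: "smooth_fun_on A D u"
  shows "wd u (differential u)"
proof (rule wdI)
  show "covector_field_on A D (differential u)" by (rule differential_covector_field[OF u])
  fix c assume c: "c \<in> A"
  have C: "Ck_on k (chart_region c) (\<lambda>x. u (chart_inv c x))" for k
    using u c unfolding smooth_fun_on_iff by blast
  show "locally_integrable_on (chart_region c) (\<lambda>x. u (chart_inv c x))"
    using C[of 0] by (intro continuous_imp_locally_integrable) simp
  show "locally_integrable_on (chart_region c) (\<lambda>x. differential u c (chart_inv c x))"
    by (intro continuous_imp_locally_integrable continuous_on_differential[OF u c])
  fix \<eta> i assume \<eta>: "test_function (chart_region c) \<eta>"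
  have "(LINT x:chart_region c|lborel. differential u c (chart_inv c x) $ i * \<eta> x)
      = (LINT x:chart_region c|lborel. frechet_derivative (\<lambda>x. u (chart_inv c x)) (at x) (axis i 1) * \<eta> x)"
    unfolding set_lebesgue_integral_def
    by (intro Bochner_Integration.integral_cong) (use c in \<open>auto simp: indicator_def differential_def\<close>)
  then show "(LINT x:chart_region c|lborel. u (chart_inv c x) * frechet_derivative \<eta> (at x) (axis i 1)) =
           - (LINT x:chart_region c|lborel. differential u c (chart_inv c x) $ i * \<eta> x)"
    using integration_by_parts[OF open_chart_region[OF c] C \<eta>] by simp
qed

lemma smooth_trunc:
  assumes u: "smooth_fun_on A D u" shows "smooth_fun_on A D (\<lambda>p. trunc k (u p))"
  unfolding smooth_fun_on_iff
proof (intro ballI allI)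
  fix c m assume c: "c \<in> A"
  show "Ck_on m (chart_region c) (\<lambda>x. trunc k (u (chart_inv c x)))"
    using u c unfolding smooth_fun_on_iff by (intro Ck_on_compose_real[OF Ck_on_trunc _ open_chart_region[OF c]]) blast
qed

lemma differential_trunc:
  assumes u: "smooth_fun_on A D u" and c: "c \<in> A" and p: "p \<in> chart_dom c" "p \<in> D"
  shows "differential (\<lambda>p. trunc k (u p)) c p = trunc' k (u p) *\<^sub>R differential u c p"
proof (rule differential_unique)
  have "(trunc k has_derivative (\<lambda>v. trunc' k (u p) * v)) (at (u (chart_inv c (chart_map c p))))"
    using trunc_has_derivative[of k "u p"] c p by (simp add: has_field_derivative_def)
  from has_derivative_compose[OF smooth_has_derivative[OF u c p] this]
  show "((\<lambda>x. trunc k (u (chart_inv c x))) has_derivative (\<lambda>v. v \<bullet> (trunc' k (u p) *\<^sub>R differential u c p))) (at (chart_map c p))"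
    by simp
qed

text \<open>Setting the differential to zero on the zero set of \<open>u\<close> makes \<open>(1 - \<theta>\<^sub>k'(u)) du\<close> tend to zero at every point;
with the differential itself the limit at a zero of \<open>u\<close> would be \<open>du\<close>.\<close>

definition differential_off_zeros :: "('m \<Rightarrow> real) \<Rightarrow> ('m, 'n) chart \<Rightarrow> 'm \<Rightarrow> real ^ 'n" where
  "differential_off_zeros u c p = (if u p = 0 then 0 else differential u c p)"

text \<open>The derivative of the truncation vanishes at \<open>0\<close>, so altering \<open>du\<close> on the zero set of \<open>u\<close> has no
effect here.\<close>

lemma wd_trunc:
  assumes u: "smooth_fun_on A D u"
  shows "wd (\<lambda>p. trunc k (u p)) (\<lambda>c p. trunc' k (u p) *\<^sub>R differential_off_zeros u c p)"
  by (rule wd_cong_covector[OF wd_differential[OF smooth_trunc[OF u]]])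
     (simp add: differential_trunc[OF u] differential_off_zeros_def)

text \<open>The weak equation for \<open>\<theta>\<^sub>k(u)\<close> converges term by term, since \<open>\<theta>\<^sub>k(u) \<rightarrow> u\<close> while \<open>\<theta>\<^sub>k'(u)\<close> is bounded and tends
to the indicator of \<open>{u \<noteq> 0}\<close>. Together with uniqueness this says that \<open>du = 0\<close> almost everywhere on the
zero set of \<open>u\<close>.\<close>

lemma wd_differential_off_zeros:
  assumes u: "smooth_fun_on A D u"
  shows "wd u (differential_off_zeros u)"
proof (rule wdI)
  let ?\<omega> = "differential_off_zeros u"
  note du = wdD[OF wd_differential[OF u]]
  show "covector_field_on A D ?\<omega>"
    unfolding covector_field_on_def
  proof (intro ballI)
    fix c d p assume "c \<in> A" "d \<in> A" "p \<in> chart_dom c \<inter> chart_dom d \<inter> D"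
    then have "differential u c p = Finite_Cartesian_Product.transpose (transition_jacobian c d p) *v differential u d p"
      using du(1) unfolding covector_field_on_def by blast
    then show "?\<omega> c p = Finite_Cartesian_Product.transpose (transition_jacobian c d p) *v ?\<omega> d p"
      unfolding differential_off_zeros_def by (cases "u p = 0") (simp_all only: refl simp_thms if_True if_False matrix_vector_mult_0_right)
  qed
  fix c assume c: "c \<in> A"
  let ?V = "chart_region c"
  let ?u = "\<lambda>x. u (chart_inv c x)"
  have C: "Ck_on k ?V ?u" for k
    using u c unfolding smooth_fun_on_iff by blast
  show ul: "locally_integrable_on ?V ?u" by (rule du(2)[OF c])
  have "open (?V \<inter> ?u -` (- {0}))"
    using C[of 0] open_chart_region[OF c] by (intro continuous_open_preimage) auto
  then have O: "?V \<inter> ?u -` (- {0}) \<in> sets lborel" by simp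
  show \<omega>l: "locally_integrable_on ?V (\<lambda>x. ?\<omega> c (chart_inv c x))"
    unfolding locally_integrable_on_def
  proof (intro allI impI)
    fix K assume K: "compact K \<and> K \<subseteq> ?V"
    then have dK: "set_integrable lborel K (\<lambda>x. differential u c (chart_inv c x))"
      using du(3)[OF c] unfolding locally_integrable_on_def by blast
    have "K \<in> sets lborel" using K by (simp add: compact_imp_closed borel_closed)
    then have "set_integrable lborel (K \<inter> (?V \<inter> ?u -` (- {0}))) (\<lambda>x. differential u c (chart_inv c x))"
      by (rule set_integrable_subset[OF dK sets.Int[OF _ O]]) simp
    moreover have "indicator (K \<inter> (?V \<inter> ?u -` (- {0}))) x *\<^sub>R differential u c (chart_inv c x)
        = indicator K x *\<^sub>R ?\<omega> c (chart_inv c x)" for x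
      using K by (auto simp: indicator_def differential_off_zeros_def)
    ultimately show "set_integrable lborel K (\<lambda>x. ?\<omega> c (chart_inv c x))"
      by (simp only: set_integrable_def)
  qed
  fix \<eta> i assume \<eta>: "test_function ?V \<eta>"
  let ?d = "\<lambda>x. frechet_derivative \<eta> (at x) (axis i 1)"
  have nth: "locally_integrable_on ?V (\<lambda>x. \<xi> c (chart_inv c x) $ i)"
    if "locally_integrable_on ?V (\<lambda>x. \<xi> c (chart_inv c x))" for \<xi> :: "('m, 'n) chart \<Rightarrow> 'm \<Rightarrow> real ^ 'n"
    using that by (rule locally_integrable_bounded_linear[OF bounded_linear_vec_nth])
  have i1: "integrable lborel (\<lambda>x. indicator ?V x *\<^sub>R (?u x * ?d x))"
    using test_function_integrable(2)[OF ul \<eta>] by (simp only: set_integrable_def)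
  have i2: "integrable lborel (\<lambda>x. indicator ?V x *\<^sub>R (differential u c (chart_inv c x) $ i * \<eta> x))"
    using test_function_integrable(1)[OF nth[of "differential u"] \<eta>] du(3)[OF c] by (simp only: set_integrable_def)
  have i3: "integrable lborel (\<lambda>x. indicator ?V x *\<^sub>R (?\<omega> c (chart_inv c x) $ i * \<eta> x))"
    using test_function_integrable(1)[OF nth[of ?\<omega>] \<eta>] \<omega>l by (simp only: set_integrable_def)
  note t = wdD[OF wd_trunc[OF u]]
  have i4: "integrable lborel (\<lambda>x. indicator ?V x *\<^sub>R (trunc k (?u x) * ?d x))" for k
    using test_function_integrable(2)[OF t(2)[OF c] \<eta>] by (simp only: set_integrable_def)
  have i5: "integrable lborel (\<lambda>x. indicator ?V x *\<^sub>R ((trunc' k (?u x) *\<^sub>R ?\<omega> c (chart_inv c x)) $ i * \<eta> x))" for k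
    using test_function_integrable(1)[OF nth[of "\<lambda>c p. trunc' k (u p) *\<^sub>R ?\<omega> c p", OF t(3)[OF c]] \<eta>]
    by (simp only: set_integrable_def)
  have 1: "(\<lambda>k. LINT x:?V|lborel. trunc k (?u x) * ?d x) \<longlonglongrightarrow> (LINT x:?V|lborel. ?u x * ?d x)"
    unfolding set_lebesgue_integral_def
  proof (rule integral_dominated_convergence[OF _ _ integrable_norm[OF i1]])
    show "AE x in lborel. (\<lambda>k. indicator ?V x *\<^sub>R (trunc k (?u x) * ?d x)) \<longlonglongrightarrow> indicator ?V x *\<^sub>R (?u x * ?d x)"
      by (intro AE_I2 tendsto_intros trunc_tendsto)
    show "AE x in lborel. norm (indicator ?V x *\<^sub>R (trunc k (?u x) * ?d x)) \<le> norm (indicator ?V x *\<^sub>R (?u x * ?d x))" for k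
      by (intro AE_I2) (auto simp: abs_mult indicator_def intro!: mult_right_mono trunc_bound)
  qed (use i1 i4 in \<open>blast intro: borel_measurable_integrable\<close>)+
  have 2: "(\<lambda>k. LINT x:?V|lborel. (trunc' k (?u x) *\<^sub>R ?\<omega> c (chart_inv c x)) $ i * \<eta> x)
      \<longlonglongrightarrow> (LINT x:?V|lborel. ?\<omega> c (chart_inv c x) $ i * \<eta> x)"
    unfolding set_lebesgue_integral_def
  proof (rule integral_dominated_convergence[OF _ _ integrable_mult_right[OF integrable_norm[OF i3], of 7]])
    show "AE x in lborel. (\<lambda>k. indicator ?V x *\<^sub>R ((trunc' k (?u x) *\<^sub>R ?\<omega> c (chart_inv c x)) $ i * \<eta> x))
        \<longlonglongrightarrow> indicator ?V x *\<^sub>R (?\<omega> c (chart_inv c x) $ i * \<eta> x)"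
    proof (rule AE_I2)
      fix x
      have "(\<lambda>k. trunc' k (?u x) * (?\<omega> c (chart_inv c x) $ i)) \<longlonglongrightarrow> ?\<omega> c (chart_inv c x) $ i"
      proof (cases "?u x = 0")
        case True then show ?thesis by (simp add: differential_off_zeros_def)
      next
        case False
        from tendsto_mult_right[OF trunc'_tendsto[OF False]] show ?thesis by simp
      qed
      from tendsto_mult_left[OF tendsto_mult_right[OF this]]
      show "(\<lambda>k. indicator ?V x *\<^sub>R ((trunc' k (?u x) *\<^sub>R ?\<omega> c (chart_inv c x)) $ i * \<eta> x))
        \<longlonglongrightarrow> indicator ?V x *\<^sub>R (?\<omega> c (chart_inv c x) $ i * \<eta> x)" by simp
    qed
    show "AE x in lborel. norm (indicator ?V x *\<^sub>R ((trunc' k (?u x) *\<^sub>R ?\<omega> c (chart_inv c x)) $ i * \<eta> x))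
        \<le> 7 * norm (indicator ?V x *\<^sub>R (?\<omega> c (chart_inv c x) $ i * \<eta> x))" for k
    proof (rule AE_I2)
      fix x
      have "\<bar>trunc' k (?u x)\<bar> * \<bar>?\<omega> c (chart_inv c x) $ i * \<eta> x\<bar> \<le> 7 * \<bar>?\<omega> c (chart_inv c x) $ i * \<eta> x\<bar>"
        by (intro mult_right_mono trunc'_bound) simp
      then show "norm (indicator ?V x *\<^sub>R ((trunc' k (?u x) *\<^sub>R ?\<omega> c (chart_inv c x)) $ i * \<eta> x))
        \<le> 7 * norm (indicator ?V x *\<^sub>R (?\<omega> c (chart_inv c x) $ i * \<eta> x))"
        by (cases "x \<in> ?V") (simp_all add: abs_mult mult.assoc)
    qed
  qed (use i3 i5 in \<open>blast intro: borel_measurable_integrable\<close>)+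
  have "(\<lambda>k. LINT x:?V|lborel. trunc k (?u x) * ?d x) \<longlonglongrightarrow> - (LINT x:?V|lborel. ?\<omega> c (chart_inv c x) $ i * \<eta> x)"
    unfolding t(4)[OF c \<eta>] by (intro tendsto_minus 2)
  with 1 show "(LINT x:?V|lborel. ?u x * ?d x) = - (LINT x:?V|lborel. ?\<omega> c (chart_inv c x) $ i * \<eta> x)"
    by (rule LIMSEQ_unique)
qed

lemma set_borel_measurable_trunc:
  assumes "set_borel_measurable borel D u"
  shows "set_borel_measurable borel D (\<lambda>p. trunc k (u p))"
proof -
  have "trunc k \<in> borel_measurable borel"
    using Ck_on_trunc[of 0 k] by (intro borel_measurable_continuous_onI) simp
  from measurable_compose[OF assms[unfolded set_borel_measurable_def] this]
  have "(\<lambda>p. trunc k (indicator D p *\<^sub>R u p)) \<in> borel_measurable borel" .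
  moreover have "(\<lambda>p. trunc k (indicator D p *\<^sub>R u p)) = (\<lambda>p. indicator D p *\<^sub>R trunc k (u p))"
    by (auto simp: indicator_def fun_eq_iff trunc_eq_0)
  ultimately show ?thesis by (simp only: set_borel_measurable_def)
qed

lemma trunc_W12:
  assumes u: "smooth_fun_on A D u" "u \<in> W12 A G D"
  shows "(\<lambda>p. trunc k (u p)) \<in> W12 A G D"
proof (rule W12I[OF _ wd_trunc[OF u(1)]])
  have um: "set_borel_measurable borel D u" and ui: "set_integrable vol D (\<lambda>p. (u p)\<^sup>2)"
    using u(2) by (auto simp: W12_def)
  show tm: "set_borel_measurable borel D (\<lambda>p. trunc k (u p))" by (rule set_borel_measurable_trunc[OF um])
  show "set_integrable vol D (\<lambda>p. (trunc k (u p))\<^sup>2)"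
    by (rule set_integrable_bound_nonneg[OF ui set_borel_measurable_square[OF tm]])
       (use trunc_bound in \<open>simp add: abs_le_square_iff[symmetric]\<close>)
  have "set_integrable vol D (\<lambda>p. 7\<^sup>2 * sq (differential_off_zeros u) p)"
    by (intro set_integrable_mult_right impI W12_sq_integrable[OF u(2) wd_differential_off_zeros[OF u(1)]])
  then show "set_integrable vol D (sq (\<lambda>c p. trunc' k (u p) *\<^sub>R differential_off_zeros u c p))"
  proof (rule set_integrable_bound_nonneg[OF _ sq_measurable[OF wd_trunc[OF u(1)]]])
    fix p
    have "(trunc' k (u p))\<^sup>2 \<le> 7\<^sup>2" using trunc'_bound[of k "u p"] abs_le_square_iff[of "trunc' k (u p)" 7] by simp
    then show "\<bar>sq (\<lambda>c p. trunc' k (u p) *\<^sub>R differential_off_zeros u c p) p\<bar> \<le> 7\<^sup>2 * sq (differential_off_zeros u) p"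
      unfolding sq_scale using sq_nonneg by (simp add: abs_mult mult_right_mono)
  qed
qed

text \<open>The energy density of \<open>u - \<theta>\<^sub>k(u)\<close> is at most \<open>u\<^sup>2 + 64 \<bar>du\<bar>\<^sup>2\<close> and tends to zero at every point.\<close>

lemma trunc_W12_norm_tendsto:
  assumes u: "smooth_fun_on A D u" "u \<in> W12 A G D"
  shows "(\<lambda>k. (W12_norm A G D (\<lambda>p. u p - trunc k (u p)))\<^sup>2) \<longlonglongrightarrow> 0"
proof -
  let ?\<omega> = "differential_off_zeros u"
  have um: "set_borel_measurable borel D u" and ui: "set_integrable vol D (\<lambda>p. (u p)\<^sup>2)"
    using u(2) by (auto simp: W12_def)
  have \<omega>i: "set_integrable vol D (sq ?\<omega>)"
    by (rule W12_sq_integrable[OF u(2) wd_differential_off_zeros[OF u(1)]])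
  let ?f = "\<lambda>k p. (u p - trunc k (u p))\<^sup>2 + (1 - trunc' k (u p))\<^sup>2 * sq ?\<omega> p"
  have wd_diff: "wd (\<lambda>p. u p - trunc k (u p)) (\<lambda>c p. (1 - trunc' k (u p)) *\<^sub>R ?\<omega> c p)" for k
    using wd_lincomb[OF wd_differential_off_zeros[OF u(1)] wd_trunc[OF u(1), of k], of 1 "-1"]
    by (simp add: scaleR_left_diff_distrib)
  have dm: "set_borel_measurable borel D (\<lambda>p. u p - trunc k (u p))" for k
    using set_borel_measurable_lincomb[OF um set_borel_measurable_trunc[OF um, of k], of 1 "-1"] by simp
  have norm: "(W12_norm A G D (\<lambda>p. u p - trunc k (u p)))\<^sup>2 = (LINT p:D|vol. ?f k p)" for k
    using W12_norm_eq[OF dm wd_diff] by (simp only: sq_scale)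
  have "(\<lambda>k. LINT p:D|vol. ?f k p) \<longlonglongrightarrow> (LINT p:D|vol. 0)"
    unfolding set_lebesgue_integral_def
  proof (rule integral_dominated_convergence[where w="\<lambda>p. indicator D p *\<^sub>R ((u p)\<^sup>2 + 8\<^sup>2 * sq ?\<omega> p)"])
    show "integrable vol (\<lambda>p. indicator D p *\<^sub>R ((u p)\<^sup>2 + 8\<^sup>2 * sq ?\<omega> p))"
      using set_integral_add(1)[OF ui set_integrable_mult_right[of "8\<^sup>2", OF \<omega>i]] by (simp add: set_integrable_def)
    show "(\<lambda>p. indicator D p *\<^sub>R ?f k p) \<in> borel_measurable vol" for k
    proof -
      have "(\<lambda>p. indicator D p *\<^sub>R (u p - trunc k (u p))\<^sup>2 + indicator D p *\<^sub>R sq (\<lambda>c p. (1 - trunc' k (u p)) *\<^sub>R ?\<omega> c p) p) \<in> borel_measurable borel"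
        using set_borel_measurable_square[OF dm[of k]] sq_measurable[OF wd_diff[of k]]
        unfolding set_borel_measurable_def by (rule borel_measurable_add)
      then show ?thesis
        by (simp only: sq_scale scaleR_right_distrib measurable_cong_sets[OF sets_vol refl])
    qed
    show "AE p in vol. (\<lambda>k. indicator D p *\<^sub>R ?f k p) \<longlonglongrightarrow> indicator D p *\<^sub>R 0"
    proof (rule AE_I2)
      fix p
      have a: "(\<lambda>k. (u p - trunc k (u p))\<^sup>2) \<longlonglongrightarrow> (u p - u p)\<^sup>2" by (intro tendsto_intros trunc_tendsto)
      have b: "(\<lambda>k. (1 - trunc' k (u p))\<^sup>2 * sq ?\<omega> p) \<longlonglongrightarrow> 0"
      proof (cases "u p = 0")
        case True
        obtain c where "sq ?\<omega> p = conorm_sq c p (?\<omega> c p)" using sq_local by blast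
        then have "sq ?\<omega> p = 0" using True by (simp add: differential_off_zeros_def conorm_sq_def)
        then show ?thesis by simp
      next
        case False
        have "(\<lambda>k. (1 - trunc' k (u p))\<^sup>2 * sq ?\<omega> p) \<longlonglongrightarrow> (1 - 1)\<^sup>2 * sq ?\<omega> p"
          by (intro tendsto_intros trunc'_tendsto False)
        then show ?thesis by simp
      qed
      from tendsto_add[OF a b] show "(\<lambda>k. indicator D p *\<^sub>R ?f k p) \<longlonglongrightarrow> indicator D p *\<^sub>R 0"
        by (intro tendsto_scaleR tendsto_const) simp
    qed
    show "AE p in vol. norm (indicator D p *\<^sub>R ?f k p) \<le> indicator D p *\<^sub>R ((u p)\<^sup>2 + 8\<^sup>2 * sq ?\<omega> p)" for k
    proof (rule AE_I2)
      fix p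
      have "(u p - trunc k (u p))\<^sup>2 \<le> (u p)\<^sup>2"
        using trunc_diff_bound[of "u p" k] by (simp add: abs_le_square_iff[symmetric])
      moreover have "(1 - trunc' k (u p))\<^sup>2 * sq ?\<omega> p \<le> 8\<^sup>2 * sq ?\<omega> p"
        using trunc'_diff_bound[of k "u p"] abs_le_square_iff[of "1 - trunc' k (u p)" 8] by (intro mult_right_mono sq_nonneg) simp
      moreover have "0 \<le> ?f k p" using sq_nonneg by simp
      ultimately show "norm (indicator D p *\<^sub>R ?f k p) \<le> indicator D p *\<^sub>R ((u p)\<^sup>2 + 8\<^sup>2 * sq ?\<omega> p)"
        by (cases "p \<in> D") simp_all
    qed
  qed simp
  then show ?thesis by (simp add: norm set_lebesgue_integral_def)
qed

text \<open>A point of the closure where \<open>k \<bar>u\<bar> \<ge> 1\<close> cannot lie on the frontier, where \<open>u = 0\<close>.\<close>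

lemma trunc_support:
  assumes u: "u \<in> F0 A D"
  shows "closure {p \<in> D. trunc k (u p) \<noteq> 0} \<subseteq> D"
proof -
  let ?C = "closure D \<inter> u -` {t. 1 \<le> real k * \<bar>t\<bar>}"
  have "closed {t::real. 1 \<le> real k * \<bar>t\<bar>}"
    by (intro closed_Collect_le continuous_intros)
  then have "closed ?C"
    using u by (intro continuous_closed_preimage) (auto simp: F0_def)
  moreover have "{p \<in> D. trunc k (u p) \<noteq> 0} \<subseteq> ?C"
  proof
    fix p assume "p \<in> {p \<in> D. trunc k (u p) \<noteq> 0}"
    then have "p \<in> D" "\<not> real k * \<bar>u p\<bar> \<le> 1" using trunc_eq_0[of k "u p"] by auto
    then show "p \<in> ?C" using closure_subset[of D] by auto
  qed
  ultimately have "closure {p \<in> D. trunc k (u p) \<noteq> 0} \<subseteq> ?C" by (rule closure_minimal[rotated])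
  also have "?C \<subseteq> D"
  proof
    fix p assume p: "p \<in> ?C"
    then have "u p \<noteq> 0" by auto
    then have "p \<notin> frontier D" using u by (auto simp: F0_def)
    with p show "p \<in> D" using open_D by (auto simp: frontier_def interior_open)
  qed
  finally show ?thesis .
qed

section \<open>Comparison of the closures\<close>

text \<open>Members of \<open>Fc\<close> may take arbitrary values off \<open>D\<close>, but \<open>F0\<close> and \<open>F1\<close> constrain the values on the frontier.\<close>

definition zero_extension :: "('m \<Rightarrow> real) \<Rightarrow> 'm \<Rightarrow> real" where
  "zero_extension u p = (if p \<in> D then u p else 0)"

text \<open>The extension is smooth on \<open>D\<close> and identically zero on the complement of its support, and these two
open sets cover the manifold.\<close>

lemma zero_extension_F1:
  assumes u: "u \<in> Fc A D" shows "zero_extension u \<in> F1 A D"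
proof -
  let ?v = "zero_extension u" and ?S = "closure {p \<in> D. u p \<noteq> 0}"
  have S: "?S \<subseteq> D" and us: "smooth_fun_on A D u" using u by (auto simp: Fc_def)
  have v0: "?v p = 0" if "p \<notin> ?S" for p
  proof (rule ccontr)
    assume "?v p \<noteq> 0"
    then have "p \<in> {p \<in> D. u p \<noteq> 0}" by (simp add: zero_extension_def split: if_splits)
    then have "p \<in> ?S" by (rule subsetD[OF closure_subset])
    with that show False by contradiction
  qed
  have vs: "smooth_fun_on A D ?v"
    by (rule smooth_fun_on_cong[OF us]) (simp add: zero_extension_def)
  have cover: "D \<union> - ?S = UNIV" using S by blast
  have "continuous_on (D \<union> - ?S) ?v"
  proof (rule continuous_on_open_Un[OF open_D])
    show "continuous_on D ?v" by (rule smooth_imp_continuous_on[OF vs])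
    show "continuous_on (- ?S) ?v"
      by (rule continuous_on_eq[of _ "\<lambda>_. 0"]) (use v0 in auto)
  qed auto
  then have vc: "continuous_on (closure D) ?v" unfolding cover by (rule continuous_on_subset) simp
  have "C1_closure A D ?v"
    unfolding C1_closure_def
  proof (intro conjI vc ballI allI)
    fix c assume c: "c \<in> A"
    have C: "Ck_on 1 (chart_region c) (?v \<circ> chart_inv c)"
      using vs c unfolding smooth_fun_on_iff o_def by blast
    then show "(?v \<circ> chart_inv c) differentiable (at x)" if "x \<in> chart_region c" for x
      using that unfolding One_nat_def Ck_on.simps by blast
    fix i
    define h where "h x = (if x \<in> chart_region c then frechet_derivative (?v \<circ> chart_inv c) (at x) (axis i 1) else 0)" for x
    let ?T = "chart_map c ` (chart_dom c \<inter> - ?S)"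
    have T: "open ?T" using open_chart_image_Int[OF c] by blast
    have h0: "h x = 0" if x: "x \<in> ?T" for x
    proof -
      have "((?v \<circ> chart_inv c) has_derivative (\<lambda>_. 0)) (at x)"
      proof (rule has_derivative_transform_within_open[of "\<lambda>_. 0" _ x UNIV ?T])
        show "0 = (?v \<circ> chart_inv c) y" if y: "y \<in> ?T" for y
        proof -
          obtain q where "q \<in> chart_dom c" "q \<notin> ?S" "y = chart_map c q" using y by blast
          then show ?thesis using v0[of q] c by simp
        qed
      qed (use T x in auto)
      then show ?thesis by (simp add: h_def frechet_derivative_unique_at)
    qed
    have "continuous_on (chart_region c \<union> ?T) h"
    proof (rule continuous_on_open_Un[OF open_chart_region[OF c] T])
      have "continuous_on (chart_region c) (\<lambda>x. frechet_derivative (?v \<circ> chart_inv c) (at x) (axis i 1))"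
        using C by simp
      then show "continuous_on (chart_region c) h" by (rule continuous_on_eq) (simp add: h_def)
      show "continuous_on ?T h"
        by (rule continuous_on_eq[of _ "\<lambda>_. 0"]) (use h0 in auto)
    qed
    then have "continuous_on (chart_map c ` (chart_dom c \<inter> closure D)) h"
      by (rule continuous_on_subset) (use cover in blast)
    then show "\<exists>h. continuous_on (chart_map c ` (chart_dom c \<inter> closure D)) h \<and>
        (\<forall>x\<in>chart_region c. h x = frechet_derivative (?v \<circ> chart_inv c) (at x) (axis i 1))"
      by (intro exI[of _ h]) (simp add: h_def)
  qed
  moreover have "?v p = 0" if "p \<in> frontier D" for p
    using that open_D by (auto simp: zero_extension_def frontier_def interior_open)
  ultimately show ?thesis using vs by (simp add: F1_def)
qed

lemma F1_subset_F0: "F1 A D \<subseteq> F0 A D"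
  by (auto simp: F1_def F0_def C1_closure_def)

lemma zero_extension_norm:
  assumes "u \<in> W12 A G D"
  shows "zero_extension u \<in> W12 A G D" "W12_norm A G D (\<lambda>p. u p - zero_extension u p) = 0"
proof -
  show "zero_extension u \<in> W12 A G D"
    using assms by (subst W12_cong(1)[of "zero_extension u" u]) (auto simp: zero_extension_def)
  have "(W12_norm A G D (\<lambda>p. 0 * u p + 0 * u p))\<^sup>2 \<le> 0" using W12_lincomb(2)[OF assms assms, of 0 0] by simp
  moreover have "W12_norm A G D (\<lambda>p. 0 * u p + 0 * u p) = W12_norm A G D (\<lambda>p. u p - zero_extension u p)"
    by (rule W12_cong(2)) (simp add: zero_extension_def)
  ultimately show "W12_norm A G D (\<lambda>p. u p - zero_extension u p) = 0" by simp
qed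

lemma zero_integral_cong:
  assumes "\<And>p. p \<in> D \<Longrightarrow> u p = v p"
  shows "zero_integral A G D u \<longleftrightarrow> zero_integral A G D v"
proof -
  have "(\<lambda>p. indicator D p *\<^sub>R u p) = (\<lambda>p. indicator D p *\<^sub>R v p)"
    using assms by (auto simp: indicator_def fun_eq_iff)
  then show ?thesis by (simp only: zero_integral_def set_integrable_def set_lebesgue_integral_def)
qed

lemma small_norm_if_square_tendsto:
  assumes "(\<lambda>k. (W12_norm A G D (v k))\<^sup>2) \<longlonglongrightarrow> 0" "\<epsilon> > 0"
  obtains k where "W12_norm A G D (v k) < \<epsilon>"
proof -
  have "eventually (\<lambda>k. (W12_norm A G D (v k))\<^sup>2 < \<epsilon>\<^sup>2) sequentially"
    using assms by (intro order_tendstoD(2)[OF assms(1)]) simp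
  then obtain k where "(W12_norm A G D (v k))\<^sup>2 < \<epsilon>\<^sup>2" using eventually_happens'[OF sequentially_bot] by blast
  then show ?thesis using that assms(2) power2_less_imp_less[of "W12_norm A G D (v k)" \<epsilon>] by simp
qed

lemma closure_F0_subset_closure_Fc:
  "W12_closure A G D (F0 A D \<inter> W12 A G D) \<subseteq> W12_closure A G D (Fc A D)"
proof (rule W12_closure_subset)
  fix s and \<epsilon> :: real
  assume s: "s \<in> F0 A D \<inter> W12 A G D" and "0 < \<epsilon>"
  then have ss: "smooth_fun_on A D s" "s \<in> W12 A G D" by (auto simp: F0_def)
  obtain k where k: "W12_norm A G D (\<lambda>p. s p - trunc k (s p)) < \<epsilon>"
    using small_norm_if_square_tendsto[OF trunc_W12_norm_tendsto[OF ss] \<open>0 < \<epsilon>\<close>] by blast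
  have "(\<lambda>p. trunc k (s p)) \<in> Fc A D \<inter> W12 A G D"
    using smooth_trunc[OF ss(1)] trunc_W12[OF ss] trunc_support[of s k] s by (auto simp: Fc_def)
  then show "\<exists>t\<in>Fc A D \<inter> W12 A G D. W12_norm A G D (\<lambda>p. s p - t p) < \<epsilon>"
    by (intro bexI[of _ "\<lambda>p. trunc k (s p)"] k)
qed

lemma closure_Fc_subset_closure_F1:
  "W12_closure A G D (Fc A D) \<subseteq> W12_closure A G D (F1 A D)"
proof (rule W12_closure_subset)
  fix s and \<epsilon> :: real
  assume "s \<in> Fc A D" "s \<in> W12 A G D" "0 < \<epsilon>"
  then show "\<exists>t\<in>F1 A D \<inter> W12 A G D. W12_norm A G D (\<lambda>p. s p - t p) < \<epsilon>"
    using zero_extension_F1 zero_extension_norm by (intro bexI[of _ "zero_extension s"]) auto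
qed

lemma closure_F1_subset_closure_F0:
  "W12_closure A G D (F1 A D) \<subseteq> W12_closure A G D (F0 A D \<inter> W12 A G D)"
  using F1_subset_F0 by (fastforce simp: W12_closure_def)

lemma closure_Gc_subset_H:
  "W12_closure A G D (Gc A G D) \<subseteq> W12_closure A G D (G0 A G D \<inter> W12 A G D)"
proof (rule W12_closure_subset)
  fix s and \<epsilon> :: real
  assume s: "s \<in> Gc A G D" "s \<in> W12 A G D" "0 < \<epsilon>"
  then have "s \<in> Fc A D" by (auto simp: Gc_def Fc_def)
  then have "zero_extension s \<in> F0 A D" using zero_extension_F1 F1_subset_F0 by blast
  moreover have "zero_integral A G D (zero_extension s)"
    using s zero_integral_cong[of s "zero_extension s"] by (auto simp: Gc_def zero_extension_def)
  ultimately show "\<exists>t\<in>G0 A G D \<inter> W12 A G D \<inter> W12 A G D. W12_norm A G D (\<lambda>p. s p - t p) < \<epsilon>"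
    using zero_extension_norm[OF s(2)] s(3) by (intro bexI[of _ "zero_extension s"]) (auto simp: G0_def)
qed

text \<open>With \<open>I\<^sub>k\<close> the integral of \<open>\<theta>\<^sub>k(s)\<close>, the approximants are \<open>\<theta>\<^sub>k(s) - (I\<^sub>k / I\<^sub>m) \<theta>\<^sub>m(s)\<close>, where \<open>m\<close> is fixed with
\<open>I\<^sub>m \<noteq> 0\<close>. The correction tends to zero in norm because \<open>I\<^sub>k\<close> tends to the integral of \<open>s\<close>, which is zero.\<close>

lemma H_subset_closure_Gc:
  "W12_closure A G D (G0 A G D \<inter> W12 A G D) \<subseteq> W12_closure A G D (Gc A G D)"
proof (rule W12_closure_subset)
  fix s and \<epsilon> :: real
  assume s: "s \<in> G0 A G D \<inter> W12 A G D" and \<epsilon>: "0 < \<epsilon>"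
  then have ss: "smooth_fun_on A D s" "s \<in> W12 A G D" and s0: "s \<in> F0 A D"
    and si: "set_integrable vol D s" "(LINT p:D|vol. s p) = 0"
    by (auto simp: G0_def F0_def zero_integral_def)
  have sm: "set_borel_measurable borel D s" using ss(2) by (auto simp: W12_def)
  let ?s = "\<lambda>k p. trunc k (s p)"
  have tm: "set_borel_measurable borel D (?s k)" for k by (rule set_borel_measurable_trunc[OF sm])
  have ti: "set_integrable vol D (?s k)" for k
    by (rule set_integrable_bound_nonneg[OF set_integrable_abs[OF si(1)] tm]) (rule trunc_bound)
  define I where "I k = (LINT p:D|vol. ?s k p)" for k
  have "I \<longlonglongrightarrow> (LINT p:D|vol. s p)"
    unfolding I_def set_lebesgue_integral_def
  proof (rule integral_dominated_convergence[where w="\<lambda>p. norm (indicator D p *\<^sub>R s p)"])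
    show "integrable vol (\<lambda>p. norm (indicator D p *\<^sub>R s p))"
      using si(1) by (intro integrable_norm) (simp only: set_integrable_def)
    show "AE p in vol. (\<lambda>k. indicator D p *\<^sub>R ?s k p) \<longlonglongrightarrow> indicator D p *\<^sub>R s p"
      by (intro AE_I2 tendsto_intros trunc_tendsto)
    show "AE p in vol. norm (indicator D p *\<^sub>R ?s k p) \<le> norm (indicator D p *\<^sub>R s p)" for k
      by (intro AE_I2) (simp add: indicator_def trunc_bound)
  qed (use tm sm in \<open>simp_all add: set_borel_measurable_def\<close>)
  then have I0: "I \<longlonglongrightarrow> 0" using si(2) by simp
  \<comment> \<open>If all \<open>I k\<close> vanish no correction is wanted; the convention \<open>x / 0 = 0\<close> provides for this case.\<close>
  define m where "m = (if \<exists>k. I k \<noteq> 0 then SOME k. I k \<noteq> 0 else 0)"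
  have m: "I k = 0" if "I m = 0" for k
    using that someI_ex[of "\<lambda>k. I k \<noteq> 0"] by (auto simp: m_def split: if_splits)
  define g where "g k p = 1 * ?s k p + (- (I k / I m)) * ?s m p" for k p
  have gG: "g k \<in> Gc A G D \<inter> W12 A G D" for k
  proof -
    have "smooth_fun_on A D (g k)"
      unfolding g_def by (intro smooth_fun_on_lincomb smooth_trunc ss(1))
    moreover have "closure {p \<in> D. g k p \<noteq> 0} \<subseteq> D"
    proof -
      have "closure {p \<in> D. g k p \<noteq> 0} \<subseteq> closure ({p \<in> D. ?s k p \<noteq> 0} \<union> {p \<in> D. ?s m p \<noteq> 0})"
        by (intro closure_mono) (auto simp: g_def)
      also have "\<dots> \<subseteq> D" using trunc_support[OF s0] by (simp only: closure_Un Un_subset_iff)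
      finally show ?thesis .
    qed
    moreover have "zero_integral A G D (g k)"
    proof -
      have a: "set_integrable vol D (\<lambda>p. 1 * ?s k p)" "set_integrable vol D (\<lambda>p. - (I k / I m) * ?s m p)"
        by (intro set_integrable_mult_right impI ti)+
      have "(LINT p:D|vol. g k p) = I k - I k / I m * I m"
        unfolding g_def set_integral_add(2)[OF a] set_integral_mult_right by (simp add: I_def)
      also have "\<dots> = 0" using m[of k] by (cases "I m = 0") auto
      finally show ?thesis using set_integral_add(1)[OF a] by (simp add: zero_integral_def g_def[abs_def])
    qed
    moreover have "g k \<in> W12 A G D"
      unfolding g_def by (intro W12_lincomb(1) trunc_W12 ss)
    ultimately show ?thesis by (simp add: Gc_def)
  qed
  have "(\<lambda>k. (W12_norm A G D (\<lambda>p. s p - g k p))\<^sup>2) \<longlonglongrightarrow> 0"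
  proof (rule tendsto_sandwich[OF _ _ tendsto_const])
    show "eventually (\<lambda>k. (W12_norm A G D (\<lambda>p. s p - g k p))\<^sup>2
       \<le> 2 * 1\<^sup>2 * (W12_norm A G D (\<lambda>p. s p - ?s k p))\<^sup>2 + 2 * (I k / I m)\<^sup>2 * (W12_norm A G D (?s m))\<^sup>2) sequentially"
    proof (rule always_eventually, rule allI)
      fix k
      have "(\<lambda>p. s p - g k p) = (\<lambda>p. 1 * (s p - ?s k p) + (I k / I m) * ?s m p)"
        by (simp add: g_def fun_eq_iff)
      then show "(W12_norm A G D (\<lambda>p. s p - g k p))\<^sup>2
       \<le> 2 * 1\<^sup>2 * (W12_norm A G D (\<lambda>p. s p - ?s k p))\<^sup>2 + 2 * (I k / I m)\<^sup>2 * (W12_norm A G D (?s m))\<^sup>2"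
        using W12_lincomb(2)[OF W12_diff[OF ss(2) trunc_W12[OF ss, of k]] trunc_W12[OF ss, of m], of 1 "I k / I m"]
        by (simp only:)
    qed
    have "(\<lambda>k. 2 * 1\<^sup>2 * (W12_norm A G D (\<lambda>p. s p - ?s k p))\<^sup>2 + 2 * (I k * inverse (I m))\<^sup>2 * (W12_norm A G D (?s m))\<^sup>2)
      \<longlonglongrightarrow> 2 * 1\<^sup>2 * 0 + 2 * (0 * inverse (I m))\<^sup>2 * (W12_norm A G D (?s m))\<^sup>2"
      by (intro tendsto_intros trunc_W12_norm_tendsto ss I0)
    then show "(\<lambda>k. 2 * 1\<^sup>2 * (W12_norm A G D (\<lambda>p. s p - ?s k p))\<^sup>2 + 2 * (I k / I m)\<^sup>2 * (W12_norm A G D (?s m))\<^sup>2) \<longlonglongrightarrow> 0"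
      by (simp add: divide_inverse)
  qed simp
  then obtain k where "W12_norm A G D (\<lambda>p. s p - g k p) < \<epsilon>"
    using small_norm_if_square_tendsto[OF _ \<epsilon>, of "\<lambda>k p. s p - g k p"] by blast
  with gG show "\<exists>t\<in>Gc A G D \<inter> W12 A G D. W12_norm A G D (\<lambda>p. s p - t p) < \<epsilon>" by blast
qed

end

theorem theoremZ:
  fixes A :: "('m::{t2_space, second_countable_topology}, 'n::finite) chart set"
    and G :: "('m, 'n) chart \<Rightarrow> 'm \<Rightarrow> real ^ 'n ^ 'n"
    and D :: "'m set"
  assumes "riemannian_manifold A G"
    and "generalized_Lipschitz_domain TYPE('d::{t2_space, second_countable_topology}) A D"
    and "frontier (closure D) = frontier D"
  shows "W12_closure A G D (F0 A D \<inter> W12 A G D) = E_space A G D \<and>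
         W12_closure A G D (F1 A D) = E_space A G D \<and>
         W12_closure A G D (Fc A D) = E_space A G D \<and>
         E_space A G D = W12_0 A G D \<and>
         H_space A G D = W12_closure A G D (Gc A G D)"
proof -
  have "open D" using assms(2) by (simp add: generalized_Lipschitz_domain_def)
  then interpret riemannian_open A G D
    using assms(1) by unfold_locales
  show ?thesis
    unfolding E_space_def H_space_def W12_0_def
    using closure_F0_subset_closure_Fc closure_Fc_subset_closure_F1 closure_F1_subset_closure_F0
      closure_Gc_subset_H H_subset_closure_Gc by blast
qed

end
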